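(* Let $d\ge1$ and $n$ be integers and let $\mathcal{T}_{n,d+1}$ be the set of all trees of order $n$ with maximum degree $d+1$. Then the $(d+1)$-greedy tree $T_{d+1}^*$ is the unique tree in $\mathcal{T}_{n,d+1}$ with minimum incidence energy: for every $T\in\mathcal{T}_{n,d+1}$, $$IE(T_{d+1}^* )\le IE(T),$$ with equality if and only if $T=T_{d+1}^*$ (up to isomorphism).
   Context: For a graph $G$ with vertices $v_1,\dots,v_n$ and edges $e_1,\dots,e_m$, the incidence matrix $I(G)$ is the $n\times m$ matrix whose $(i,j)$-entry is $1$ if $v_i$ is incident with $e_j$ and $0$ otherwise. The incidence energy $IE(G)$ is the sum of the singular values of $I(G)$, i.e. the sum of the square roots of the eigenvalues of $I(G)I(G)^T$. A rooted $d$-ary tree is a rooted tree in which every vertex has $0$ or $d$ children. The complete $d$-ary tree $C_h$ is the rooted $d$-ary tree all of whose leaves are at distance $h-1$ from the root ($C_1$ is a single vertex). For a vertex $u$ of a rooted tree, $T(u)$ denotes the subtree induced by $u$ and all its descendants, rooted at $u$. The $(d+1)$-greedy tree $T_{d+1}^*$ (of order $n$) is a rooted tree with root $v_0$ and maximum degree $d+1$ such that: (1) $\deg(v_0)=d+1$; (2) the heights (distances to $v_0$) of any two pendent vertices differ by at most $1$; (3) for every vertex $v$, at most one of the subtrees $T(u)$, $u$ a child of $v$, is not a complete $d$-ary tree.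
   Formalization: Conditions (1)–(3) do not determine the greedy tree (for d=2, n=19 two non-isomorphic trees satisfy them), so a condition is added: every vertex at least two levels above some other vertex has degree d+1, i.e. all levels except possibly the last are full. *)

theory Defs
  imports "Jordan_Normal_Form.Spectral_Radius"
begin

section \<open>Finite simple graphs and trees\<close>

record 'a ugraph =
  gverts :: "'a set"
  gedges :: "'a set set"

definition simple_graph :: "'a ugraph \<Rightarrow> bool" where
  "simple_graph G \<longleftrightarrow>
     finite (gverts G) \<and> (\<forall>e\<in>gedges G. e \<subseteq> gverts G \<and> card e = 2)"

definition adjacent :: "'a ugraph \<Rightarrow> 'a \<Rightarrow> 'a \<Rightarrow> bool" where
  "adjacent G u v \<longleftrightarrow> {u, v} \<in> gedges G"

definition gdegree :: "'a ugraph \<Rightarrow> 'a \<Rightarrow> nat" where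
  "gdegree G v = card {e \<in> gedges G. v \<in> e}"

definition max_degree :: "'a ugraph \<Rightarrow> nat" where
  "max_degree G = Max (gdegree G ` gverts G)"

definition walk :: "'a ugraph \<Rightarrow> 'a list \<Rightarrow> bool" where
  "walk G p \<longleftrightarrow> p \<noteq> [] \<and> set p \<subseteq> gverts G \<and> successively (adjacent G) p"

definition connected_graph :: "'a ugraph \<Rightarrow> bool" where
  "connected_graph G \<longleftrightarrow> gverts G \<noteq> {} \<and>
     (\<forall>u\<in>gverts G. \<forall>v\<in>gverts G. \<exists>p. walk G p \<and> hd p = u \<and> last p = v)"

definition is_cycle :: "'a ugraph \<Rightarrow> 'a list \<Rightarrow> bool" where
  "is_cycle G p \<longleftrightarrow> walk G p \<and> distinct p \<and> length p \<ge> 3 \<and> adjacent G (last p) (hd p)"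

definition is_tree :: "'a ugraph \<Rightarrow> bool" where
  "is_tree G \<longleftrightarrow> simple_graph G \<and> connected_graph G \<and> (\<nexists>p. is_cycle G p)"

text \<open>Number of edges of a shortest walk; only meaningful for vertices joined by a walk.\<close>

definition gdist :: "'a ugraph \<Rightarrow> 'a \<Rightarrow> 'a \<Rightarrow> nat" where
  "gdist G u v = (LEAST k. \<exists>p. walk G p \<and> hd p = u \<and> last p = v \<and> length p = Suc k)"

definition induced_subgraph :: "'a ugraph \<Rightarrow> 'a set \<Rightarrow> 'a ugraph" where
  "induced_subgraph G W = \<lparr>gverts = W, gedges = {e \<in> gedges G. e \<subseteq> W}\<rparr>"

definition graph_isomorphic :: "'a ugraph \<Rightarrow> 'b ugraph \<Rightarrow> bool" where
  "graph_isomorphic G H \<longleftrightarrow>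
     (\<exists>f. bij_betw f (gverts G) (gverts H) \<and>
        (\<forall>u\<in>gverts G. \<forall>v\<in>gverts G. adjacent G u v \<longleftrightarrow> adjacent H (f u) (f v)))"

definition trees_of_order_max_degree :: "nat \<Rightarrow> nat \<Rightarrow> 'a ugraph set" where
  "trees_of_order_max_degree n D =
     {T. is_tree T \<and> card (gverts T) = n \<and> max_degree T = D}"


section \<open>Rooted trees\<close>

definition children :: "'a ugraph \<Rightarrow> 'a \<Rightarrow> 'a \<Rightarrow> 'a set" where
  "children G r v =
     {u \<in> gverts G. adjacent G v u \<and> gdist G r u = Suc (gdist G r v)}"

definition descendants :: "'a ugraph \<Rightarrow> 'a \<Rightarrow> 'a \<Rightarrow> 'a set" where
  "descendants G r u = {w. (\<lambda>x y. y \<in> children G r x)\<^sup>*\<^sup>* u w}"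

definition subtree :: "'a ugraph \<Rightarrow> 'a \<Rightarrow> 'a \<Rightarrow> 'a ugraph" where
  "subtree G r u = induced_subgraph G (descendants G r u)"

definition dary_tree :: "nat \<Rightarrow> 'a ugraph \<Rightarrow> 'a \<Rightarrow> bool" where
  "dary_tree d G r \<longleftrightarrow> is_tree G \<and> r \<in> gverts G \<and>
     (\<forall>v\<in>gverts G. card (children G r v) = 0 \<or> card (children G r v) = d)"

definition complete_dary_tree :: "nat \<Rightarrow> nat \<Rightarrow> 'a ugraph \<Rightarrow> 'a \<Rightarrow> bool" where
  "complete_dary_tree d h G r \<longleftrightarrow> h \<ge> 1 \<and> dary_tree d G r \<and>
     (\<forall>v\<in>gverts G. children G r v = {} \<longrightarrow> gdist G r v = h - 1)"

text \<open>The four conditions on the root \<open>r\<close> are, in this order: the root has degree \<open>d + 1\<close>;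
  the heights of any two pendent vertices differ by at most one; for every vertex, at most one
  of the subtrees at its children is not a complete \<open>d\<close>-ary tree; and every vertex lying at least
  two levels above some other vertex has the full degree \<open>d + 1\<close>, i.e. all levels except possibly
  the last one are completely filled.

  The last condition has to be spelled out, because the first three do not determine
  the tree. For example, let \<open>d = 2\<close> and let two of the three subtrees at the children of the
  root be \<open>C\<^sub>3\<close>. If the remaining child has \<open>C\<^sub>2\<close> as its only branch, the first three conditions
  hold; but they also hold if that child has a leaf and a two-vertex path as its branches,
  which gives a different tree, also with 19 vertices, and only in this one all levels
  but the last are filled.\<close>

definition greedy_rooted :: "nat \<Rightarrow> 'a ugraph \<Rightarrow> 'a \<Rightarrow> bool" where
  "greedy_rooted d G r \<longleftrightarrow> is_tree G \<and> r \<in> gverts G \<and> max_degree G = d + 1 \<and>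
     gdegree G r = d + 1 \<and>
     (\<forall>x\<in>gverts G. \<forall>y\<in>gverts G. gdegree G x = 1 \<longrightarrow> gdegree G y = 1 \<longrightarrow>
        gdist G r x \<le> gdist G r y + 1) \<and>
     (\<forall>v\<in>gverts G.
        card {u \<in> children G r v. \<nexists>h. complete_dary_tree d h (subtree G r u) u} \<le> 1) \<and>
     (\<forall>x\<in>gverts G. \<forall>y\<in>gverts G. gdist G r x + 2 \<le> gdist G r y \<longrightarrow> gdegree G x = d + 1)"

definition greedy_tree :: "nat \<Rightarrow> nat \<Rightarrow> 'a ugraph \<Rightarrow> bool" where
  "greedy_tree n d G \<longleftrightarrow> card (gverts G) = n \<and> (\<exists>r. greedy_rooted d G r)"


section \<open>Incidence energy\<close>

definition incidence_mat :: "'a list \<Rightarrow> 'a set list \<Rightarrow> real mat" where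
  "incidence_mat vs es =
     mat (length vs) (length es) (\<lambda>(i, j). if vs ! i \<in> es ! j then 1 else 0)"

text \<open>The sum of the singular values, i.e. of the square roots of the eigenvalues of \<open>A A\<^sup>T\<close>,
  each counted with its multiplicity.\<close>

definition singular_value_sum :: "real mat \<Rightarrow> real" where
  "singular_value_sum A =
     (\<Sum>k\<in>spectrum (A * transpose_mat A).
        real (Polynomial.order k (char_poly (A * transpose_mat A))) * sqrt k)"

text \<open>The numbering of the vertices and edges is arbitrary;
  lemma \<open>incidence_energy_eq\<close> below shows that the value does not depend on it.\<close>

definition incidence_energy :: "'a ugraph \<Rightarrow> real" where
  "incidence_energy G = singular_value_sum (incidence_mat
     (SOME vs. distinct vs \<and> set vs = gverts G)
     (SOME es. distinct es \<and> set es = gedges G))"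

lemma incidence_mat_gram:
  assumes "distinct es" "i < length vs" "j < length vs"
  shows "(incidence_mat vs es * transpose_mat (incidence_mat vs es)) $$ (i, j) =
    real (card {e \<in> set es. vs ! i \<in> e \<and> vs ! j \<in> e})"
proof -
  have "(incidence_mat vs es * transpose_mat (incidence_mat vs es)) $$ (i, j) =
      (\<Sum>k<length es. if vs ! i \<in> es ! k \<and> vs ! j \<in> es ! k then 1 else 0)"
    using assms(2,3)
    by (auto simp: incidence_mat_def scalar_prod_def lessThan_atLeast0 intro!: sum.cong)
  also have "\<dots> = (\<Sum>e\<in>set es. if vs ! i \<in> e \<and> vs ! j \<in> e then 1 else 0)"
    using bij_betw_nth[OF assms(1) refl refl]
    by (rule sum.reindex_bij_betw)
  also have "\<dots> = real (card {e \<in> set es. vs ! i \<in> e \<and> vs ! j \<in> e})"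
    by (simp add: sum.If_cases Int_def)
  finally show ?thesis .
qed

lemma similar_mat_reindex:
  fixes A B :: "real mat"
  assumes A: "A \<in> carrier_mat n n" and B: "B \<in> carrier_mat n n"
    and p: "bij_betw p {..<n} {..<n}"
    and AB: "\<And>i j. i < n \<Longrightarrow> j < n \<Longrightarrow> A $$ (i, j) = B $$ (p i, p j)"
  shows "similar_mat A B"
proof -
  define P :: "real mat" where "P = mat n n (\<lambda>(i, j). if j = p i then 1 else 0)"
  have pn: "p i < n" if "i < n" for i
    using p that by (auto simp: bij_betw_def)
  have pinj: "p i = p j \<longleftrightarrow> i = j" if "i < n" "j < n" for i j
    using p that by (auto simp: bij_betw_def inj_on_def)
  have P: "P \<in> carrier_mat n n" by (simp add: P_def)
  have PX: "(P * X) $$ (i, j) = X $$ (p i, j)"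
    if "X \<in> carrier_mat n n" "i < n" "j < n" for X i j
    using that pn[OF that(2)]
    by (auto simp: P_def scalar_prod_def if_distrib[of "\<lambda>x. x * _"] cong: if_cong)
  have XP: "(X * transpose_mat P) $$ (i, j) = X $$ (i, p j)"
    if "X \<in> carrier_mat n n" "i < n" "j < n" for X i j
    using that pn[OF that(3)]
    by (auto simp: P_def scalar_prod_def if_distrib[of "\<lambda>x. _ * x"] cong: if_cong)
  have PT: "P * transpose_mat P = 1\<^sub>m n"
  proof (intro eq_matI)
    fix i j assume "i < dim_row (1\<^sub>m n :: real mat)" "j < dim_col (1\<^sub>m n :: real mat)"
    then have ij: "i < n" "j < n" by auto
    show "(P * transpose_mat P) $$ (i, j) = 1\<^sub>m n $$ (i, j)"
      using ij pn[OF ij(2)] pinj[OF ij] unfolding XP[OF P ij] by (auto simp: P_def)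
  qed (use P in auto)
  have TP: "transpose_mat P * P = 1\<^sub>m n"
    using mat_mult_left_right_inverse[OF P _ PT] P by simp
  have "A = P * B * transpose_mat P"
  proof (intro eq_matI)
    fix i j assume "i < dim_row (P * B * transpose_mat P)" "j < dim_col (P * B * transpose_mat P)"
    then have ij: "i < n" "j < n" using P by auto
    have "(P * B * transpose_mat P) $$ (i, j) = (P * B) $$ (i, p j)"
      using P B ij by (intro XP) auto
    also have "\<dots> = B $$ (p i, p j)"
      using PX[OF B ij(1) pn[OF ij(2)]] .
    finally show "A $$ (i, j) = (P * B * transpose_mat P) $$ (i, j)"
      using AB[OF ij] by simp
  qed (use A P in auto)
  then show ?thesis
    using similar_mat_witI[OF PT TP _ A B P] P by (auto simp: similar_mat_def)
qed

lemma singular_value_sum_incidence_mat_unique: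
  assumes "distinct vs" "distinct vs'" "set vs = set vs'"
    and "distinct es" "distinct es'" "set es = set es'"
  shows "singular_value_sum (incidence_mat vs es) = singular_value_sum (incidence_mat vs' es')"
proof -
  let ?n = "length vs"
  let ?gram = "\<lambda>vs es. incidence_mat vs es * transpose_mat (incidence_mat vs es)"
  have len: "length vs' = ?n"
    using assms(1-3) by (metis distinct_card)
  have b: "bij_betw ((!) vs) {..<?n} (set vs)" "bij_betw ((!) vs') {..<?n} (set vs)"
    using bij_betw_nth[OF assms(1) refl refl] bij_betw_nth[OF assms(2) refl refl] assms(3) len
    by auto
  define p where "p = inv_into {..<?n} ((!) vs') \<circ> (!) vs"
  have p: "bij_betw p {..<?n} {..<?n}"
    unfolding p_def using b by (blast intro: bij_betw_trans bij_betw_inv_into)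
  have pn: "p i < ?n" "vs' ! p i = vs ! i" if "i < ?n" for i
    using p b that bij_betw_inv_into_right[OF b(2), of "vs ! i"] by (auto simp: p_def bij_betw_def)
  have C: "?gram vs es \<in> carrier_mat ?n ?n" "?gram vs' es' \<in> carrier_mat ?n ?n"
    by (auto simp: incidence_mat_def len)
  have "similar_mat (?gram vs es) (?gram vs' es')"
    by (rule similar_mat_reindex[OF C p])
      (simp add: incidence_mat_gram assms len pn del: index_mult_mat)
  then have cp: "char_poly (?gram vs es) = char_poly (?gram vs' es')"
    by (rule char_poly_similar)
  then have "spectrum (?gram vs es) = spectrum (?gram vs' es')"
    using spectrum_root_char_poly[OF C(1)] spectrum_root_char_poly[OF C(2)] by simp
  with cp show ?thesis by (simp add: singular_value_sum_def)
qed

lemma incidence_energy_eq: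
  assumes "distinct vs" "set vs = gverts G" "distinct es" "set es = gedges G"
  shows "incidence_energy G = singular_value_sum (incidence_mat vs es)"
proof -
  have 1: "distinct (SOME vs. distinct vs \<and> set vs = gverts G) \<and>
      set (SOME vs. distinct vs \<and> set vs = gverts G) = gverts G"
    by (rule someI[of _ vs]) (use assms in simp)
  have 2: "distinct (SOME es. distinct es \<and> set es = gedges G) \<and>
      set (SOME es. distinct es \<and> set es = gedges G) = gedges G"
    by (rule someI[of _ es]) (use assms in simp)
  show ?thesis
    unfolding incidence_energy_def
    by (rule singular_value_sum_incidence_mat_unique) (use 1 2 assms in auto)
qed

end

theory Submission
  imports Defs "HOL-Real_Asymp.Real_Asymp"
begin

text \<open>The singular values enter through \<open>\<pi> * sqrt l = \<integral> ln (1 + l / s\<^sup>2) ds\<close> over the positive axis,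
  so it suffices to minimise \<open>det (x I + Q)\<close> for every \<open>x > 0\<close>, where \<open>Q\<close> is the Gram matrix of the
  incidence matrix. Gaussian elimination from the leaves turns this determinant into a product over
  the vertices of a rooted tree, governed by the recursion \<open>c(v) = x + \<Sum> c(u) / (1 + c(u))\<close> over the
  children \<open>u\<close> of \<open>v\<close>, the conductance of an electrical network. As a function of the branches at two
  fixed vertices it is bilinear, and exchanging branches is a strictly concave move; so in a minimiser
  the branches at one of the two vertices dominate those at the other one. Propagated along paths,
  this compares depths: of two disjoint branches, one is filled down to at least the height of
  the other one. Rooted at its centre, a minimiser is therefore the greedy tree.\<close>

section \<open>Branches as trees with empty slots\<close>

text \<open>Optimality is defined for one fixed \<open>x\<close>, because flows and weights depend
  on \<open>x\<close> and a minimiser might change with it. What is deduced from it, however, is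
  purely combinatorial: the order of two flows is decided by comparing \<open>void_depth\<close>
  with \<open>height\<close>. So every single \<open>x\<close> leads to the same tree, and
  strictness at each \<open>x\<close> survives the integration. No competitor is compared with the
  greedy tree by hand. There are finitely many competitors, so a minimiser exists; it can be
  rerooted into greedy form; and a greedy form is determined by its number of nodes. The competitors
  have degrees at most \<open>d + 1\<close>, not maximum degree exactly \<open>d + 1\<close>,
  because an exchange with a free slot may change the maximum degree. The determinant does not see
  the root, so optimality survives moving the root along an edge. This allows any two vertices to be
  placed at the ends of a path that starts at the root.\<close>

text \<open>\<open>Void\<close> marks an unused slot, so that every vertex has exactly \<open>d\<close> slots for its children and
  moving a branch into a free slot becomes an exchange of two branches. The root of a whole tree has
  \<open>d + 1\<close> slots and is represented by the multiset of its branches.\<close>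

datatype ptree = Void | Node "ptree multiset"

primrec nodes :: "ptree \<Rightarrow> nat" where
  "nodes Void = 0"
| "nodes (Node M) = Suc (\<Sum>\<^sub># (image_mset nodes M))"

primrec regular :: "nat \<Rightarrow> ptree \<Rightarrow> bool" where
  "regular d Void \<longleftrightarrow> True"
| "regular d (Node M) \<longleftrightarrow> size M = d \<and> (\<forall>b\<in>#image_mset (regular d) M. b)"

text \<open>Give each edge conductance 1 and join each vertex to the ground with conductance
  \<open>x\<close>. A branch of conductance \<open>c\<close> in series with the edge above it
  contributes \<open>c / (1 + c)\<close>, the \<open>flow\<close> below. This network belongs to the
  Laplacian; in a tree the signless Laplacian gives the same determinants, since elimination uses
  only products of opposite off-diagonal entries.\<close>

primrec conductance :: "real \<Rightarrow> ptree \<Rightarrow> real" where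
  "conductance x Void = 0"
| "conductance x (Node M) = x + (\<Sum>c\<in>#image_mset (conductance x) M. c / (1 + c))"

definition flow :: "real \<Rightarrow> ptree \<Rightarrow> real" where
  "flow x t = conductance x t / (1 + conductance x t)"

text \<open>The product of the pivots of a branch, each of them \<open>1 + c\<close> with the 1
  coming from the edge to the parent. In \<open>root_weight\<close> the root has no such edge, and
  its pivot is its conductance alone.\<close>

primrec weight :: "real \<Rightarrow> ptree \<Rightarrow> real" where
  "weight x Void = 1"
| "weight x (Node M) = (1 + conductance x (Node M)) * \<Prod>\<^sub># (image_mset (weight x) M)"

definition root_weight :: "real \<Rightarrow> ptree multiset \<Rightarrow> real" where
  "root_weight x R = (x + (\<Sum>t\<in>#R. flow x t)) * (\<Prod>t\<in>#R. weight x t)"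

definition root_regular :: "nat \<Rightarrow> ptree multiset \<Rightarrow> bool" where
  "root_regular d R \<longleftrightarrow> size R = Suc d \<and> (\<forall>t\<in>#R. regular d t)"

definition root_nodes :: "ptree multiset \<Rightarrow> nat" where
  "root_nodes R = Suc (\<Sum>t\<in>#R. nodes t)"

text \<open>Recursion through a multiset produces equations over \<open>image_mset\<close>; these
  restatements replace them as simplification rules.\<close>

lemma regular_Node [simp]: "regular d (Node M) \<longleftrightarrow> size M = d \<and> (\<forall>t\<in>#M. regular d t)"
  by simp

lemma conductance_Node [simp]: "conductance x (Node M) = x + (\<Sum>t\<in>#M. flow x t)"
  by (simp add: flow_def[abs_def] image_mset.compositionality comp_def)

lemma flow_Void [simp]: "flow x Void = 0"
  by (simp add: flow_def)

declare regular.simps(2) [simp del] conductance.simps(2) [simp del]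

lemma sum_image_mset_nonneg:
  fixes f :: "'a \<Rightarrow> real"
  shows "(\<And>t. t \<in># M \<Longrightarrow> f t \<ge> 0) \<Longrightarrow> (\<Sum>t\<in>#M. f t) \<ge> 0"
  by (induction M) auto

lemma conductance_nonneg: "x > 0 \<Longrightarrow> conductance x t \<ge> 0"
proof (induction t)
  case (Node M)
  then have "(\<Sum>t\<in>#M. flow x t) \<ge> 0"
    by (intro sum_image_mset_nonneg) (auto simp: flow_def)
  with Node.prems show ?case by simp
qed simp

lemma conductance_pos: "x > 0 \<Longrightarrow> t \<noteq> Void \<Longrightarrow> conductance x t > 0"
proof (cases t)
  case (Node M)
  assume "x > 0"
  then have "(\<Sum>t\<in>#M. flow x t) \<ge> 0"
    by (intro sum_image_mset_nonneg) (auto simp: flow_def conductance_nonneg)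
  with Node \<open>x > 0\<close> show ?thesis by simp
qed simp

lemma flow_nonneg: "x > 0 \<Longrightarrow> flow x t \<ge> 0"
  by (simp add: flow_def conductance_nonneg)

lemma flow_less_iff:
  "x > 0 \<Longrightarrow> flow x s < flow x t \<longleftrightarrow> conductance x s < conductance x t"
  using conductance_nonneg[of x s] conductance_nonneg[of x t]
  by (simp add: flow_def divide_simps) (auto simp: algebra_simps)

lemma weight_pos: "x > 0 \<Longrightarrow> weight x t > 0"
proof (induction t)
  case (Node M)
  then have "(\<Prod>t\<in>#M. weight x t) > 0"
    by (induction M) auto
  then show ?case
    using conductance_nonneg[OF Node.prems, of "Node M"] by (simp del: conductance_Node)
qed simp

lemma prod_weight_pos: "x > 0 \<Longrightarrow> (\<Prod>t\<in>#M. weight x t) > 0"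
  by (induction M) (auto simp: weight_pos)

text \<open>Multiplying by the flow trades the pivot \<open>1 + c\<close> for \<open>c\<close>: the
  right-hand side is \<open>root_weight x M\<close>, the determinant of the branch with the edge to
  its parent cut.\<close>

lemma weight_flow_Node:
  assumes "x > 0"
  shows "weight x (Node M) * flow x (Node M) = (x + (\<Sum>t\<in>#M. flow x t)) * (\<Prod>t\<in>#M. weight x t)"
  using conductance_nonneg[OF assms, of "Node M"] by (simp add: flow_def)

text \<open>A branch enters linearly, and only through the two numbers \<open>weight\<close> and
  \<open>weight * flow\<close>. The affine formulas along a path rest on this.\<close>

lemma root_weight_add:
  "root_weight x (add_mset t R) =
    (\<Prod>t\<in>#R. weight x t) * ((x + (\<Sum>t\<in>#R. flow x t)) * weight x t + weight x t * flow x t)"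
proof -
  have *: "(x + (f + s)) * (w * p) = p * ((x + s) * w + w * f)" for f s w p :: real
    by (simp add: algebra_simps)
  show ?thesis
    unfolding root_weight_def image_mset_add_mset sum_mset.add_mset prod_mset.add_mset by (rule *)
qed

text \<open>With \<open>s\<close> and \<open>t\<close> the conductances of the two sides of the
  edge, both root weights are the product of the weights in \<open>M\<close> and \<open>N\<close>
  times \<open>s + t + s * t\<close>, which is symmetric.\<close>

lemma root_weight_reroot:
  assumes "x > 0"
  shows "root_weight x (add_mset (Node N) M) = root_weight x (add_mset (Node M) N)"
proof -
  have *: "p * (s * ((1 + t) * q) + t * q) = q * (t * ((1 + s) * p) + s * p)" for p q s t :: real
    by (simp add: algebra_simps)
  show ?thesis
    unfolding root_weight_add weight_flow_Node[OF assms] unfolding weight.simps conductance_Node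
    by (rule *)
qed

section \<open>Optimal trees\<close>

primrec chain :: "ptree multiset list \<Rightarrow> ptree multiset \<Rightarrow> ptree" where
  "chain [] N = Node N"
| "chain (K # Ks) N = Node (add_mset (chain Ks N) K)"

text \<open>The path from the root to the vertex carrying \<open>N\<close> has one inner vertex for
  each entry of \<open>Ks\<close>. In a regular tree both ends keep \<open>d\<close> slots off the
  path, an inner vertex only \<open>d - 1\<close>.\<close>

definition spine :: "ptree multiset \<Rightarrow> ptree multiset list \<Rightarrow> ptree multiset \<Rightarrow> ptree multiset" where
  "spine M Ks N = add_mset (chain Ks N) M"

lemma chain_snoc: "chain (Ks @ [K]) N = chain Ks (add_mset (Node N) K)"
  by (induction Ks) auto

lemma regular_chain:
  "regular d (chain Ks N) \<longleftrightarrow> size N = d \<and> (\<forall>t\<in>#N. regular d t) \<and>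
    (\<forall>K\<in>set Ks. Suc (size K) = d \<and> (\<forall>t\<in>#K. regular d t))"
  by (induction Ks) auto

lemma root_regular_spine:
  "root_regular d (spine M Ks N) \<longleftrightarrow> size M = d \<and> (\<forall>t\<in>#M. regular d t) \<and>
    size N = d \<and> (\<forall>t\<in>#N. regular d t) \<and>
    (\<forall>K\<in>set Ks. Suc (size K) = d \<and> (\<forall>t\<in>#K. regular d t))"
  by (auto simp: root_regular_def spine_def regular_chain)

lemma nodes_chain:
  "nodes (chain Ks N) = Suc (\<Sum>t\<in>#N. nodes t) + (\<Sum>K\<leftarrow>Ks. Suc (\<Sum>t\<in>#K. nodes t))"
  by (induction Ks) auto

lemma root_nodes_spine:
  "root_nodes (spine M Ks N) = Suc (\<Sum>t\<in>#M. nodes t) + Suc (\<Sum>t\<in>#N. nodes t)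
    + (\<Sum>K\<leftarrow>Ks. Suc (\<Sum>t\<in>#K. nodes t))"
  by (auto simp: root_nodes_def spine_def nodes_chain)

text \<open>The two quantities have to be treated together: a new vertex in front of the chain mixes
  them with the positive coefficients \<open>1 + s\<close>, 1 and \<open>s\<close>, 1. This
  preserves affinity in the total flow of \<open>N\<close> and the sign of the slopes.\<close>

lemma weight_chain_affine:
  assumes x: "x > 0"
  shows "\<exists>p q p' q'. q > 0 \<and> (\<forall>N.
    weight x (chain Ks N) = (\<Prod>t\<in>#N. weight x t) * (p + q * (\<Sum>t\<in>#N. flow x t)) \<and>
    weight x (chain Ks N) * flow x (chain Ks N) =
      (\<Prod>t\<in>#N. weight x t) * (p' + q' * (\<Sum>t\<in>#N. flow x t))) \<and> q' > 0"
proof (induction Ks)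
  case Nil
  have "weight x (chain [] N) = (\<Prod>t\<in>#N. weight x t) * ((1 + x) + 1 * (\<Sum>t\<in>#N. flow x t)) \<and>
    weight x (chain [] N) * flow x (chain [] N) =
      (\<Prod>t\<in>#N. weight x t) * (x + 1 * (\<Sum>t\<in>#N. flow x t))" for N
    unfolding chain.simps weight_flow_Node[OF x] by (simp add: mult.commute add.assoc)
  then show ?case
    by (intro exI[of _ "1 + x"] exI[of _ 1] exI[of _ x]) auto
next
  case (Cons K Ks)
  then obtain p q p' q' where q: "q > 0" "q' > 0" and
    **: "weight x (chain Ks N) = (\<Prod>t\<in>#N. weight x t) * (p + q * (\<Sum>t\<in>#N. flow x t))"
    "weight x (chain Ks N) * flow x (chain Ks N) =
      (\<Prod>t\<in>#N. weight x t) * (p' + q' * (\<Sum>t\<in>#N. flow x t))" for N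
    by blast
  define s where "s = x + (\<Sum>t\<in>#K. flow x t)"
  define w where "w = (\<Prod>t\<in>#K. weight x t)"
  have s: "s > 0" and w: "w > 0"
    using x unfolding s_def w_def
    by (auto intro!: add_pos_nonneg sum_image_mset_nonneg prod_weight_pos simp: flow_nonneg)
  have "weight x (chain (K # Ks) N) =
      w * ((1 + s) * weight x (chain Ks N) + weight x (chain Ks N) * flow x (chain Ks N)) \<and>
    weight x (chain (K # Ks) N) * flow x (chain (K # Ks) N) =
      w * (s * weight x (chain Ks N) + weight x (chain Ks N) * flow x (chain Ks N))" for N
  proof -
    have *: "(1 + (x + (f + a))) * (p * w) = w * ((1 + (x + a)) * p + p * f) \<and>
        (x + (f + a)) * (p * w) = w * ((x + a) * p + p * f)" for f a p :: real
      by (simp add: algebra_simps)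
    show ?thesis
      unfolding chain.simps weight_flow_Node[OF x] unfolding weight.simps conductance_Node
        image_mset_add_mset sum_mset.add_mset prod_mset.add_mset s_def w_def[symmetric] by (rule *)
  qed
  then have ***: "weight x (chain (K # Ks) N) = w * ((1 + s) * weight x (chain Ks N) + weight x (chain Ks N) * flow x (chain Ks N))"
    "weight x (chain (K # Ks) N) * flow x (chain (K # Ks) N) =
      w * (s * weight x (chain Ks N) + weight x (chain Ks N) * flow x (chain Ks N))" for N
    by blast+
  have "weight x (chain (K # Ks) N) = (\<Prod>t\<in>#N. weight x t) *
      (w * ((1 + s) * p + p') + w * ((1 + s) * q + q') * (\<Sum>t\<in>#N. flow x t)) \<and>
    weight x (chain (K # Ks) N) * flow x (chain (K # Ks) N) = (\<Prod>t\<in>#N. weight x t) *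
      (w * (s * p + p') + w * (s * q + q') * (\<Sum>t\<in>#N. flow x t))" for N
  proof -
    have *: "w * ((1 + s) * (P * (p + q * S)) + P * (p' + q' * S)) =
        P * (w * ((1 + s) * p + p') + w * ((1 + s) * q + q') * S) \<and>
      w * (s * (P * (p + q * S)) + P * (p' + q' * S)) =
        P * (w * (s * p + p') + w * (s * q + q') * S)" for P S :: real
      by (simp add: algebra_simps)
    show ?thesis unfolding ***(2) unfolding ***(1) **(2) unfolding **(1) by (rule *)
  qed
  moreover have "w * ((1 + s) * q + q') > 0" "w * (s * q + q') > 0"
    using s w q by (auto intro!: mult_pos_pos add_pos_pos)
  ultimately show ?case by blast
qed

text \<open>The product of weights in front is invariant under exchanges between \<open>M\<close>
  and \<open>N\<close>, so only the bracket changes. The coefficient \<delta> is the slope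
  \<open>q\<close> of the chain; its positivity is the source of strict concavity once the total
  flow is fixed.\<close>

lemma root_weight_spine:
  assumes x: "x > 0"
  shows "\<exists>\<delta> \<alpha> \<beta> \<gamma>. \<delta> > 0 \<and> (\<forall>M N. root_weight x (spine M Ks N) =
    ((\<Prod>t\<in>#M. weight x t) * (\<Prod>t\<in>#N. weight x t)) *
    (\<alpha> + \<beta> * (\<Sum>t\<in>#M. flow x t) + \<gamma> * (\<Sum>t\<in>#N. flow x t)
      + \<delta> * ((\<Sum>t\<in>#M. flow x t) * (\<Sum>t\<in>#N. flow x t))))"
proof -
  obtain p q p' q' where q: "q > 0" and
    wc: "\<And>N. weight x (chain Ks N) = (\<Prod>t\<in>#N. weight x t) * (p + q * (\<Sum>t\<in>#N. flow x t))"
    "\<And>N. weight x (chain Ks N) * flow x (chain Ks N) =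
      (\<Prod>t\<in>#N. weight x t) * (p' + q' * (\<Sum>t\<in>#N. flow x t))"
    using weight_chain_affine[OF x, of Ks] by blast
  have *: "w' * ((x + a) * (w * (p + q * b)) + w * (p' + q' * b)) =
      (w' * w) * (x * p + p' + p * a + (x * q + q') * b + q * (a * b))" for w w' a b :: real
    by (simp add: algebra_simps)
  have "root_weight x (spine M Ks N) = ((\<Prod>t\<in>#M. weight x t) * (\<Prod>t\<in>#N. weight x t)) *
      (x * p + p' + p * (\<Sum>t\<in>#M. flow x t) + (x * q + q') * (\<Sum>t\<in>#N. flow x t)
        + q * ((\<Sum>t\<in>#M. flow x t) * (\<Sum>t\<in>#N. flow x t)))" for M N
    unfolding spine_def root_weight_add wc(2) unfolding wc(1) by (rule *)
  with q show ?thesis by (intro exI conjI allI)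
qed

definition optimal :: "real \<Rightarrow> nat \<Rightarrow> ptree multiset \<Rightarrow> bool" where
  "optimal x d R \<longleftrightarrow> root_regular d R \<and>
    (\<forall>R'. root_regular d R' \<longrightarrow> root_nodes R' = root_nodes R \<longrightarrow> root_weight x R \<le> root_weight x R')"

lemma optimal_swap:
  assumes "optimal x d (spine (add_mset b M) Ks (add_mset b' N))"
  shows "root_weight x (spine (add_mset b M) Ks (add_mset b' N))
    \<le> root_weight x (spine (add_mset b' M) Ks (add_mset b N))"
proof -
  have "root_regular d (spine (add_mset b' M) Ks (add_mset b N))"
    "root_nodes (spine (add_mset b' M) Ks (add_mset b N)) =
      root_nodes (spine (add_mset b M) Ks (add_mset b' N))"
    using assms by (auto simp: optimal_def root_regular_spine root_nodes_spine)
  with assms show ?thesis unfolding optimal_def by blast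
qed

text \<open>Exchanging two branches keeps the sum of the flows fixed, and along this line the root weight
  is a strictly concave quadratic function. So at a minimum it is impossible that one exchange
  moves flow to the left end and another one moves flow to the right end.\<close>

lemma optimal_comparable:
  assumes x: "x > 0" and opt: "optimal x d (spine M Ks N)"
    and b: "b \<in># M" "b' \<in># N" "flow x b < flow x b'"
    and c: "c \<in># M" "c' \<in># N"
  shows "flow x c \<le> flow x c'"
proof (rule ccontr)
  assume less: "\<not> flow x c \<le> flow x c'"
  obtain \<delta> \<alpha> \<beta> \<gamma> where "\<delta> > 0 \<and> (\<forall>M N. root_weight x (spine M Ks N) =
    ((\<Prod>t\<in>#M. weight x t) * (\<Prod>t\<in>#N. weight x t)) *
    (\<alpha> + \<beta> * (\<Sum>t\<in>#M. flow x t) + \<gamma> * (\<Sum>t\<in>#N. flow x t)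
      + \<delta> * ((\<Sum>t\<in>#M. flow x t) * (\<Sum>t\<in>#N. flow x t))))"
    using root_weight_spine[OF x, of Ks] by (elim exE)
  note \<delta> = this[THEN conjunct1] and rw = this[THEN conjunct2, rule_format]
  define A where "A = (\<Sum>t\<in>#M. flow x t)"
  define B where "B = (\<Sum>t\<in>#N. flow x t)"
  have key: "\<alpha> + \<beta> * A + \<gamma> * B + \<delta> * (A * B) \<le>
      \<alpha> + \<beta> * (A + e) + \<gamma> * (B - e) + \<delta> * ((A + e) * (B - e))"
    if s: "s \<in># M" "s' \<in># N" and e: "e = flow x s' - flow x s" for s s' e
  proof -
    obtain M' N' where MN: "M = add_mset s M'" "N = add_mset s' N'"
      using s by (meson mset_add)
    define W where "W = (\<Prod>t\<in>#M. weight x t) * (\<Prod>t\<in>#N. weight x t)"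
    have W: "W > 0" unfolding W_def using x by (intro mult_pos_pos prod_weight_pos)
    have "root_weight x (spine M Ks N) \<le> root_weight x (spine (add_mset s' M') Ks (add_mset s N'))"
      unfolding MN by (rule optimal_swap) (use opt MN in simp)
    also have "root_weight x (spine M Ks N) = W * (\<alpha> + \<beta> * A + \<gamma> * B + \<delta> * (A * B))"
      unfolding rw A_def B_def W_def ..
    also have "root_weight x (spine (add_mset s' M') Ks (add_mset s N')) =
        W * (\<alpha> + \<beta> * (A + e) + \<gamma> * (B - e) + \<delta> * ((A + e) * (B - e)))"
    proof -
      have "(\<Sum>t\<in>#add_mset s' M'. flow x t) = A + e" "(\<Sum>t\<in>#add_mset s N'. flow x t) = B - e"
        by (simp_all add: A_def B_def MN e)
      moreover have "(\<Prod>t\<in>#add_mset s' M'. weight x t) * (\<Prod>t\<in>#add_mset s N'. weight x t) = W"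
        unfolding W_def MN by simp
      ultimately show ?thesis unfolding rw by simp
    qed
    finally show ?thesis by (simp only: mult_le_cancel_left_pos[OF W])
  qed
  define \<epsilon> where "\<epsilon> = flow x b' - flow x b"
  define \<epsilon>' where "\<epsilon>' = flow x c - flow x c'"
  have pos: "\<epsilon> > 0" "\<epsilon>' > 0" using b less by (auto simp: \<epsilon>_def \<epsilon>'_def)
  \<comment> \<open>An exchange that moves flow \<open>e\<close> into \<open>M\<close> changes the
    bracket by \<open>e * (\<beta> - \<gamma> + \<delta> * (B - A) - \<delta> * e)\<close>. The two
    exchanges have \<open>e = \<epsilon> > 0\<close> and
    \<open>e = - \<epsilon>' < 0\<close>.\<close>
  have 1: "0 \<le> \<epsilon> * (\<beta> - \<gamma> + \<delta> * (B - A) - \<delta> * \<epsilon>)"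
    using key[OF b(1,2) \<epsilon>_def] by (simp add: algebra_simps)
  have 2: "0 \<le> - \<epsilon>' * (\<beta> - \<gamma> + \<delta> * (B - A) + \<delta> * \<epsilon>')"
    using key[OF c, of "- \<epsilon>'"] by (simp add: algebra_simps \<epsilon>'_def)
  have "0 \<le> \<beta> - \<gamma> + \<delta> * (B - A) - \<delta> * \<epsilon>"
    using 1 pos by (simp add: zero_le_mult_iff)
  moreover have "\<beta> - \<gamma> + \<delta> * (B - A) + \<delta> * \<epsilon>' \<le> 0"
    using 2 pos by (simp add: mult_le_0_iff)
  moreover have "\<delta> * \<epsilon> > 0" "\<delta> * \<epsilon>' > 0" using \<delta> pos by auto
  ultimately show False by linarith
qed

section \<open>Height and void depth of branches\<close>

primrec height :: "ptree \<Rightarrow> nat" where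
  "height Void = 0"
| "height (Node M) = Suc (Max (insert 0 (set_mset (image_mset height M))))"

text \<open>The depth of the highest void; for an empty set of slots \<open>Min\<close> is a junk value.\<close>

primrec void_depth :: "ptree \<Rightarrow> nat" where
  "void_depth Void = 0"
| "void_depth (Node M) = Suc (Min (set_mset (image_mset void_depth M)))"

definition root_height :: "ptree multiset \<Rightarrow> nat" where
  "root_height R = Max (insert 0 (height ` set_mset R))"

definition root_void_depth :: "ptree multiset \<Rightarrow> nat" where
  "root_void_depth R = Min (void_depth ` set_mset R)"

lemma height_Node [simp]: "height (Node M) = Suc (root_height M)"
  by (simp add: root_height_def)

lemma void_depth_Node [simp]: "void_depth (Node M) = Suc (root_void_depth M)"
  by (simp add: root_void_depth_def)

declare height.simps(2) [simp del] void_depth.simps(2) [simp del]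

lemma root_height_le_iff: "root_height R \<le> k \<longleftrightarrow> (\<forall>t\<in>#R. height t \<le> k)"
  by (auto simp: root_height_def)

lemma height_le_root_height: "t \<in># R \<Longrightarrow> height t \<le> root_height R"
  using root_height_le_iff by blast

lemma root_height_attained:
  assumes "R \<noteq> {#}" obtains t where "t \<in># R" "height t = root_height R"
proof -
  have "root_height R \<in> insert 0 (height ` set_mset R)"
    unfolding root_height_def by (intro Max_in) auto
  then show ?thesis using that assms height_le_root_height
    by (metis image_iff insert_iff le_zero_eq multiset_nonemptyE)
qed

lemma root_height_add: "root_height (add_mset t R) = max (height t) (root_height R)"
  by (cases "R = {#}") (auto simp: root_height_def intro: Max_insert)

lemma le_root_void_depth_iff:
  "R \<noteq> {#} \<Longrightarrow> k \<le> root_void_depth R \<longleftrightarrow> (\<forall>t\<in>#R. k \<le> void_depth t)"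
  by (auto simp: root_void_depth_def)

lemma root_void_depth_le: "t \<in># R \<Longrightarrow> root_void_depth R \<le> void_depth t"
  by (auto simp: root_void_depth_def)

lemma root_void_depth_attained:
  assumes "R \<noteq> {#}" obtains t where "t \<in># R" "void_depth t = root_void_depth R"
proof -
  have "root_void_depth R \<in> void_depth ` set_mset R"
    unfolding root_void_depth_def using assms by (intro Min_in) auto
  then show ?thesis using that by auto
qed

lemma root_void_depth_le_root_height_of:
  assumes "R \<noteq> {#}" "\<And>t. t \<in># R \<Longrightarrow> void_depth t \<le> height t"
  shows "root_void_depth R \<le> root_height R"
  using assms by (meson height_le_root_height le_trans multiset_nonemptyE root_void_depth_le)

lemma void_depth_le_height: "d \<ge> 1 \<Longrightarrow> regular d t \<Longrightarrow> void_depth t \<le> height t"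
proof (induction t)
  case (Node M)
  then have "M \<noteq> {#}" by auto
  then show ?case using Node by (auto intro!: root_void_depth_le_root_height_of)
qed simp

lemma root_void_depth_le_root_height:
  "R \<noteq> {#} \<Longrightarrow> d \<ge> 1 \<Longrightarrow> \<forall>t\<in>#R. regular d t \<Longrightarrow> root_void_depth R \<le> root_height R"
  by (rule root_void_depth_le_root_height_of) (auto simp: void_depth_le_height)

section \<open>Moving the root\<close>

inductive reroot :: "ptree multiset \<Rightarrow> ptree multiset \<Rightarrow> bool" where
  "reroot (add_mset (Node N) M) (add_mset (Node M) N)"

lemma optimal_reroot_step:
  assumes "x > 0" "optimal x d (add_mset (Node N) M)"
  shows "optimal x d (add_mset (Node M) N)"
  using assms root_weight_reroot[OF assms(1), of N M]
  by (auto simp: optimal_def root_regular_def root_nodes_def ac_simps)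

lemma optimal_reroot:
  assumes "x > 0" "reroot\<^sup>*\<^sup>* R R'" "optimal x d R"
  shows "optimal x d R'"
  using assms(2,3)
  by (induction rule: rtranclp_induct) (auto elim!: reroot.cases intro: optimal_reroot_step[OF assms(1)])

lemma root_nodes_reroot: "reroot\<^sup>*\<^sup>* R R' \<Longrightarrow> root_nodes R' = root_nodes R"
  by (induction rule: rtranclp_induct) (auto elim!: reroot.cases simp: root_nodes_def)

text \<open>The path grows by one vertex at each end: after rerooting into the left child,
  \<open>M'\<close> and \<open>N'\<close> become the side branches of the two former ends.\<close>

lemma optimal_spine_descend:
  assumes "x > 0" "optimal x d (spine (add_mset (Node M) M') Ks (add_mset (Node N) N'))"
  shows "optimal x d (spine M (M' # Ks @ [N']) N)"
proof -
  have "optimal x d (add_mset (Node M) (add_mset (chain Ks (add_mset (Node N) N')) M'))"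
    using assms(2) by (simp add: spine_def add_mset_commute)
  from optimal_reroot_step[OF assms(1) this] show ?thesis
    by (simp add: spine_def chain_snoc)
qed

text \<open>The root travels along the path to its other end, one rerooting per edge.\<close>

lemma optimal_spine_rev:
  assumes "x > 0" "optimal x d (spine M Ks N)"
  shows "optimal x d (spine N (rev Ks) M)"
  using assms(2)
proof (induction Ks arbitrary: M)
  case Nil
  then show ?case using optimal_reroot_step[OF assms(1)] by (simp add: spine_def)
next
  case (Cons K Ks)
  then have "optimal x d (spine (add_mset (Node M) K) Ks N)"
    using optimal_reroot_step[OF assms(1), of d "add_mset (chain Ks N) K" M]
    by (simp add: spine_def add_mset_commute)
  from Cons.IH[OF this] show ?case by (simp add: spine_def chain_snoc)
qed

section \<open>From flows to depths\<close>

lemma sum_mset_le_separated: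
  fixes f g :: "'a \<Rightarrow> real"
  assumes "size M = size N" "\<And>s t. s \<in># M \<Longrightarrow> t \<in># N \<Longrightarrow> f s \<le> f t"
  shows "(\<Sum>t\<in>#M. f t) \<le> (\<Sum>t\<in>#N. f t)"
  using assms
proof (induction M arbitrary: N)
  case (add s M)
  then obtain t N' where "N = add_mset t N'" by (metis size_eq_Suc_imp_eq_union size_add_mset)
  with add show ?case by (auto intro!: add_mono)
qed simp

text \<open>Descend at both ends at once, in \<open>b\<close> towards a highest void and in
  \<open>b'\<close> towards a deepest vertex, so that the two slots stay at the ends of a growing
  path. The descent in \<open>b\<close> stops first, at a \<open>Void\<close> facing a
  \<open>Node\<close>, whose flow is positive. On the way back, one strictly smaller pair of slots
  forces every slot of the first vertex to be at most every slot of the second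
  (\<open>optimal_comparable\<close>), so the conductances compare strictly.\<close>

lemma optimal_flow_less:
  assumes x: "x > 0" and "d \<ge> 1" "optimal x d (spine M Ks N)"
    "b \<in># M" "b' \<in># N" "void_depth b < height b'"
  shows "flow x b < flow x b'"
  using assms(3-)
proof (induction b arbitrary: M Ks N b')
  case Void
  then have "b' \<noteq> Void" by auto
  then show ?case
    using conductance_pos[OF x, of b'] by (simp add: flow_def)
next
  case (Node M\<^sub>0)
  then obtain N\<^sub>0 where b': "b' = Node N\<^sub>0" by (cases b') auto
  obtain M' N' where MN: "M = add_mset (Node M\<^sub>0) M'" "N = add_mset (Node N\<^sub>0) N'"
    using Node.prems(2,3) b' by (meson mset_add)
  have opt: "optimal x d (spine M\<^sub>0 (M' # Ks @ [N']) N\<^sub>0)"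
    using optimal_spine_descend[OF x] Node.prems(1) MN by blast
  then have size: "size M\<^sub>0 = d" "size N\<^sub>0 = d"
    by (auto simp: optimal_def root_regular_spine)
  then have ne: "M\<^sub>0 \<noteq> {#}" "N\<^sub>0 \<noteq> {#}" using \<open>d \<ge> 1\<close> by auto
  obtain s t where s: "s \<in># M\<^sub>0" "void_depth s = root_void_depth M\<^sub>0"
    and t: "t \<in># N\<^sub>0" "height t = root_height N\<^sub>0"
    using root_void_depth_attained[OF ne(1)] root_height_attained[OF ne(2)] by metis
  have "void_depth s < height t" using Node.prems(4) b' s t by simp
  then have less: "flow x s < flow x t"
    using Node.IH[OF s(1) opt s(1) t(1)] by blast
  obtain M\<^sub>1 N\<^sub>1 where MN1: "M\<^sub>0 = add_mset s M\<^sub>1" "N\<^sub>0 = add_mset t N\<^sub>1"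
    using s(1) t(1) by (meson mset_add)
  have "(\<Sum>t\<in>#M\<^sub>1. flow x t) \<le> (\<Sum>t\<in>#N\<^sub>1. flow x t)"
  proof (rule sum_mset_le_separated)
    show "size M\<^sub>1 = size N\<^sub>1" using size MN1 by simp
    show "flow x u \<le> flow x v" if "u \<in># M\<^sub>1" "v \<in># N\<^sub>1" for u v
      using optimal_comparable[OF x opt s(1) t(1) less, of u v] that MN1 by simp
  qed
  then have "conductance x (Node M\<^sub>0) < conductance x (Node N\<^sub>0)"
    using less MN1 by simp
  then show ?case unfolding b' by (simp only: flow_less_iff[OF x])
qed

text \<open>If both inequalities failed, \<open>optimal_flow_less\<close> would give a slot of
  \<open>M\<close> with less flow than one of \<open>N\<close> and a slot of \<open>N\<close> with
  less flow than one of \<open>M\<close>; \<open>optimal_comparable\<close> excludes this.\<close>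

lemma optimal_separated:
  assumes x: "x > 0" and d: "d \<ge> 1" and opt: "optimal x d (spine M Ks N)"
  shows "root_height N \<le> root_void_depth M \<or> root_height M \<le> root_void_depth N"
proof (rule ccontr)
  assume contr: "\<not> ?thesis"
  have ne: "M \<noteq> {#}" "N \<noteq> {#}"
    using opt d by (auto simp: optimal_def root_regular_spine)
  obtain s t where st: "s \<in># M" "void_depth s = root_void_depth M"
      "t \<in># M" "height t = root_height M"
    using root_void_depth_attained[OF ne(1)] root_height_attained[OF ne(1)] by metis
  obtain s' t' where st': "s' \<in># N" "void_depth s' = root_void_depth N"
      "t' \<in># N" "height t' = root_height N"
    using root_void_depth_attained[OF ne(2)] root_height_attained[OF ne(2)] by metis
  have "flow x s < flow x t'"
    using optimal_flow_less[OF x d opt st(1) st'(3)] contr st st' by simp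
  moreover have "flow x s' < flow x t"
    using optimal_flow_less[OF x d optimal_spine_rev[OF x opt] st'(1) st(3)] contr st st' by simp
  ultimately show False
    using optimal_comparable[OF x opt st(1) st'(3) _ st(3) st'(1)] by simp
qed

lemma optimal_edge:
  assumes "x > 0" "d \<ge> 1" "optimal x d (add_mset (Node N) M)"
  shows "root_height N \<le> root_void_depth M \<or> root_height M \<le> root_void_depth N"
  using optimal_separated[of x d M "[]" N] assms by (simp add: spine_def)

text \<open>Rerooting into \<open>s\<close> turns the two tops into the ends of a path with the old
  root as its only inner vertex. A \<open>Void\<close> satisfies the claim trivially, having height
  0.\<close>

lemma optimal_siblings:
  assumes "x > 0" "d \<ge> 1" "optimal x d (add_mset s (add_mset t K))"
  shows "height s \<le> void_depth t \<or> height t \<le> void_depth s"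
proof (cases s; cases t)
  fix M N assume st: "s = Node M" "t = Node N"
  then have "optimal x d (spine M [K] N)"
    using optimal_reroot_step[OF assms(1), of d M "add_mset t K"] assms(3)
    by (simp add: spine_def)
  from optimal_separated[OF assms(1,2) this] show ?thesis using st by auto
qed auto

section \<open>The centre of an optimal tree\<close>

lemma regular_1_void_depth: "regular 1 t \<Longrightarrow> void_depth t = height t"
proof (induction t)
  case (Node M)
  then obtain s where "M = {#s#}" using size_1_singleton_mset by fastforce
  with Node show ?case by (simp add: root_void_depth_def root_height_def)
qed simp

text \<open>Both sides of the edge have height \<open>k\<close> and the side of \<open>M\<close> is
  full. It remains to fill \<open>N\<close> down to \<open>k - 1\<close>. Comparing the two sides of
  this edge says nothing more about \<open>N\<close>, so the argument goes one level down, to a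
  deepest branch of \<open>N\<close>.\<close>

lemma optimal_bicentral:
  assumes x: "x > 0" and d: "d \<ge> 1" and opt: "optimal x d (add_mset (Node N) M)"
    and hM: "root_height M = k" and hN: "root_height N = k" and k: "k \<le> root_void_depth M"
  shows "root_height (add_mset (Node N) M) \<le> Suc (root_void_depth (add_mset (Node N) M))"
proof -
  have reg: "size M = d" "size N = d" "\<forall>t\<in>#M. regular d t" "\<forall>t\<in>#N. regular d t"
    using opt by (auto simp: optimal_def root_regular_def)
  have ne: "M \<noteq> {#}" "N \<noteq> {#}" using reg(1,2) d by auto
  \<comment> \<open>Cut the edge above the deepest branch \<open>D\<close>. The far side contains
    \<open>M\<close> and has height above \<open>k\<close>, which exceeds any void depth below
    \<open>D\<close>. So by \<open>optimal_edge\<close> the far side is filled to the height of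
    \<open>K\<close>, which is \<open>k - 1\<close>.\<close>
  have rest: "k - 1 \<le> void_depth t"
    if D: "N = add_mset D N'" "height D = k" "k > 0" and t: "t \<in># N'" for D N' t
  proof -
    obtain K where K: "D = Node K" using D by (cases D) auto
    have "K \<noteq> {#}" using D K reg(4) d by auto
    then have le: "root_void_depth K \<le> root_height K"
      using D K reg(4) d by (intro root_void_depth_le_root_height) auto
    have "optimal x d (add_mset (Node K) (add_mset (Node M) N'))"
      using optimal_reroot_step[OF x opt] D K by (simp add: add_mset_commute)
    from optimal_edge[OF x d this]
    have "root_height K \<le> root_void_depth (add_mset (Node M) N') \<or>
      root_height (add_mset (Node M) N') \<le> root_void_depth K" .
    moreover have "root_height (add_mset (Node M) N') \<ge> Suc k"
      using hM by (simp add: root_height_add)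
    ultimately have "root_height K \<le> root_void_depth (add_mset (Node M) N')"
      using le D K by auto
    then show ?thesis
      using root_void_depth_le[of t "add_mset (Node M) N'"] t D K by simp
  qed
  have N: "k - 1 \<le> root_void_depth N"
  proof (cases "k = 0")
    case False
    obtain D where "D \<in># N" and hD: "height D = k"
      using root_height_attained[OF ne(2)] hN by metis
    then obtain N' where N: "N = add_mset D N'" by (meson mset_add)
    \<comment> \<open>\<open>D\<close> itself is reached through a sibling \<open>D'\<close>: either
      \<open>D'\<close> has height \<open>k\<close> too and \<open>rest\<close> applies with the
      roles exchanged, or \<open>D\<close> is filled to the height of \<open>D'\<close>, which is at
      least \<open>k - 1\<close> by \<open>rest\<close>.\<close>
    have "k - 1 \<le> void_depth D"
    proof (cases "N' = {#}")
      case True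
      \<comment> \<open>Without a sibling of \<open>D\<close> all branches are paths, whose only
        void is at the bottom.\<close>
      then have "d = 1" using N reg(2) by simp
      then show ?thesis using regular_1_void_depth[of D] N reg(4) hD by simp
    next
      case ne: False
      then obtain D' N'' where N': "N' = add_mset D' N''" by (meson multiset_cases)
      have "optimal x d (add_mset D (add_mset D' (add_mset (Node M) N'')))"
        using optimal_reroot_step[OF x opt] N N' by (simp add: add_mset_commute)
      from optimal_siblings[OF x d this] show ?thesis
      proof
        assume le: "height D \<le> void_depth D'"
        have "void_depth D' \<le> height D'"
          using N N' reg(4) d by (intro void_depth_le_height) auto
        moreover have "height D' \<le> k" using height_le_root_height[of D' N] hN N N' by simp
        ultimately have "height D' = k" using le hD by simp
        with rest[of D' "add_mset D N''" D] show ?thesis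
          using N N' False by (simp add: add_mset_commute)
      next
        assume "height D' \<le> void_depth D"
        moreover have "void_depth D' \<le> height D'"
          using N N' reg(4) d by (intro void_depth_le_height) auto
        moreover have "k - 1 \<le> void_depth D'"
          using rest[OF N hD, of D'] False N' by simp
        ultimately show ?thesis by simp
      qed
    qed
    then show ?thesis
      using rest[OF N hD] False N le_root_void_depth_iff[OF ne(2)] by auto
  qed simp
  have "k \<le> root_void_depth (add_mset (Node N) M)"
    using N k le_root_void_depth_iff[OF ne(1), of k] by (auto simp: le_root_void_depth_iff)
  then show ?thesis using hM hN by (simp add: root_height_add)
qed

text \<open>Take a rerooting of least height \<open>e\<close>. A step into a deepest branch cannot
  lower the height, so the remaining branches have height \<open>e\<close> or \<open>e - 1\<close>:
  the centre is a vertex or an edge.\<close>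

lemma optimal_center:
  assumes x: "x > 0" and d: "d \<ge> 1" and opt: "optimal x d R"
  obtains R' where "reroot\<^sup>*\<^sup>* R R'" "root_height R' \<le> Suc (root_void_depth R')"
proof -
  obtain R\<^sub>0 where R0: "reroot\<^sup>*\<^sup>* R R\<^sub>0"
    and min: "\<And>R'. reroot\<^sup>*\<^sup>* R R' \<Longrightarrow> root_height R\<^sub>0 \<le> root_height R'"
    using ex_has_least_nat[of "reroot\<^sup>*\<^sup>* R" R root_height] by auto
  have opt0: "optimal x d R\<^sub>0" using optimal_reroot[OF x R0 opt] .
  then have reg: "root_regular d R\<^sub>0" by (simp add: optimal_def)
  then have ne: "R\<^sub>0 \<noteq> {#}" by (auto simp: root_regular_def)
  define e where "e = root_height R\<^sub>0"
  show ?thesis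
  proof (cases "e = 0")
    case True
    then show ?thesis using that[OF R0] by (simp add: e_def)
  next
    case False
    obtain b where b: "b \<in># R\<^sub>0" "height b = e"
      using root_height_attained[OF ne] e_def by metis
    then obtain N where "b = Node N" and hN: "Suc (root_height N) = e"
      using False by (cases b) auto
    then obtain M where R: "R\<^sub>0 = add_mset (Node N) M" using b(1) by (meson mset_add)
    have regs: "size M = d" "size N = d" "\<forall>t\<in>#M. regular d t" "\<forall>t\<in>#N. regular d t"
      using reg R by (auto simp: root_regular_def)
    have neMN: "M \<noteq> {#}" "N \<noteq> {#}" using regs(1,2) d by auto
    have step: "reroot\<^sup>*\<^sup>* R (add_mset (Node M) N)"
      using R0 reroot.intros[of N M] unfolding R by (rule rtranclp.rtrancl_into_rtrancl)
    have optMN: "optimal x d (add_mset (Node N) M)" "optimal x d (add_mset (Node M) N)"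
      using opt0 R optimal_reroot_step[OF x] by auto
    have "e \<le> Suc (root_height M)"
      using min[OF step] hN unfolding e_def[symmetric] by (simp add: root_height_add)
    moreover have hM: "root_height M \<le> e" unfolding e_def R by (simp add: root_height_add)
    ultimately consider "root_height M = e" | "root_height M = root_height N"
      using hN by linarith
    then show ?thesis
    proof cases
      case 1
      obtain b2 where b2: "b2 \<in># M" "height b2 = e"
        using root_height_attained[OF neMN(1)] 1 by metis
      then obtain N2 where "b2 = Node N2" and hN2: "Suc (root_height N2) = e"
        using False by (cases b2) auto
      then obtain M2 where M: "M = add_mset (Node N2) M2" using b2(1) by (meson mset_add)
      \<comment> \<open>The other alternative of \<open>optimal_edge\<close> is impossible, since
        the branches in \<open>K\<close> have height at most \<open>e - 1\<close>. Used for two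
        branches of height \<open>e\<close>, this covers every branch, because each belongs to the
        rest of one of the two.\<close>
      have *: "root_height K \<le> root_void_depth L"
        if "optimal x d (add_mset (Node K) L)" "Suc (root_height K) = e" "e \<le> root_height L" for K L
      proof -
        have "K \<noteq> {#}" "\<forall>t\<in>#K. regular d t"
          using that(1) d by (auto simp: optimal_def root_regular_def)
        then have "root_void_depth K \<le> root_height K"
          using d root_void_depth_le_root_height by blast
        then show ?thesis using optimal_edge[OF x d that(1)] that(2,3) by linarith
      qed
      have "root_height N \<le> root_void_depth M"
        using *[OF optMN(1) hN] 1 by simp
      moreover have "root_height N2 \<le> root_void_depth (add_mset (Node N) M2)"
        by (rule *) (use optMN(1) M hN2 hN in \<open>auto simp: add_mset_commute root_height_add\<close>)
      then have "root_height N2 \<le> void_depth (Node N)"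
        using root_void_depth_le[of "Node N" "add_mset (Node N) M2"] by simp
      ultimately have "root_height N \<le> root_void_depth R\<^sub>0"
        using hN hN2 unfolding R by (simp add: le_root_void_depth_iff neMN)
      then show ?thesis using that[OF R0] hN by (simp add: e_def)
    next
      \<comment> \<open>The centre is an edge; the root is placed at the end whose own branches are
        full.\<close>
      case 2
      from optimal_edge[OF x d optMN(1)] show ?thesis
      proof
        assume "root_height N \<le> root_void_depth M"
        then show ?thesis
          using optimal_bicentral[OF x d optMN(1) 2 refl] that[OF R0] R by simp
      next
        assume "root_height M \<le> root_void_depth N"
        then show ?thesis
          using optimal_bicentral[OF x d optMN(2) 2[symmetric] refl] that[OF step] by simp
      qed
    qed
  qed
qed

section \<open>Completely filled branches and the greedy shape\<close>

primrec perfect :: "nat \<Rightarrow> nat \<Rightarrow> ptree" where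
  "perfect d 0 = Void"
| "perfect d (Suc k) = Node (replicate_mset d (perfect d k))"

definition is_perfect :: "nat \<Rightarrow> ptree \<Rightarrow> bool" where
  "is_perfect d t \<longleftrightarrow> (\<exists>k. t = perfect d k)"

primrec well_filled :: "nat \<Rightarrow> ptree \<Rightarrow> bool" where
  "well_filled d Void \<longleftrightarrow> True"
| "well_filled d (Node M) \<longleftrightarrow> size {#t \<in># M. \<not> is_perfect d t#} \<le> 1 \<and>
    (\<forall>b\<in>#image_mset (well_filled d) M. b)"

text \<open>Translation of \<open>greedy_rooted\<close> to branches. The inequality between height
  and void depth says that all levels but the last are filled; the root may still have empty
  slots.\<close>

definition root_greedy :: "nat \<Rightarrow> ptree multiset \<Rightarrow> bool" where
  "root_greedy d R \<longleftrightarrow> root_regular d R \<and> root_height R \<le> Suc (root_void_depth R) \<and>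
    size {#t \<in># R. \<not> is_perfect d t#} \<le> 1 \<and> (\<forall>t\<in>#R. well_filled d t)"

lemma multiset_all_eq_replicate: "(\<And>y. y \<in># M \<Longrightarrow> y = a) \<Longrightarrow> M = replicate_mset (size M) a"
  by (induction M) auto

lemma eq_perfectI:
  assumes "d \<ge> 1" "regular d t" "k \<le> void_depth t" "height t \<le> k"
  shows "t = perfect d k"
  using assms(2-)
proof (induction t arbitrary: k)
  case (Node M)
  then obtain j where k: "k = Suc j" by (cases k) auto
  have "M \<noteq> {#}" using Node.prems assms(1) by auto
  then have "t = perfect d j" if "t \<in># M" for t
    using Node that k by (auto simp: le_root_void_depth_iff root_height_le_iff)
  then show ?case
    using Node.prems(1) multiset_all_eq_replicate[of M "perfect d j"] k by auto
qed simp

lemma height_perfect: "d \<ge> 1 \<Longrightarrow> height (perfect d k) = k"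
  by (induction k) (auto simp: root_height_def)

lemma void_depth_perfect: "d \<ge> 1 \<Longrightarrow> void_depth (perfect d k) = k"
  by (induction k) (auto simp: root_void_depth_def)

lemma is_perfect_iff:
  assumes "d \<ge> 1" "regular d t"
  shows "is_perfect d t \<longleftrightarrow> void_depth t = height t"
  using assms eq_perfectI[of d t] height_perfect void_depth_perfect
  unfolding is_perfect_def by (metis order_refl)

text \<open>Two imperfect branches in \<open>M\<close> would both have void depth \<open>k\<close>
  and height \<open>Suc k\<close>, so neither would be filled to the height of the other, against
  \<open>optimal_siblings\<close>. \<open>L\<close> absorbs the branch leading back when the vertex
  under study has been made the root.\<close>

lemma optimal_incomplete:
  assumes x: "x > 0" and d: "d \<ge> 1" and opt: "optimal x d (M + L)"
    and k: "\<And>t. t \<in># M \<Longrightarrow> k \<le> void_depth t \<and> height t \<le> Suc k"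
  shows "size {#t \<in># M. \<not> is_perfect d t#} \<le> 1"
proof (rule ccontr)
  assume *: "\<not> ?thesis"
  then obtain s Y where "{#t \<in># M. \<not> is_perfect d t#} = add_mset s Y"
    by (metis less_one linear multiset_cases not_le size_empty zero_less_one)
  moreover from this * obtain t Y' where "Y = add_mset t Y'"
    by (cases Y) auto
  ultimately have F: "{#t \<in># M. \<not> is_perfect d t#} = add_mset s (add_mset t Y')" by simp
  define K where "K = Y' + {#t \<in># M. is_perfect d t#} + L"
  have "M = {#t \<in># M. \<not> is_perfect d t#} + {#t \<in># M. is_perfect d t#}"
    using multiset_partition[of M "\<lambda>t. \<not> is_perfect d t"] by simp
  then have "M + L = {#t \<in># M. \<not> is_perfect d t#} + {#t \<in># M. is_perfect d t#} + L"
    by (rule arg_cong)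
  then have "M + L = add_mset s (add_mset t K)"
    unfolding K_def F by (simp add: ac_simps)
  with opt have optK: "optimal x d (add_mset s (add_mset t K))" by simp
  have "s \<in># {#t \<in># M. \<not> is_perfect d t#}" "t \<in># {#t \<in># M. \<not> is_perfect d t#}"
    unfolding F by auto
  then have st: "s \<in># M" "\<not> is_perfect d s" "t \<in># M" "\<not> is_perfect d t" by auto
  have "regular d s" "regular d t"
    using optK by (auto simp: optimal_def root_regular_def)
  then have "void_depth s < height s" "void_depth t < height t"
    using st is_perfect_iff[OF d] void_depth_le_height[OF d] by (metis le_neq_implies_less)+
  then show False
    using optimal_siblings[OF x d optK] k[OF st(1)] k[OF st(3)] by linarith
qed

text \<open>Rerooting at the top of \<open>t\<close> makes its children branches at the root, next
  to the single branch \<open>Node M\<close> that leads back.\<close>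

lemma optimal_well_filled:
  assumes x: "x > 0" and d: "d \<ge> 1" and "optimal x d R" "t \<in># R" "k \<le> void_depth t" "height t \<le> Suc k"
  shows "well_filled d t"
  using assms(3-)
proof (induction t arbitrary: R k)
  case (Node N)
  obtain M where R: "R = add_mset (Node N) M" using Node.prems(2) by (meson mset_add)
  have opt: "optimal x d (add_mset (Node M) N)"
    using Node.prems(1) R optimal_reroot_step[OF x] by simp
  then have "N \<noteq> {#}" using d by (auto simp: optimal_def root_regular_def)
  \<comment> \<open>For \<open>k = 0\<close> all children are \<open>Void\<close>, so the truncation
    of \<open>k - 1\<close> does no harm.\<close>
  then have k: "k - 1 \<le> void_depth s \<and> height s \<le> Suc (k - 1)" if "s \<in># N" for s
    using that Node.prems(3,4) root_void_depth_le[OF that] height_le_root_height[OF that] by auto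
  have "size {#t \<in># N. \<not> is_perfect d t#} \<le> 1"
    by (rule optimal_incomplete[OF x d, of _ "{#Node M#}" "k - 1"]) (use opt k in auto)
  moreover have "well_filled d s" if "s \<in># N" for s
    using Node.IH[OF that opt, of "k - 1"] that k by simp
  ultimately show ?case by simp
qed simp

lemma optimal_imp_greedy:
  assumes x: "x > 0" and d: "d \<ge> 1" and opt: "optimal x d R"
  obtains R' where "reroot\<^sup>*\<^sup>* R R'" "optimal x d R'" "root_greedy d R'"
proof -
  obtain R' where R': "reroot\<^sup>*\<^sup>* R R'" "root_height R' \<le> Suc (root_void_depth R')"
    using optimal_center[OF assms] .
  have opt': "optimal x d R'" using optimal_reroot[OF x R'(1) opt] .
  have k: "root_void_depth R' \<le> void_depth t \<and> height t \<le> Suc (root_void_depth R')" if "t \<in># R'" for t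
    using that R'(2) root_void_depth_le[OF that] height_le_root_height[OF that] by auto
  have "size {#t \<in># R'. \<not> is_perfect d t#} \<le> 1"
    by (rule optimal_incomplete[OF x d, of _ "{#}" "root_void_depth R'"]) (use opt' k in auto)
  moreover have "\<forall>t\<in>#R'. well_filled d t"
    using optimal_well_filled[OF x d opt'] k by blast
  ultimately have "root_greedy d R'"
    using opt' R'(2) by (simp add: root_greedy_def optimal_def)
  with R'(1) opt' show ?thesis by (rule that)
qed

section \<open>Uniqueness of the greedy tree\<close>

text \<open>\<open>r = 0\<close> encodes that no value lies strictly between \<open>p\<close> and
  \<open>q\<close>.\<close>

lemma multiset_two_values_form:
  fixes X :: "nat multiset"
  assumes "p < q" "\<And>y. y \<in># X \<Longrightarrow> p \<le> y \<and> y \<le> q" "size {#y \<in># X. p < y \<and> y < q#} \<le> 1"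
  shows "\<exists>a b r. r < q - p \<and>
    X = replicate_mset a q + replicate_mset b p + (if r = 0 then {#} else {#p + r#})"
  using assms(2,3)
proof (induction X)
  case empty
  show ?case by (rule exI[of _ 0], rule exI[of _ 0], rule exI[of _ 0]) (use assms(1) in simp)
next
  case (add y X)
  have "{#y \<in># X. p < y \<and> y < q#} \<subseteq># {#y \<in># add_mset y X. p < y \<and> y < q#}"
    by (intro multiset_filter_mono) simp
  then have "size {#y \<in># X. p < y \<and> y < q#} \<le> 1"
    using add.prems(2) size_mset_mono le_trans by blast
  then obtain a b r where r: "r < q - p"
    and X: "X = replicate_mset a q + replicate_mset b p + (if r = 0 then {#} else {#p + r#})"
    using add by auto
  consider "y = q" | "y = p" | "p < y" "y < q" using add.prems(1)[of y] by force
  then show ?case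
  proof cases
    case 1
    then show ?thesis using r X by (intro exI[of _ "Suc a"] exI[of _ b] exI[of _ r]) simp
  next
    case 2
    then show ?thesis using r X by (intro exI[of _ a] exI[of _ "Suc b"] exI[of _ r]) simp
  next
    case 3
    then have "r = 0" using add.prems(2) r X by (auto split: if_splits)
    then show ?thesis using 3 X by (intro exI[of _ a] exI[of _ b] exI[of _ "y - p"]) simp
  qed
qed

text \<open>Beyond \<open>size X * p\<close> the sum is \<open>a * D + r\<close> with
  \<open>r < D = q - p\<close>; division with remainder recovers \<open>a\<close> and
  \<open>r\<close>.\<close>

lemma multiset_two_values_unique:
  fixes X Y :: "nat multiset"
  assumes pq: "p < q"
    and X: "\<And>y. y \<in># X \<Longrightarrow> p \<le> y \<and> y \<le> q" "size {#y \<in># X. p < y \<and> y < q#} \<le> 1"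
    and Y: "\<And>y. y \<in># Y \<Longrightarrow> p \<le> y \<and> y \<le> q" "size {#y \<in># Y. p < y \<and> y < q#} \<le> 1"
    and size: "size X = size Y" and sum: "\<Sum>\<^sub># X = \<Sum>\<^sub># Y"
  shows "X = Y"
proof -
  obtain a b r where r: "r < q - p"
    and X: "X = replicate_mset a q + replicate_mset b p + (if r = 0 then {#} else {#p + r#})"
    using multiset_two_values_form[OF pq X] by blast
  obtain a' b' r' where r': "r' < q - p"
    and Y: "Y = replicate_mset a' q + replicate_mset b' p + (if r' = 0 then {#} else {#p + r'#})"
    using multiset_two_values_form[OF pq Y] by blast
  obtain D where q: "q = p + D" using pq less_imp_add_positive by blast
  have "\<Sum>\<^sub># X = size X * p + (a * D + r)" "\<Sum>\<^sub># Y = size Y * p + (a' * D + r')"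
    unfolding X Y q by (auto simp: algebra_simps)
  then have eq: "a * D + r = a' * D + r'" using size sum by simp
  have rD: "r < D" "r' < D" using r r' q by auto
  from eq have "(a * D + r) mod D = (a' * D + r') mod D" by simp
  then have rr: "r = r'" using rD by simp
  with eq rD have "a = a'" by auto
  with rr size show ?thesis unfolding X Y by (auto split: if_splits)
qed

lemma size_mult_le_sum_mset:
  fixes f :: "'a \<Rightarrow> nat"
  shows "(\<And>t. t \<in># M \<Longrightarrow> c \<le> f t) \<Longrightarrow> size M * c \<le> (\<Sum>t\<in>#M. f t)"
  by (induction M) (auto intro: add_mono)

lemma sum_mset_le_size_mult:
  fixes f :: "'a \<Rightarrow> nat"
  shows "(\<And>t. t \<in># M \<Longrightarrow> f t \<le> c) \<Longrightarrow> (\<Sum>t\<in>#M. f t) \<le> size M * c"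
  by (induction M) (auto intro: add_mono)

lemma nodes_perfect_le:
  "regular d t \<Longrightarrow> d \<ge> 1 \<Longrightarrow> k \<le> void_depth t \<Longrightarrow> nodes (perfect d k) \<le> nodes t"
proof (induction k arbitrary: t)
  case (Suc k)
  then obtain M where t: "t = Node M" by (cases t) auto
  with Suc.prems have "M \<noteq> {#}" by auto
  then have "nodes (perfect d k) \<le> nodes s" if "s \<in># M" for s
    using Suc t that by (auto simp: le_root_void_depth_iff)
  then show ?case using size_mult_le_sum_mset[of M _ nodes] Suc.prems t by auto
qed simp

lemma nodes_le_perfect:
  "regular d t \<Longrightarrow> height t \<le> k \<Longrightarrow> nodes t \<le> nodes (perfect d k)"
proof (induction k arbitrary: t)
  case 0
  then show ?case by (cases t) auto
next
  case (Suc k)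
  show ?case
  proof (cases t)
    case (Node M)
    then have "nodes s \<le> nodes (perfect d k)" if "s \<in># M" for s
      using Suc that by (auto simp: root_height_le_iff)
    then show ?thesis using sum_mset_le_size_mult[of M nodes] Suc.prems Node by auto
  qed simp
qed

lemma nodes_less_perfect:
  "regular d t \<Longrightarrow> d \<ge> 1 \<Longrightarrow> height t \<le> k \<Longrightarrow> void_depth t < k \<Longrightarrow> nodes t < nodes (perfect d k)"
proof (induction k arbitrary: t)
  case (Suc k)
  show ?case
  proof (cases t)
    case (Node M)
    with Suc.prems have "M \<noteq> {#}" by auto
    then obtain s where "s \<in># M" and s: "void_depth s = root_void_depth M"
      using root_void_depth_attained by metis
    then obtain M' where M: "M = add_mset s M'" by (meson mset_add)
    have "nodes s < nodes (perfect d k)"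
      using Suc.prems Node s by (intro Suc.IH) (auto simp: M root_height_add)
    moreover have "nodes u \<le> nodes (perfect d k)" if "u \<in># M'" for u
      using Suc.prems Node that by (intro nodes_le_perfect) (auto simp: M root_height_le_iff)
    then have "(\<Sum>t\<in>#M'. nodes t) \<le> size M' * nodes (perfect d k)"
      by (rule sum_mset_le_size_mult)
    moreover have "Suc (size M') = d" using Suc.prems(1) Node M by simp
    ultimately show ?thesis using Node M by auto
  qed simp
qed simp

lemma nodes_perfect_less:
  "regular d t \<Longrightarrow> d \<ge> 1 \<Longrightarrow> k \<le> void_depth t \<Longrightarrow> k < height t \<Longrightarrow> nodes (perfect d k) < nodes t"
proof (induction k arbitrary: t)
  case 0
  then show ?case by (cases t) auto
next
  case (Suc k)
  then obtain M where t: "t = Node M" by (cases t) auto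
  with Suc.prems have ne: "M \<noteq> {#}" by auto
  then obtain s where "s \<in># M" and s: "height s = root_height M"
    using root_height_attained by metis
  then obtain M' where M: "M = add_mset s M'" by (meson mset_add)
  have void: "k \<le> void_depth u" if "u \<in># M" for u
    using Suc.prems(3) t that ne by (auto simp: le_root_void_depth_iff)
  have "nodes (perfect d k) < nodes s"
    using Suc.prems t s M void by (intro Suc.IH) auto
  moreover have "nodes (perfect d k) \<le> nodes u" if "u \<in># M'" for u
    using Suc.prems t that M void by (intro nodes_perfect_le) auto
  then have "size M' * nodes (perfect d k) \<le> (\<Sum>t\<in>#M'. nodes t)"
    by (rule size_mult_le_sum_mset)
  moreover have "Suc (size M') = d" using Suc.prems(1) t M by simp
  ultimately show ?case using t M by auto
qed

text \<open>Perfect branches in this range have \<open>p\<close> or \<open>q\<close> nodes and at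
  most one branch is imperfect, so size and sum determine the multiset of node counts. The
  hypothesis \<open>inj\<close>, supplied by induction in \<open>well_filled_unique\<close>, then
  identifies the branches themselves.\<close>

lemma filled_multiset_unique:
  assumes d: "d \<ge> 1"
    and M: "\<And>t. t \<in># M \<Longrightarrow> regular d t \<and> k \<le> void_depth t \<and> height t \<le> Suc k"
      "size {#t \<in># M. \<not> is_perfect d t#} \<le> 1"
    and N: "\<And>t. t \<in># N \<Longrightarrow> regular d t \<and> k \<le> void_depth t \<and> height t \<le> Suc k"
      "size {#t \<in># N. \<not> is_perfect d t#} \<le> 1"
    and eq: "size M = size N" "(\<Sum>t\<in>#M. nodes t) = (\<Sum>t\<in>#N. nodes t)"
    and inj: "\<And>s t. s \<in># M \<Longrightarrow> t \<in># N \<Longrightarrow> nodes s = nodes t \<Longrightarrow> s = t"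
  shows "M = N"
proof -
  define p where "p = nodes (perfect d k)"
  define q where "q = nodes (perfect d (Suc k))"
  have pq: "p < q"
    unfolding p_def q_def
  proof (rule nodes_perfect_less[OF _ d])
    show "regular d (perfect d (Suc k))" by (induction k) (auto split: if_splits)
  qed (use d in \<open>auto simp: void_depth_perfect height_perfect simp del: perfect.simps\<close>)
  have range: "p \<le> y \<and> y \<le> q"
    if "\<And>t. t \<in># L \<Longrightarrow> regular d t \<and> k \<le> void_depth t \<and> height t \<le> Suc k"
      "y \<in># image_mset nodes L" for L y
    using that nodes_perfect_le[OF _ d] nodes_le_perfect[of d _ "Suc k"] unfolding p_def q_def by fastforce
  have one: "size {#y \<in># image_mset nodes L. p < y \<and> y < q#} \<le> 1"
    if L: "\<And>t. t \<in># L \<Longrightarrow> regular d t \<and> k \<le> void_depth t \<and> height t \<le> Suc k"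
      "size {#t \<in># L. \<not> is_perfect d t#} \<le> 1" for L
  proof -
    have "\<not> is_perfect d t" if "t \<in># L" "p < nodes t" "nodes t < q" for t
    proof
      assume "is_perfect d t"
      then obtain j where "t = perfect d j" by (auto simp: is_perfect_def)
      moreover from this L(1)[OF that(1)] have "j = k \<or> j = Suc k"
        using height_perfect[OF d] void_depth_perfect[OF d] by force
      ultimately show False using that by (auto simp: p_def q_def simp del: perfect.simps)
    qed
    then have "{#t \<in># L. p < nodes t \<and> nodes t < q#} \<subseteq># {#t \<in># L. \<not> is_perfect d t#}"
      by (auto intro!: mset_subset_eqI simp: count_eq_zero_iff)
    then have "size {#t \<in># L. p < nodes t \<and> nodes t < q#} \<le> 1"
      using L(2) size_mset_mono le_trans by blast
    then show ?thesis by (simp add: filter_mset_image_mset)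
  qed
  have "image_mset nodes M = image_mset nodes N"
    by (rule multiset_two_values_unique[OF pq range[OF M(1)] one[OF M] range[OF N(1)] one[OF N]])
      (use eq in auto)
  then show ?thesis by (rule multiset.inj_map_strong[rotated]) (use inj in blast)
qed

lemma well_filled_unique:
  assumes d: "d \<ge> 1"
  shows "regular d s \<Longrightarrow> regular d t \<Longrightarrow> well_filled d s \<Longrightarrow> well_filled d t \<Longrightarrow>
    k \<le> void_depth s \<Longrightarrow> height s \<le> Suc k \<Longrightarrow> k \<le> void_depth t \<Longrightarrow> height t \<le> Suc k \<Longrightarrow>
    nodes s = nodes t \<Longrightarrow> s = t"
proof (induction s arbitrary: t k)
  case Void
  then show ?case by (cases t) auto
next
  case (Node M)
  then obtain N where t: "t = Node N" by (cases t) auto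
  have ne: "M \<noteq> {#}" "N \<noteq> {#}" using Node.prems(1,2) t d by auto
  have bM: "k - 1 \<le> void_depth s \<and> height s \<le> Suc (k - 1)" if "s \<in># M" for s
    using Node.prems(5,6) root_void_depth_le[OF that] height_le_root_height[OF that] by auto
  have bN: "k - 1 \<le> void_depth s \<and> height s \<le> Suc (k - 1)" if "s \<in># N" for s
    using Node.prems(7,8) t root_void_depth_le[OF that] height_le_root_height[OF that] by auto
  have "s = u" if "s \<in># M" "u \<in># N" "nodes s = nodes u" for s u
    using Node.IH[OF that(1), of u "k - 1"] that Node.prems(1-4) t bM[OF that(1)] bN[OF that(2)]
    by simp
  then have "M = N"
    using Node.prems t bM bN by (intro filled_multiset_unique[OF d, of M "k - 1" N]) simp_all
  then show ?case using t by simp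
qed

lemma root_greedy_unique:
  assumes d: "d \<ge> 1" and "root_greedy d R" "root_greedy d R'" and nodes: "root_nodes R = root_nodes R'"
  shows "R = R'"
proof -
  \<comment> \<open>A smaller void depth means fewer nodes: every branch of \<open>R\<close> has at
    most \<open>c\<close> nodes and one of them has fewer, while every branch of \<open>R'\<close>
    has at least \<open>c\<close>.\<close>
  have less: False
    if R: "root_greedy d R" "root_greedy d R'" "root_nodes R = root_nodes R'"
      "root_void_depth R < root_void_depth R'" for R R'
  proof -
    define c where "c = nodes (perfect d (root_void_depth R'))"
    have size: "size R = Suc d" "size R' = Suc d" and
      reg: "\<And>t. t \<in># R \<Longrightarrow> regular d t" "\<And>t. t \<in># R' \<Longrightarrow> regular d t"
      using R by (auto simp: root_greedy_def root_regular_def)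
    have ne: "R \<noteq> {#}" using size by auto
    obtain t where "t \<in># R" and t: "void_depth t = root_void_depth R"
      using root_void_depth_attained[OF ne] by metis
    then obtain M where M: "R = add_mset t M" by (meson mset_add)
    have h: "height u \<le> root_void_depth R'" if "u \<in># R" for u
      using R(1,4) height_le_root_height[OF that] by (auto simp: root_greedy_def)
    have "nodes t < c"
      unfolding c_def using R(4) t h M reg d by (intro nodes_less_perfect) auto
    moreover have "(\<Sum>t\<in>#M. nodes t) \<le> size M * c"
      unfolding c_def using h M reg by (intro sum_mset_le_size_mult nodes_le_perfect) auto
    moreover have "size R' * c \<le> (\<Sum>t\<in>#R'. nodes t)"
      unfolding c_def using reg d by (intro size_mult_le_sum_mset nodes_perfect_le) (auto simp: root_void_depth_le)
    ultimately show False
      using R(3) size M by (auto simp: root_nodes_def)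
  qed
  have k: "root_void_depth R = root_void_depth R'"
    using less[of R R'] less[of R' R] assms by (metis linorder_neqE_nat)
  define k where "k = root_void_depth R"
  have b: "regular d t \<and> k \<le> void_depth t \<and> height t \<le> Suc k" if "t \<in># R" for t
    using assms(2) that root_void_depth_le[OF that] height_le_root_height[OF that]
    by (auto simp: k_def root_greedy_def root_regular_def)
  have b': "regular d t \<and> k \<le> void_depth t \<and> height t \<le> Suc k" if "t \<in># R'" for t
    using assms(3) that root_void_depth_le[OF that] height_le_root_height[OF that]
    by (auto simp: k_def k root_greedy_def root_regular_def)
  have "s = t" if "s \<in># R" "t \<in># R'" "nodes s = nodes t" for s t
    using well_filled_unique[OF d, of s t k] that b[OF that(1)] b'[OF that(2)] assms(2,3)
    by (simp add: root_greedy_def)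
  then show ?thesis
    by (intro filled_multiset_unique[OF d b _ b'])
      (use assms in \<open>auto simp: root_greedy_def root_regular_def root_nodes_def\<close>)
qed

lemma finite_regular: "finite {t. regular d t \<and> nodes t \<le> n}"
proof (induction n)
  case 0
  have "t = Void" if "nodes t \<le> 0" for t using that by (cases t) auto
  then have "{t. regular d t \<and> nodes t \<le> 0} \<subseteq> {Void}" by auto
  then show ?case by (rule finite_subset) simp
next
  case (Suc n)
  let ?A = "{t. regular d t \<and> nodes t \<le> n}"
  have "t \<in> insert Void (Node ` mset ` {xs. set xs \<subseteq> ?A \<and> length xs = d})"
    if t: "regular d t" "nodes t \<le> Suc n" for t
  proof (cases t)
    case (Node M)
    obtain xs where xs: "mset xs = M" using ex_mset by blast
    have "nodes s \<le> n" if mem: "s \<in># M" for s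
    proof -
      obtain M' where "M = add_mset s M'" using mem by (meson mset_add)
      then show ?thesis using t Node by simp
    qed
    then have "set xs \<subseteq> ?A \<and> length xs = d" using t Node xs by auto
    then show ?thesis using Node xs by blast
  qed simp
  then have "{t. regular d t \<and> nodes t \<le> Suc n} \<subseteq>
      insert Void (Node ` mset ` {xs. set xs \<subseteq> ?A \<and> length xs = d})" by auto
  moreover have "finite {xs. set xs \<subseteq> ?A \<and> length xs = d}"
    using Suc by (rule finite_lists_length_eq)
  ultimately show ?case by (meson finite_imageI finite_insert finite_subset)
qed

lemma optimal_exists:
  assumes "root_regular d R"
  obtains R' where "optimal x d R'" "root_nodes R' = root_nodes R"
proof -
  let ?S = "{R'. root_regular d R' \<and> root_nodes R' = root_nodes R}"
  let ?A = "{t. regular d t \<and> nodes t \<le> root_nodes R}"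
  have "R' \<in> mset ` {xs. set xs \<subseteq> ?A \<and> length xs = Suc d}" if R': "R' \<in> ?S" for R'
  proof -
    obtain xs where xs: "mset xs = R'" using ex_mset by blast
    have "nodes s \<le> root_nodes R" if mem: "s \<in># R'" for s
    proof -
      obtain M' where "R' = add_mset s M'" using mem by (meson mset_add)
      then show ?thesis using R' by (auto simp: root_nodes_def)
    qed
    then have "set xs \<subseteq> ?A \<and> length xs = Suc d" using R' xs by (auto simp: root_regular_def)
    then show ?thesis using xs by blast
  qed
  then have "?S \<subseteq> mset ` {xs. set xs \<subseteq> ?A \<and> length xs = Suc d}" by blast
  moreover have "finite {xs. set xs \<subseteq> ?A \<and> length xs = Suc d}"
    using finite_regular by (rule finite_lists_length_eq)
  ultimately have fin: "finite (root_weight x ` ?S)" by (meson finite_imageI finite_subset)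
  have "R \<in> ?S" using assms by simp
  then have "root_weight x ` ?S \<noteq> {}" by blast
  from Min_in[OF fin this] obtain R' where "R' \<in> ?S" "Min (root_weight x ` ?S) = root_weight x R'"
    by (rule imageE)
  moreover from this have "root_weight x R' \<le> root_weight x R''" if "R'' \<in> ?S" for R''
    using Min_le[OF fin imageI[OF that]] by simp
  ultimately show ?thesis by (intro that[of R']) (auto simp: optimal_def)
qed

lemma greedy_optimal:
  assumes x: "x > 0" and d: "d \<ge> 1" and R: "root_greedy d R"
  shows "optimal x d R"
proof -
  obtain R\<^sub>0 where R0: "optimal x d R\<^sub>0" "root_nodes R\<^sub>0 = root_nodes R"
    by (rule optimal_exists[of d R]) (use R in \<open>simp_all add: root_greedy_def\<close>)
  obtain R\<^sub>1 where R1: "reroot\<^sup>*\<^sup>* R\<^sub>0 R\<^sub>1" "optimal x d R\<^sub>1" "root_greedy d R\<^sub>1"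
    using optimal_imp_greedy[OF x d R0(1)] .
  have "root_nodes R\<^sub>1 = root_nodes R\<^sub>0"
    using R1(1) by (rule root_nodes_reroot)
  then have "R = R\<^sub>1" using root_greedy_unique[OF d R R1(3)] R0(2) by metis
  with R1(2) show ?thesis by blast
qed

section \<open>Rooted graphs and their trees of branches\<close>

definition graft :: "'a ugraph \<Rightarrow> 'a \<Rightarrow> 'a ugraph \<Rightarrow> 'a \<Rightarrow> 'a ugraph" where
  "graft G v H w = \<lparr>gverts = gverts G \<union> gverts H, gedges = insert {v, w} (gedges G \<union> gedges H)\<rparr>"

definition single_vertex :: "'a \<Rightarrow> 'a ugraph" where
  "single_vertex v = \<lparr>gverts = {v}, gedges = {}\<rparr>"

text \<open>The number of void slots at the root is left open here; at the other vertices it is fixed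
  by regularity of the branches.\<close>

inductive represents :: "'a ugraph \<Rightarrow> 'a \<Rightarrow> ptree multiset \<Rightarrow> bool" where
  single: "represents (single_vertex v) v (replicate_mset k Void)"
| graft: "represents G v M \<Longrightarrow> represents H w N \<Longrightarrow> gverts G \<inter> gverts H = {} \<Longrightarrow>
    represents (graft G v H w) v (add_mset (Node N) M)"

lemma simple_graph_adjacent:
  assumes "simple_graph G" "adjacent G a b"
  shows "a \<in> gverts G" "b \<in> gverts G" "a \<noteq> b"
proof -
  have "{a, b} \<subseteq> gverts G" "card {a, b} = 2"
    using assms unfolding simple_graph_def adjacent_def by blast+
  then show "a \<in> gverts G" "b \<in> gverts G" "a \<noteq> b" by auto
qed

lemma adjacent_commute: "adjacent G a b \<longleftrightarrow> adjacent G b a"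
  by (simp add: adjacent_def insert_commute)

lemma gverts_graft [simp]: "gverts (graft G v H w) = gverts G \<union> gverts H"
  by (simp add: graft_def)

lemma gverts_single [simp]: "gverts (single_vertex v) = {v}"
  by (simp add: single_vertex_def)

lemma simple_graph_single [simp]: "simple_graph (single_vertex v)"
  by (simp add: single_vertex_def simple_graph_def)

lemma adjacent_single [simp]: "\<not> adjacent (single_vertex v) a b"
  by (simp add: single_vertex_def adjacent_def)

lemma adjacent_graft:
  "adjacent (graft G v H w) a b \<longleftrightarrow> adjacent G a b \<or> adjacent H a b \<or>
    (a = v \<and> b = w) \<or> (a = w \<and> b = v)"
  by (auto simp: adjacent_def graft_def doubleton_eq_iff)

lemma simple_graph_graft:
  assumes "simple_graph G" "simple_graph H" "gverts G \<inter> gverts H = {}" "v \<in> gverts G" "w \<in> gverts H"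
  shows "simple_graph (graft G v H w)"
proof -
  have "v \<noteq> w" using assms by auto
  with assms show ?thesis by (auto simp: simple_graph_def graft_def)
qed

lemma represents_simple: "represents G v M \<Longrightarrow> simple_graph G \<and> v \<in> gverts G"
  by (induction rule: represents.induct) (auto intro: simple_graph_graft)

lemma represents_simple_graph: "represents G v M \<Longrightarrow> simple_graph G"
  and represents_root_in: "represents G v M \<Longrightarrow> v \<in> gverts G"
  by (simp_all add: represents_simple)

lemma represents_card: "represents G v M \<Longrightarrow> card (gverts G) = root_nodes M"
proof (induction rule: represents.induct)
  case (single v k)
  have "(\<Sum>t\<in>#replicate_mset k Void. nodes t) = 0" by simp
  then show ?case by (simp add: root_nodes_def)
next
  case (graft G v M H w N)
  have "finite (gverts G)" "finite (gverts H)"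
    using represents_simple_graph[OF graft.hyps(1)] represents_simple_graph[OF graft.hyps(2)]
    by (simp_all add: simple_graph_def)
  then show ?case using graft by (simp add: card_Un_disjoint root_nodes_def)
qed

text \<open>Local axioms for the distance to \<open>v\<close>: it changes by exactly one along an
  edge, and every other vertex has exactly one closer neighbour. They survive grafting, determine
  \<open>gdist\<close> and exclude cycles, so shortest walks in grafted graphs never have to be
  analysed.\<close>

definition depth_function :: "'a ugraph \<Rightarrow> 'a \<Rightarrow> ('a \<Rightarrow> nat) \<Rightarrow> bool" where
  "depth_function G v \<delta> \<longleftrightarrow> \<delta> v = 0 \<and>
    (\<forall>a b. adjacent G a b \<longrightarrow> \<delta> a = Suc (\<delta> b) \<or> \<delta> b = Suc (\<delta> a)) \<and>
    (\<forall>a\<in>gverts G. a \<noteq> v \<longrightarrow> (\<exists>!b. adjacent G a b \<and> \<delta> a = Suc (\<delta> b)))"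

lemma depth_function_zero_iff:
  "depth_function G v \<delta> \<Longrightarrow> a \<in> gverts G \<Longrightarrow> \<delta> a = 0 \<longleftrightarrow> a = v"
  unfolding depth_function_def by (metis nat.distinct(1))

lemma depth_function_walk_le:
  assumes "depth_function G v \<delta>"
  shows "walk G p \<Longrightarrow> \<delta> (last p) < \<delta> (hd p) + length p"
proof (induction p)
  case (Cons a p)
  show ?case
  proof (cases p)
    case (Cons b q)
    with Cons.prems have "adjacent G a b" "walk G p" by (auto simp: walk_def)
    then have "\<delta> b \<le> Suc (\<delta> a)" using assms unfolding depth_function_def by fastforce
    then show ?thesis using Cons.IH[OF \<open>walk G p\<close>] Cons by simp
  qed simp
qed (simp add: walk_def)

lemma walk_snoc:
  "walk G p \<Longrightarrow> simple_graph G \<Longrightarrow> adjacent G (last p) b \<Longrightarrow> walk G (p @ [b])"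
  using simple_graph_adjacent[of G "last p" b] by (auto simp: walk_def successively_append_iff)

lemma depth_function_walk:
  assumes "depth_function G v \<delta>" and G: "simple_graph G" "v \<in> gverts G" and "a \<in> gverts G"
  obtains p where "walk G p" "hd p = v" "last p = a" "length p = Suc (\<delta> a)"
proof -
  have "\<exists>p. walk G p \<and> hd p = v \<and> last p = a \<and> length p = Suc (\<delta> a)" using assms(4)
  proof (induction "\<delta> a" arbitrary: a)
    case 0
    then have "a = v" using depth_function_zero_iff[OF assms(1)] by metis
    then show ?case using 0 G by (intro exI[of _ "[v]"]) (auto simp: walk_def)
  next
    case (Suc k)
    then have "a \<noteq> v" using assms(1) by (auto simp: depth_function_def)
    then obtain b where b: "adjacent G a b" "\<delta> a = Suc (\<delta> b)"
      using assms(1) Suc.prems unfolding depth_function_def by blast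
    then obtain p where p: "walk G p" "hd p = v" "last p = b" "length p = Suc (\<delta> b)"
      using Suc.hyps(1)[of b] Suc.hyps(2) simple_graph_adjacent[OF G(1) b(1)] by auto
    have "walk G (p @ [a])"
      using walk_snoc[OF p(1) G(1)] p(3) b(1) adjacent_commute[of G] by simp
    then show ?case using p b by (intro exI[of _ "p @ [a]"]) (auto simp: walk_def)
  qed
  then show ?thesis using that by blast
qed

text \<open>Following parents back to the root gives a walk with \<open>\<delta> a\<close> edges,
  and along any walk \<delta> grows by at most one per edge.\<close>

lemma depth_function_gdist:
  assumes "depth_function G v \<delta>" "simple_graph G" "v \<in> gverts G" "a \<in> gverts G"
  shows "gdist G v a = \<delta> a"
  unfolding gdist_def
proof (rule Least_equality)
  show "\<exists>p. walk G p \<and> hd p = v \<and> last p = a \<and> length p = Suc (\<delta> a)"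
    using depth_function_walk[OF assms] by metis
next
  fix k assume "\<exists>p. walk G p \<and> hd p = v \<and> last p = a \<and> length p = Suc k"
  then show "\<delta> a \<le> k"
    using depth_function_walk_le[OF assms(1)] assms(1) by (force simp: depth_function_def)
qed

lemma walk_rev: "walk G p \<Longrightarrow> walk G (rev p)"
proof -
  have *: "(\<lambda>x y. adjacent G y x) = adjacent G" by (intro ext adjacent_commute)
  show "walk G p \<Longrightarrow> walk G (rev p)" unfolding walk_def successively_rev * set_rev rev_is_Nil_conv .
qed

lemma walk_join:
  assumes "walk G p" "walk G q" "last p = hd q"
  shows "walk G (p @ tl q) \<and> hd (p @ tl q) = hd p \<and> last (p @ tl q) = last q"
proof (cases "tl q")
  case Nil
  then have "q = [hd q]" using assms(2) by (cases q) (auto simp: walk_def)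
  then show ?thesis using assms Nil by (metis append_Nil2 last.simps)
next
  case (Cons b q')
  then have "q = hd q # b # q'" using assms(2) by (cases q) (auto simp: walk_def)
  then show ?thesis using assms
    by (cases q) (auto simp: walk_def successively_append_iff)
qed

lemma connected_graphI:
  assumes "v \<in> gverts G" "\<And>a. a \<in> gverts G \<Longrightarrow> \<exists>p. walk G p \<and> hd p = v \<and> last p = a"
  shows "connected_graph G"
  unfolding connected_graph_def
proof (intro conjI ballI)
  fix a b assume "a \<in> gverts G" "b \<in> gverts G"
  then obtain p q where p: "walk G p" "hd p = v" "last p = a" and q: "walk G q" "hd q = v" "last q = b"
    using assms(2) by metis
  have "p \<noteq> []" using p by (auto simp: walk_def)
  then have "hd (rev p) = a" "last (rev p) = hd q" using p q by (auto simp: hd_rev last_rev)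
  then show "\<exists>p. walk G p \<and> hd p = a \<and> last p = b"
    using walk_join[OF walk_rev[OF p(1)] q(1)] q(3) by metis
qed (use assms(1) in auto)

text \<open>On a cycle, both neighbours of a deepest vertex would be parents of it.\<close>

lemma depth_function_acyclic:
  assumes \<delta>: "depth_function G v \<delta>" and G: "simple_graph G"
  shows "\<not> is_cycle G p"
proof
  assume "is_cycle G p"
  then have p: "successively (adjacent G) p" "distinct p" "length p \<ge> 3" "adjacent G (last p) (hd p)"
    "set p \<subseteq> gverts G"
    by (auto simp: is_cycle_def walk_def)
  define n where "n = length p"
  have adj: "adjacent G (p ! i) (p ! (Suc i mod n))" if "i < n" for i
  proof (cases "Suc i < n")
    case True
    then show ?thesis using p(1) by (simp add: n_def successively_conv_nth)
  next
    case False
    then have "n = Suc i" "p \<noteq> []" using that p(3) by auto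
    then have "last p = p ! i" "hd p = p ! (Suc i mod n)"
      by (simp_all add: n_def last_conv_nth hd_conv_nth)
    then show ?thesis using p(4) by simp
  qed
  have fin: "finite ((\<lambda>i. \<delta> (p ! i)) ` {..<n})" "(\<lambda>i. \<delta> (p ! i)) ` {..<n} \<noteq> {}"
    using p(3) by (auto simp: n_def lessThan_empty_iff)
  from Max_in[OF this] obtain i where i: "i < n" "Max ((\<lambda>i. \<delta> (p ! i)) ` {..<n}) = \<delta> (p ! i)"
    by auto
  then have max: "\<delta> (p ! j) \<le> \<delta> (p ! i)" if "j < n" for j
    using Max_ge[OF fin(1), of "\<delta> (p ! j)"] that by simp
  \<comment> \<open>\<open>j\<close> and \<open>k\<close> are the cyclic predecessor and successor
    of \<open>i\<close>; adding \<open>n\<close> avoids truncated subtraction at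
    \<open>i = 0\<close>.\<close>
  define j where "j = (i + n - 1) mod n"
  define k where "k = Suc i mod n"
  have n: "n \<ge> 3" using p(3) by (simp add: n_def)
  have jk: "j < n" "k < n" using n by (auto simp: j_def k_def)
  have ji: "Suc j mod n = i" using i(1) n
    by (cases i) (auto simp: j_def mod_Suc)
  have "j \<noteq> k"
  proof (cases "i = 0")
    case True then show ?thesis using n by (simp add: j_def k_def)
  next
    case False
    then have "i + n - 1 = (i - 1) + n" by simp
    then have "j = (i - 1) mod n" unfolding j_def by (simp only: mod_add_self2)
    then have "j = i - 1" using i(1) by simp
    then show ?thesis using i(1) n False by (cases "Suc i = n") (auto simp: k_def)
  qed
  then have neq: "p ! j \<noteq> p ! k" using p(2) jk by (simp add: n_def nth_eq_iff_index_eq)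
  have "adjacent G (p ! i) (p ! j)" using adj[OF jk(1)] ji adjacent_commute[of G] by simp
  moreover have "adjacent G (p ! i) (p ! k)" using adj[OF i(1)] by (simp add: k_def)
  moreover have "p ! i \<noteq> v"
  proof
    assume "p ! i = v"
    then have "\<delta> (p ! k) \<le> 0" using max[OF jk(2)] \<delta> by (simp add: depth_function_def)
    moreover have "p ! k \<in> gverts G" "p ! k \<noteq> p ! i"
      using simple_graph_adjacent[OF G adj[OF i(1)]] by (auto simp: k_def)
    ultimately show False
      using depth_function_zero_iff[OF \<delta>] \<open>p ! i = v\<close> by auto
  qed
  moreover have "p ! i \<in> gverts G" using p(5) i(1) by (auto simp: n_def)
  moreover have "\<delta> (p ! i) = Suc (\<delta> (p ! j))" "\<delta> (p ! i) = Suc (\<delta> (p ! k))"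
    using \<delta> max[OF jk(1)] max[OF jk(2)] calculation(1,2) unfolding depth_function_def
    by (metis Suc_n_not_le_n)+
  ultimately show False using \<delta> neq unfolding depth_function_def by blast
qed

lemma depth_function_is_tree:
  assumes "depth_function G v \<delta>" "simple_graph G" "v \<in> gverts G"
  shows "is_tree G"
proof -
  have "connected_graph G"
    by (rule connected_graphI[OF assms(3)]) (metis depth_function_walk[OF assms])
  then show ?thesis
    using assms(2) depth_function_acyclic[OF assms(1,2)] by (simp add: is_tree_def)
qed

text \<open>All depths in \<open>H\<close> grow by one; \<open>w\<close> receives \<open>v\<close>
  as its parent, and no other parent changes.\<close>

lemma depth_function_graft:
  assumes G: "simple_graph G" "v \<in> gverts G" "depth_function G v \<delta>"
    and H: "simple_graph H" "w \<in> gverts H" "depth_function H w \<eta>"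
    and disj: "gverts G \<inter> gverts H = {}"
  shows "depth_function (graft G v H w) v (\<lambda>a. if a \<in> gverts G then \<delta> a else Suc (\<eta> a))"
proof -
  have w: "w \<notin> gverts G" using H(2) disj by auto
  have nG: "\<not> adjacent G a b" if "a \<notin> gverts G \<or> b \<notin> gverts G" for a b
    using simple_graph_adjacent[OF G(1)] that by blast
  have nH: "\<not> adjacent H a b" if "a \<in> gverts G \<or> b \<in> gverts G" for a b
    using simple_graph_adjacent[OF H(1)] that disj by blast
  have [simp]: "\<delta> v = 0" "\<eta> w = 0" using G(3) H(3) by (auto simp: depth_function_def)
  show ?thesis
    unfolding depth_function_def
  proof (intro conjI allI impI ballI)
    fix a b assume "adjacent (graft G v H w) a b"
    then show "(if a \<in> gverts G then \<delta> a else Suc (\<eta> a)) = Suc (if b \<in> gverts G then \<delta> b else Suc (\<eta> b)) \<or>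
      (if b \<in> gverts G then \<delta> b else Suc (\<eta> b)) = Suc (if a \<in> gverts G then \<delta> a else Suc (\<eta> a))"
      unfolding adjacent_graft
    proof (elim disjE)
      assume ab: "adjacent G a b"
      then have "a \<in> gverts G" "b \<in> gverts G" using simple_graph_adjacent[OF G(1)] by auto
      then show ?thesis using G(3) ab by (simp add: depth_function_def)
    next
      assume ab: "adjacent H a b"
      then have "a \<notin> gverts G" "b \<notin> gverts G" using simple_graph_adjacent[OF H(1) ab] disj by auto
      then show ?thesis using H(3) ab by (simp add: depth_function_def)
    qed (use G(2) w in auto)
  next
    fix a assume a: "a \<in> gverts (graft G v H w)" "a \<noteq> v"
    consider "a \<in> gverts G" | "a \<in> gverts H" "a \<notin> gverts G" "a \<noteq> w" | "a = w" using a by auto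
    then show "\<exists>!b. adjacent (graft G v H w) a b \<and>
      (if a \<in> gverts G then \<delta> a else Suc (\<eta> a)) = Suc (if b \<in> gverts G then \<delta> b else Suc (\<eta> b))"
    proof cases
      case 1
      have "\<exists>!b. adjacent G a b \<and> \<delta> a = Suc (\<delta> b)"
        using G(3) 1 a(2) unfolding depth_function_def by blast
      moreover have "adjacent (graft G v H w) a b \<and>
        (if a \<in> gverts G then \<delta> a else Suc (\<eta> a)) = Suc (if b \<in> gverts G then \<delta> b else Suc (\<eta> b))
        \<longleftrightarrow> adjacent G a b \<and> \<delta> a = Suc (\<delta> b)" for b
        using 1 a(2) w nH[of a b] nG[of a b] unfolding adjacent_graft by auto
      ultimately show ?thesis by simp
    next
      case 2
      have "\<exists>!b. adjacent H a b \<and> \<eta> a = Suc (\<eta> b)"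
        using H(3) 2 unfolding depth_function_def by blast
      moreover have "adjacent (graft G v H w) a b \<and>
        (if a \<in> gverts G then \<delta> a else Suc (\<eta> a)) = Suc (if b \<in> gverts G then \<delta> b else Suc (\<eta> b))
        \<longleftrightarrow> adjacent H a b \<and> \<eta> a = Suc (\<eta> b)" for b
        using 2 a(2) w nH[of a b] nG[of a b] unfolding adjacent_graft by auto
      ultimately show ?thesis by simp
    next
      case 3
      have "adjacent (graft G v H w) a b \<and>
        (if a \<in> gverts G then \<delta> a else Suc (\<eta> a)) = Suc (if b \<in> gverts G then \<delta> b else Suc (\<eta> b))
        \<longleftrightarrow> b = v" for b
        using 3 a(2) w G(2) nH[of a b] nG[of a b] unfolding adjacent_graft by auto
      then show ?thesis by simp
    qed
  qed (use G(2) in simp)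
qed

lemma depth_function_cong:
  assumes "simple_graph G" "v \<in> gverts G" "\<And>a. a \<in> gverts G \<Longrightarrow> \<delta> a = \<delta>' a" "depth_function G v \<delta>'"
  shows "depth_function G v \<delta>"
proof -
  have *: "adjacent G a b \<and> \<delta> a = Suc (\<delta> b) \<longleftrightarrow> adjacent G a b \<and> \<delta>' a = Suc (\<delta>' b)" for a b
    using simple_graph_adjacent[OF assms(1), of a b] assms(3) by auto
  have **: "\<delta> a = Suc (\<delta> b) \<or> \<delta> b = Suc (\<delta> a)" if ab: "adjacent G a b" for a b
  proof -
    have "\<delta>' a = Suc (\<delta>' b) \<or> \<delta>' b = Suc (\<delta>' a)"
      using assms(4) ab unfolding depth_function_def by blast
    then show ?thesis using simple_graph_adjacent[OF assms(1) ab] assms(3)[of a] assms(3)[of b] by simp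
  qed
  have "\<delta> v = 0" using assms(2-4) by (simp add: depth_function_def)
  with ** show ?thesis using assms(4) unfolding depth_function_def * by blast
qed

lemma represents_depth_function: "represents G v M \<Longrightarrow> depth_function G v (gdist G v)"
proof -
  assume rep: "represents G v M"
  then have "\<exists>\<delta>. depth_function G v \<delta>"
  proof (induction rule: represents.induct)
    case (single v k)
    show ?case by (rule exI[of _ "\<lambda>_. 0"]) (simp add: depth_function_def)
  next
    case (graft G v M H w N)
    then obtain \<delta> \<eta> where "depth_function G v \<delta>" "depth_function H w \<eta>" by blast
    with depth_function_graft[of G v \<delta> H w \<eta>] graft.hyps show ?case
      by (blast intro: represents_simple_graph represents_root_in)
  qed
  then obtain \<delta> where \<delta>: "depth_function G v \<delta>" by blast
  note G = represents_simple_graph[OF rep] represents_root_in[OF rep]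
  show ?thesis by (rule depth_function_cong[OF G depth_function_gdist[OF \<delta> G] \<delta>])
qed

lemma represents_is_tree: "represents G v M \<Longrightarrow> is_tree G"
  by (rule depth_function_is_tree[OF represents_depth_function represents_simple_graph represents_root_in])

lemma represents_gdist_graft:
  assumes "represents G v M" "represents H w N" "gverts G \<inter> gverts H = {}"
    and "a \<in> gverts G \<union> gverts H"
  shows "gdist (graft G v H w) v a = (if a \<in> gverts G then gdist G v a else Suc (gdist H w a))"
proof -
  note G = represents_simple_graph[OF assms(1)] represents_root_in[OF assms(1)]
    represents_depth_function[OF assms(1)]
  note H = represents_simple_graph[OF assms(2)] represents_root_in[OF assms(2)]
    represents_depth_function[OF assms(2)]
  show ?thesis
    using depth_function_gdist[OF depth_function_graft[OF G H assms(3)]]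
      simple_graph_graft[OF G(1) H(1) assms(3) G(2) H(2)] G(2) assms(4) by simp
qed

section \<open>Children, degrees and subtrees of grafted graphs\<close>

lemma simple_graph_edge: "simple_graph G \<Longrightarrow> e \<in> gedges G \<Longrightarrow> e \<noteq> {} \<and> e \<subseteq> gverts G"
  by (auto simp: simple_graph_def)

lemma simple_graph_finite_edges: "simple_graph G \<Longrightarrow> finite (gedges G)"
  using simple_graph_edge finite_subset[of "gedges G" "Pow (gverts G)"]
  by (auto simp: simple_graph_def)

lemma induced_subgraph_gverts: "simple_graph G \<Longrightarrow> induced_subgraph G (gverts G) = G"
  by (cases G) (auto simp: induced_subgraph_def simple_graph_def)

lemma children_subset: "children G r a \<subseteq> gverts G"
  by (auto simp: children_def)

lemma descendants_subset: "a \<in> gverts G \<Longrightarrow> descendants G r a \<subseteq> gverts G"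
proof
  fix b assume a: "a \<in> gverts G" and "b \<in> descendants G r a"
  then have "(\<lambda>x y. y \<in> children G r x)\<^sup>*\<^sup>* a b" by (simp add: descendants_def)
  then show "b \<in> gverts G" using a by induction (auto simp: children_def)
qed

text \<open>\<open>S\<close> is closed under taking children, so a descent starting in it never
  leaves it. This shows that grafting keeps the subtrees at all vertices except the root.\<close>

lemma descendants_eq_on:
  assumes "\<And>x. x \<in> S \<Longrightarrow> children G r x = children H s x" "\<And>x. x \<in> S \<Longrightarrow> children H s x \<subseteq> S"
    and "a \<in> S"
  shows "descendants G r a = descendants H s a \<and> descendants H s a \<subseteq> S"
proof -
  have 1: "(\<lambda>x y. y \<in> children H s x)\<^sup>*\<^sup>* a b \<and> b \<in> S"
    if "(\<lambda>x y. y \<in> children G r x)\<^sup>*\<^sup>* a b" for b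
    using that
  proof induction
    case (step y z)
    then have "z \<in> children H s y" using assms(1) by simp
    then show ?case using step assms(2) by (meson rtranclp.rtrancl_into_rtrancl subsetD)
  qed (use assms(3) in simp)
  have 2: "(\<lambda>x y. y \<in> children G r x)\<^sup>*\<^sup>* a b \<and> b \<in> S"
    if "(\<lambda>x y. y \<in> children H s x)\<^sup>*\<^sup>* a b" for b
    using that
  proof induction
    case (step y z)
    then have "z \<in> children G r y" using assms(1) by simp
    then show ?case using step assms(2) by (meson rtranclp.rtrancl_into_rtrancl subsetD)
  qed (use assms(3) in simp)
  show ?thesis using 1 2 unfolding descendants_def by blast
qed

lemma represents_parent:
  assumes "represents G v M" "a \<in> gverts G" "a \<noteq> v"
  obtains b where "b \<in> gverts G" "a \<in> children G v b"
proof -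
  obtain b where "adjacent G a b" "gdist G v a = Suc (gdist G v b)"
    using represents_depth_function[OF assms(1)] assms(2,3) unfolding depth_function_def by blast
  moreover from this(1) have "b \<in> gverts G" "adjacent G b a"
    using simple_graph_adjacent[OF represents_simple_graph[OF assms(1)]]
    by (auto simp: adjacent_commute)
  ultimately show ?thesis using that[of b] assms(2) by (simp add: children_def)
qed

lemma represents_gdist_root: "represents G v M \<Longrightarrow> gdist G v v = 0"
  using represents_depth_function[of G v M] by (simp add: depth_function_def)

lemma represents_descendants_root:
  assumes rep: "represents G v M"
  shows "descendants G v v = gverts G"
proof
  show "descendants G v v \<subseteq> gverts G"
    using descendants_subset represents_root_in[OF rep] .
  have "a \<in> descendants G v v" if "a \<in> gverts G" for a
    using that
  proof (induction "gdist G v a" arbitrary: a rule: less_induct)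
    case less
    show ?case
    proof (cases "a = v")
      case False
      obtain b where b: "b \<in> gverts G" "a \<in> children G v b"
        using represents_parent[OF rep less.prems False] .
      then have "gdist G v b < gdist G v a" by (simp add: children_def)
      from less.hyps[OF this b(1)] b(2) show ?thesis
        by (auto simp: descendants_def intro: rtranclp.rtrancl_into_rtrancl)
    qed (simp add: descendants_def)
  qed
  then show "gverts G \<subseteq> descendants G v v" by blast
qed

lemma gdegree_graft:
  assumes s: "simple_graph G" "simple_graph H" and disj: "gverts G \<inter> gverts H = {}"
    and vw: "v \<in> gverts G" "w \<in> gverts H" and "a \<in> gverts G \<union> gverts H"
  shows "gdegree (graft G v H w) a =
    (if a \<in> gverts G then gdegree G a else gdegree H a) + (if a = v \<or> a = w then 1 else 0)"
proof -
  have v: "v \<in> gverts G" "w \<in> gverts H" "w \<notin> gverts G" "v \<notin> gverts H"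
    using vw disj by auto
  note fin = s[THEN simple_graph_finite_edges]
  have sub: "\<And>e. e \<in> gedges G \<Longrightarrow> e \<subseteq> gverts G" "\<And>e. e \<in> gedges H \<Longrightarrow> e \<subseteq> gverts H"
    using s simple_graph_edge by blast+
  have new: "{v, w} \<notin> gedges G" "{v, w} \<notin> gedges H" using sub v by blast+
  have "{e \<in> gedges (graft G v H w). a \<in> e} =
      (if a \<in> gverts G then {e \<in> gedges G. a \<in> e} else {e \<in> gedges H. a \<in> e}) \<union>
      (if a = v \<or> a = w then {{v, w}} else {})"
  proof (cases "a \<in> gverts G")
    case True
    then have "a \<notin> e" if "e \<in> gedges H" for e using sub(2)[OF that] disj by blast
    with True show ?thesis by (auto simp: graft_def)
  next
    case False
    then have "a \<notin> e" if "e \<in> gedges G" for e using sub(1)[OF that] by blast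
    with False show ?thesis by (auto simp: graft_def)
  qed
  then show ?thesis
    using new fin unfolding gdegree_def by simp
qed

context
  fixes G H :: "'a ugraph" and v w M N
  assumes G: "represents G v M" and H: "represents H w N" and disj: "gverts G \<inter> gverts H = {}"
begin

lemma children_graft:
  assumes "a \<in> gverts G \<union> gverts H"
  shows "children (graft G v H w) v a =
    (if a \<in> gverts G then children G v a \<union> (if a = v then {w} else {}) else children H w a)"
proof -
  have v: "v \<in> gverts G" "w \<in> gverts H" "w \<notin> gverts G" "v \<notin> gverts H"
    using represents_root_in[OF G] represents_root_in[OF H] disj by auto
  have nG: "adjacent G x y \<Longrightarrow> x \<in> gverts G \<and> y \<in> gverts G \<and> x \<notin> gverts H \<and> y \<notin> gverts H" for x y
    using simple_graph_adjacent[OF represents_simple_graph[OF G]] disj by blast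
  have nH: "adjacent H x y \<Longrightarrow> x \<in> gverts H \<and> y \<in> gverts H \<and> x \<notin> gverts G \<and> y \<notin> gverts G" for x y
    using simple_graph_adjacent[OF represents_simple_graph[OF H]] disj by blast
  note dist = represents_gdist_graft[OF G H disj]
  have zero: "gdist G v v = 0" "gdist H w w = 0"
    using represents_gdist_root G H by metis+
  have "u \<in> children (graft G v H w) v a \<longleftrightarrow> u \<in> (if a \<in> gverts G
      then children G v a \<union> (if a = v then {w} else {}) else children H w a)" for u
  proof (cases "u \<in> gverts G \<union> gverts H")
    case True
    then show ?thesis
      using assms v nG[of a u] nH[of a u] disj dist[OF assms] dist[OF True] zero
      by (auto simp: children_def adjacent_graft)
  next
    case False
    then show ?thesis using v by (auto simp: children_def)
  qed
  then show ?thesis by blast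
qed

lemma gdist_graft_right: "a \<in> gverts H \<Longrightarrow> gdist (graft G v H w) v a = Suc (gdist H w a)"
  using represents_gdist_graft[OF G H disj, of a] disj by auto

lemma gdist_graft_left: "a \<in> gverts G \<Longrightarrow> gdist (graft G v H w) v a = gdist G v a"
  using represents_gdist_graft[OF G H disj, of a] by simp

lemma children_graft_right: "a \<in> gverts H \<Longrightarrow> children (graft G v H w) v a = children H w a"
  using children_graft[of a] disj by auto

lemma children_graft_left:
  "a \<in> gverts G \<Longrightarrow> a \<noteq> v \<Longrightarrow> children (graft G v H w) v a = children G v a"
  using children_graft[of a] by simp

lemma children_graft_root: "children (graft G v H w) v v = insert w (children G v v)"
  using children_graft[of v] represents_root_in[OF G] by simp

lemma subtree_graft_right:
  assumes "a \<in> gverts H"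
  shows "subtree (graft G v H w) v a = subtree H w a"
proof -
  have d: "descendants (graft G v H w) v a = descendants H w a \<and> descendants H w a \<subseteq> gverts H"
    using assms by (intro descendants_eq_on) (auto simp: children_graft_right children_subset)
  have "e \<in> gedges (graft G v H w) \<longleftrightarrow> e \<in> gedges H" if "e \<subseteq> gverts H" for e
  proof -
    have "e \<notin> gedges G"
      using simple_graph_edge[OF represents_simple_graph[OF G], of e] that disj by blast
    moreover have "e \<noteq> {v, w}" using represents_root_in[OF G] that disj by auto
    ultimately show ?thesis by (simp add: graft_def)
  qed
  with d have "{e \<in> gedges (graft G v H w). e \<subseteq> descendants H w a} =
      {e \<in> gedges H. e \<subseteq> descendants H w a}" by blast
  with d show ?thesis by (simp add: subtree_def induced_subgraph_def)
qed

text \<open>Only \<open>v\<close> gains a child, and \<open>v\<close> is nobody's child; hence the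
  set closed under children is \<open>gverts G - {v}\<close>.\<close>

lemma subtree_graft_left:
  assumes "a \<in> gverts G" "a \<noteq> v"
  shows "subtree (graft G v H w) v a = subtree G v a"
proof -
  have "v \<notin> children G v x" for x
    using represents_gdist_root[OF G] by (simp add: children_def)
  then have d: "descendants (graft G v H w) v a = descendants G v a \<and> descendants G v a \<subseteq> gverts G - {v}"
    using assms children_subset[of G v]
    by (intro descendants_eq_on) (auto simp: children_graft_left)
  have "e \<in> gedges (graft G v H w) \<longleftrightarrow> e \<in> gedges G" if "e \<subseteq> gverts G - {v}" for e
  proof -
    have "e \<notin> gedges H"
      using simple_graph_edge[OF represents_simple_graph[OF H], of e] that disj by blast
    moreover have "e \<noteq> {v, w}" using that by auto
    ultimately show ?thesis by (simp add: graft_def)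
  qed
  then have "{e \<in> gedges (graft G v H w). e \<subseteq> descendants G v a} =
      {e \<in> gedges G. e \<subseteq> descendants G v a}" using d by (intro Collect_cong) (meson subset_trans)
  with d show ?thesis by (simp add: subtree_def induced_subgraph_def)
qed

lemma subtree_graft_branch: "subtree (graft G v H w) v w = H"
  unfolding subtree_graft_right[OF represents_root_in[OF H]]
  by (simp add: subtree_def represents_descendants_root[OF H]
    induced_subgraph_gverts[OF represents_simple_graph[OF H]])

end

lemma represents_finite_children: "represents G v M \<Longrightarrow> finite (children G v a)"
  using finite_subset[OF children_subset[of G v a]] represents_simple_graph[of G v M]
  by (simp add: simple_graph_def)

lemma children_single [simp]: "children (single_vertex v) r a = {}"
  by (simp add: children_def)

lemma gdegree_single [simp]: "gdegree (single_vertex v) a = 0"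
  by (simp add: gdegree_def single_vertex_def)

lemma root_notin_children: "represents G v M \<Longrightarrow> v \<notin> children G v a"
  using represents_gdist_root by (fastforce simp: children_def)

lemma represents_gdegree:
  "represents G v M \<Longrightarrow> a \<in> gverts G \<Longrightarrow>
    gdegree G a = card (children G v a) + (if a = v then 0 else 1)"
proof (induction arbitrary: a rule: represents.induct)
  case (single v k)
  then show ?case by simp
next
  case (graft G v M H w N)
  note * = graft.hyps(1-3)
  have v: "v \<in> gverts G" "w \<in> gverts H" "w \<notin> gverts G" "v \<notin> gverts H"
    using represents_root_in[OF *(1)] represents_root_in[OF *(2)] *(3) by auto
  have w: "w \<notin> children G v v" using v children_subset[of G v v] by blast
  note s = represents_simple_graph[OF *(1)] represents_simple_graph[OF *(2)]
  show ?case
  proof (cases "a \<in> gverts G")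
    case True
    then have "a \<noteq> w" using v by auto
    with True show ?thesis
      using graft.IH(1)[OF True] v w represents_finite_children[OF *(1)]
      by (simp add: gdegree_graft[OF s *(3) v(1,2)] children_graft[OF *])
  next
    case False
    then have "a \<in> gverts H" "a \<noteq> v" using graft.prems v by auto
    with False show ?thesis
      using graft.IH(2)[OF \<open>a \<in> gverts H\<close>]
      by (simp add: gdegree_graft[OF s *(3) v(1,2)] children_graft[OF *])
  qed
qed

lemma represents_root_children:
  "represents G v M \<Longrightarrow> card (children G v v) = size {#t \<in># M. t \<noteq> Void#}"
proof (induction rule: represents.induct)
  case (graft G v M H w N)
  note * = graft.hyps(1-3)
  have "w \<notin> children G v v"
    using represents_root_in[OF *(2)] *(3) children_subset[of G v v] by blast
  then show ?case
    using graft.IH(1) represents_finite_children[OF *(1)] by (simp add: children_graft_root[OF *])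
qed simp

section \<open>Heights and free slots as distances\<close>

lemma represents_height:
  "represents G v M \<Longrightarrow> (\<forall>a\<in>gverts G. gdist G v a \<le> root_height M) \<and>
    (\<exists>a\<in>gverts G. gdist G v a = root_height M)"
proof (induction rule: represents.induct)
  case (single v k)
  have "represents (single_vertex v) v (replicate_mset k Void)" by (rule represents.single)
  from represents_gdist_root[OF this] show ?case
    by (auto simp: root_height_def)
next
  case (graft G v M H w N)
  note * = graft.hyps(1-3)
  have "gdist (graft G v H w) v a \<le> root_height (add_mset (Node N) M)"
    if "a \<in> gverts (graft G v H w)" for a
    using that graft.IH gdist_graft_left[OF *, of a] gdist_graft_right[OF *, of a]
    by (force simp: root_height_add)
  moreover have "\<exists>a\<in>gverts (graft G v H w). gdist (graft G v H w) v a = root_height (add_mset (Node N) M)"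
  proof (cases "Suc (root_height N) \<le> root_height M")
    case True
    obtain a where "a \<in> gverts G" "gdist G v a = root_height M" using graft.IH(1) by blast
    then show ?thesis
      using True gdist_graft_left[OF *, of a] by (intro bexI[of _ a]) (auto simp: root_height_add)
  next
    case False
    obtain a where "a \<in> gverts H" "gdist H w a = root_height N" using graft.IH(2) by blast
    then show ?thesis
      using False gdist_graft_right[OF *, of a] by (intro bexI[of _ a]) (auto simp: root_height_add)
  qed
  ultimately show ?case by blast
qed

text \<open>A vertex with fewer children than slots owns a void. A branch counts depths from its own
  top, which is at distance 1 from \<open>v\<close>, and a void lies one level below its owner; the
  two shifts cancel, so \<open>void_depth t\<close> is the distance of the owner from
  \<open>v\<close>.\<close>

lemma represents_voids:
  "represents G v M \<Longrightarrow> d \<ge> 1 \<Longrightarrow> \<forall>t\<in>#M. regular d t \<Longrightarrow>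
    (\<forall>a\<in>gverts G. card (children G v a) < (if a = v then size M else d) \<longrightarrow>
      (\<exists>t\<in>#M. void_depth t \<le> gdist G v a)) \<and>
    (\<forall>t\<in>#M. \<exists>a\<in>gverts G. card (children G v a) < (if a = v then size M else d) \<and>
      gdist G v a = void_depth t)"
proof (induction rule: represents.induct)
  case (single v k)
  have "represents (single_vertex v) v (replicate_mset k Void)" by (rule represents.single)
  from represents_gdist_root[OF this] show ?case by (auto split: if_splits)
next
  case (graft G v M H w N)
  note * = graft.hyps(1-3)
  have N: "size N = d" "\<forall>t\<in>#N. regular d t" and M: "\<forall>t\<in>#M. regular d t"
    using graft.prems by auto
  then have "N \<noteq> {#}" using graft.prems(1) by auto
  have v: "v \<in> gverts G" "w \<in> gverts H" "w \<notin> gverts G" "v \<notin> gverts H"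
    using represents_root_in[OF *(1)] represents_root_in[OF *(2)] *(3) by auto
  have w: "w \<notin> children G v v" using v children_subset[of G v v] by blast
  note IH1 = graft.IH(1)[OF graft.prems(1) M] and IH2 = graft.IH(2)[OF graft.prems(1) N(2)]
  let ?cap = "\<lambda>a. if a = v then size (add_mset (Node N) M) else d"
  have left: "card (children (graft G v H w) v a) < ?cap a \<longleftrightarrow>
      card (children G v a) < (if a = v then size M else d)" if "a \<in> gverts G" for a
    using that w represents_finite_children[OF *(1)]
    by (simp add: children_graft[OF *])
  have right: "card (children (graft G v H w) v a) < ?cap a \<longleftrightarrow>
      card (children H w a) < (if a = w then size N else d)" if "a \<in> gverts H" for a
    using that v N by (auto simp: children_graft_right[OF *])
  have "\<exists>t\<in>#add_mset (Node N) M. void_depth t \<le> gdist (graft G v H w) v a"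
    if a: "a \<in> gverts (graft G v H w)" "card (children (graft G v H w) v a) < ?cap a" for a
  proof (cases "a \<in> gverts G")
    case True
    then obtain t where "t \<in># M" "void_depth t \<le> gdist G v a"
      using IH1 left a(2) by blast
    then show ?thesis using gdist_graft_left[OF * True] by auto
  next
    case False
    then have aH: "a \<in> gverts H" using a(1) by simp
    then obtain t where "t \<in># N" "void_depth t \<le> gdist H w a"
      using IH2 right a(2) by blast
    then show ?thesis using gdist_graft_right[OF * aH] root_void_depth_le[of t N]
      by (intro bexI[of _ "Node N"]) auto
  qed
  moreover have "\<exists>a\<in>gverts (graft G v H w). card (children (graft G v H w) v a) < ?cap a \<and>
      gdist (graft G v H w) v a = void_depth t" if t: "t \<in># add_mset (Node N) M" for t
  proof (cases "t \<in># M")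
    case True
    then obtain a where "a \<in> gverts G" "card (children G v a) < (if a = v then size M else d)"
      "gdist G v a = void_depth t" using IH1 by blast
    then show ?thesis using left gdist_graft_left[OF *] by (intro bexI[of _ a]) auto
  next
    case False
    obtain s where "s \<in># N" and s: "void_depth s = root_void_depth N"
      using root_void_depth_attained[OF \<open>N \<noteq> {#}\<close>] .
    then obtain a where "a \<in> gverts H" "card (children H w a) < (if a = w then size N else d)"
      "gdist H w a = void_depth s" using IH2 by blast
    then show ?thesis using False t s right gdist_graft_right[OF *] by (intro bexI[of _ a]) auto
  qed
  ultimately show ?case by blast
qed

lemma represents_root_void_depth:
  assumes "represents G v M" "d \<ge> 1" "\<forall>t\<in>#M. regular d t" "M \<noteq> {#}"
  shows "\<And>a. a \<in> gverts G \<Longrightarrow> card (children G v a) < (if a = v then size M else d) \<Longrightarrow>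
      root_void_depth M \<le> gdist G v a"
    and "\<exists>a\<in>gverts G. card (children G v a) < (if a = v then size M else d) \<and>
      gdist G v a = root_void_depth M"
proof -
  note voids = represents_voids[OF assms(1-3)]
  show "root_void_depth M \<le> gdist G v a"
    if "a \<in> gverts G" "card (children G v a) < (if a = v then size M else d)" for a
    using voids that root_void_depth_le[of _ M] le_trans by blast
  obtain s where "s \<in># M" and "void_depth s = root_void_depth M"
    using root_void_depth_attained[OF assms(4)] .
  then show "\<exists>a\<in>gverts G. card (children G v a) < (if a = v then size M else d) \<and>
      gdist G v a = root_void_depth M"
    using voids by metis
qed

lemma represents_children_le:
  "represents G v M \<Longrightarrow> \<forall>t\<in>#M. regular d t \<Longrightarrow> a \<in> gverts G \<Longrightarrow>
    card (children G v a) \<le> (if a = v then size M else d)"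
proof (induction arbitrary: a rule: represents.induct)
  case (graft G v M H w N)
  note * = graft.hyps(1-3)
  have v: "v \<in> gverts G" "w \<in> gverts H" "w \<notin> gverts G" "v \<notin> gverts H"
    using represents_root_in[OF *(1)] represents_root_in[OF *(2)] *(3) by auto
  show ?case
  proof (cases "a \<in> gverts G")
    case True
    then have "card (children G v a) \<le> (if a = v then size M else d)"
      using graft.IH(1)[of a] graft.prems by simp
    moreover have "card (insert w (children G v a)) \<le> Suc (card (children G v a))"
      using represents_finite_children[OF *(1)] by (simp add: card_insert_if)
    ultimately show ?thesis
      using True by (auto simp: children_graft[OF *] split: if_splits)
  next
    case False
    then have "a \<in> gverts H" "a \<noteq> v" using graft.prems v by auto
    with graft.IH(2)[of a] graft.prems show ?thesis
      by (auto simp: children_graft_right[OF *] split: if_splits)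
  qed
qed simp

section \<open>Greedy trees and greedy multisets of branches\<close>

lemma is_perfect_Void [simp]: "is_perfect d Void"
  unfolding is_perfect_def by (rule exI[of _ 0]) simp

text \<open>In a complete tree a deepest vertex and the owner of a highest void are both leaves, the
  latter because fewer than \<open>d\<close> children means none; so height and void depth agree.
  Conversely, if they agree, the owner of a void is at maximal distance and has no children.\<close>

lemma represents_complete_iff:
  assumes rep: "represents G v M" and d: "d \<ge> 1" and reg: "regular d (Node M)"
  shows "(\<exists>h. complete_dary_tree d h G v) \<longleftrightarrow> is_perfect d (Node M)"
proof -
  have M: "size M = d" "\<forall>t\<in>#M. regular d t" "M \<noteq> {#}" using reg d by auto
  have height: "\<And>a. a \<in> gverts G \<Longrightarrow> gdist G v a \<le> root_height M"
    "\<exists>a\<in>gverts G. gdist G v a = root_height M"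
    using represents_height[OF rep] by blast+
  have void: "\<And>a. a \<in> gverts G \<Longrightarrow> card (children G v a) < d \<Longrightarrow> root_void_depth M \<le> gdist G v a"
    "\<exists>a\<in>gverts G. card (children G v a) < d \<and> gdist G v a = root_void_depth M"
    using represents_root_void_depth[OF rep d M(2,3)] M(1) by auto
  note fin = represents_finite_children[OF rep]
  show ?thesis
  proof
    assume "\<exists>h. complete_dary_tree d h G v"
    then obtain h where h: "\<And>a. a \<in> gverts G \<Longrightarrow> card (children G v a) = 0 \<or> card (children G v a) = d"
      "\<And>a. a \<in> gverts G \<Longrightarrow> children G v a = {} \<Longrightarrow> gdist G v a = h - 1"
      by (auto simp: complete_dary_tree_def dary_tree_def)
    obtain a where a: "a \<in> gverts G" "gdist G v a = root_height M" using height(2) by blast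
    have "children G v a = {}"
      using a(2) height(1) by (fastforce simp: children_def)
    then have "root_height M = h - 1" using h(2)[OF a(1)] a(2) by simp
    moreover obtain b where b: "b \<in> gverts G" "card (children G v b) < d"
      "gdist G v b = root_void_depth M" using void(2) by blast
    have "children G v b = {}" using h(1)[OF b(1)] b(2) fin by auto
    then have "root_void_depth M = h - 1" using h(2)[OF b(1)] b(3) by simp
    ultimately show "is_perfect d (Node M)" using is_perfect_iff[OF d reg] by simp
  next
    assume "is_perfect d (Node M)"
    then have eq: "root_void_depth M = root_height M" using is_perfect_iff[OF d reg] by simp
    have "card (children G v a) = 0 \<or> card (children G v a) = d" if a: "a \<in> gverts G" for a
    proof (rule ccontr)
      assume *: "\<not> ?thesis"
      have "card (children G v a) \<le> d"
        using represents_children_le[OF rep M(2) a] M(1) by (simp split: if_splits)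
      then have "root_height M \<le> gdist G v a" using * void(1)[OF a] eq by simp
      moreover obtain u where "u \<in> children G v a" using * fin by (metis card.empty ex_in_conv)
      then have "gdist G v a < root_height M"
        using height(1)[of u] by (simp add: children_def)
      ultimately show False by simp
    qed
    moreover have "gdist G v a = root_height M" if "a \<in> gverts G" "children G v a = {}" for a
      using void(1)[OF that(1)] height(1)[OF that(1)] that(2) d eq by simp
    ultimately have "complete_dary_tree d (Suc (root_height M)) G v"
      using represents_is_tree[OF rep] represents_root_in[OF rep]
      by (simp add: complete_dary_tree_def dary_tree_def)
    then show "\<exists>h. complete_dary_tree d h G v" by blast
  qed
qed

definition incomplete_children :: "nat \<Rightarrow> 'a ugraph \<Rightarrow> 'a \<Rightarrow> 'a \<Rightarrow> 'a set" where
  "incomplete_children d G r a =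
    {u \<in> children G r a. \<nexists>h. complete_dary_tree d h (subtree G r u) u}"

context
  fixes d :: nat and G H :: "'a ugraph" and v w M N
  assumes d: "d \<ge> 1" and G: "represents G v M" and H: "represents H w N"
    and disj: "gverts G \<inter> gverts H = {}" and N: "regular d (Node N)"
begin

lemma incomplete_children_graft_right:
  "a \<in> gverts H \<Longrightarrow> incomplete_children d (graft G v H w) v a = incomplete_children d H w a"
  using children_subset[of H w a]
  by (auto simp: incomplete_children_def children_graft_right[OF G H disj]
    subtree_graft_right[OF G H disj] subsetD)

lemma incomplete_children_graft_left:
  assumes "a \<in> gverts G" "a \<noteq> v"
  shows "incomplete_children d (graft G v H w) v a = incomplete_children d G v a"
proof -
  have "subtree (graft G v H w) v u = subtree G v u" if "u \<in> children G v a" for u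
    using that children_subset[of G v a] root_notin_children[OF G, of a]
    by (intro subtree_graft_left[OF G H disj]) auto
  then show ?thesis
    unfolding incomplete_children_def children_graft_left[OF G H disj assms]
    by (intro Collect_cong) (metis (no_types))
qed

lemma incomplete_children_graft_root:
  "incomplete_children d (graft G v H w) v v =
    (if is_perfect d (Node N) then {} else {w}) \<union> incomplete_children d G v v"
proof -
  have "subtree (graft G v H w) v u = subtree G v u" if "u \<in> children G v v" for u
    using that children_subset[of G v v] root_notin_children[OF G, of v]
    by (intro subtree_graft_left[OF G H disj]) auto
  then have "{u \<in> children G v v. \<nexists>h. complete_dary_tree d h (subtree (graft G v H w) v u) u} =
      incomplete_children d G v v"
    unfolding incomplete_children_def by (intro Collect_cong) (metis (no_types))
  moreover have "incomplete_children d (graft G v H w) v v =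
      (if is_perfect d (Node N) then {} else {w}) \<union>
      {u \<in> children G v v. \<nexists>h. complete_dary_tree d h (subtree (graft G v H w) v u) u}"
    unfolding incomplete_children_def children_graft_root[OF G H disj]
      represents_complete_iff[OF H d N, symmetric]
    by (auto simp: subtree_graft_branch[OF G H disj])
  ultimately show ?thesis by simp
qed

end

lemma card_incomplete_children_root:
  "represents G v M \<Longrightarrow> d \<ge> 1 \<Longrightarrow> \<forall>t\<in>#M. regular d t \<Longrightarrow>
    card (incomplete_children d G v v) = size {#t \<in># M. \<not> is_perfect d t#}"
proof (induction rule: represents.induct)
  case (single v k)
  then show ?case by (simp add: incomplete_children_def)
next
  case (graft G v M H w N)
  note * = graft.hyps(1-3)
  have N: "regular d (Node N)" using graft.prems by simp
  have sub: "incomplete_children d G v v \<subseteq> children G v v"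
    by (auto simp: incomplete_children_def)
  then have "w \<notin> incomplete_children d G v v"
    using represents_root_in[OF *(2)] *(3) children_subset[of G v v] by blast
  moreover have "finite (incomplete_children d G v v)"
    using sub represents_finite_children[OF *(1)] by (rule finite_subset)
  ultimately show ?case
    using graft.IH(1) graft.prems unfolding incomplete_children_graft_root[OF graft.prems(1) * N]
    by simp
qed

text \<open>The root is set apart because its own condition is counted by
  \<open>card_incomplete_children_root\<close>; the top \<open>w\<close> of a grafted branch becomes
  an ordinary vertex and then needs that count.\<close>

lemma incomplete_children_iff_well_filled:
  "represents G v M \<Longrightarrow> d \<ge> 1 \<Longrightarrow> \<forall>t\<in>#M. regular d t \<Longrightarrow>
    (\<forall>a\<in>gverts G - {v}. card (incomplete_children d G v a) \<le> 1) \<longleftrightarrow> (\<forall>t\<in>#M. well_filled d t)"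
proof (induction rule: represents.induct)
  case (graft G v M H w N)
  note * = graft.hyps(1-3)
  have N: "regular d (Node N)" using graft.prems by simp
  have v: "v \<in> gverts G" "w \<in> gverts H" "w \<notin> gverts G" "v \<notin> gverts H"
    using represents_root_in[OF *(1)] represents_root_in[OF *(2)] *(3) by auto
  have verts: "gverts (graft G v H w) - {v} = (gverts G - {v}) \<union> (insert w (gverts H - {w}))"
    using v by auto
  have left: "(\<forall>a\<in>gverts G - {v}. card (incomplete_children d (graft G v H w) v a) \<le> 1) \<longleftrightarrow>
      (\<forall>t\<in>#M. well_filled d t)"
    using graft.IH(1) graft.prems incomplete_children_graft_left[OF graft.prems(1) * N] by simp
  have right: "(\<forall>a\<in>gverts H - {w}. card (incomplete_children d (graft G v H w) v a) \<le> 1) \<longleftrightarrow>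
      (\<forall>t\<in>#N. well_filled d t)"
    using graft.IH(2) graft.prems(1) N incomplete_children_graft_right[OF graft.prems(1) * N] by simp
  have "card (incomplete_children d (graft G v H w) v w) = size {#t \<in># N. \<not> is_perfect d t#}"
    using card_incomplete_children_root[OF *(2) graft.prems(1)] N
      incomplete_children_graft_right[OF graft.prems(1) * N v(2)] by simp
  with left right show ?case unfolding verts by (auto simp: ball_Un)
qed simp

lemma greedy_rooted_imp_root_greedy:
  assumes greedy: "greedy_rooted d G r" and rep: "represents G r R"
    and reg: "root_regular d R" and d: "d \<ge> 1"
  shows "root_greedy d R"
proof -
  have R: "\<forall>t\<in>#R. regular d t" "size R = Suc d" using reg by (auto simp: root_regular_def)
  then have ne: "R \<noteq> {#}" by auto
  have inc: "\<forall>a\<in>gverts G. card (incomplete_children d G r a) \<le> 1"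
    using greedy unfolding greedy_rooted_def incomplete_children_def by blast
  have "root_height R \<le> Suc (root_void_depth R)"
  proof (rule ccontr)
    assume *: "\<not> ?thesis"
    obtain y where y: "y \<in> gverts G" "gdist G r y = root_height R"
      using represents_height[OF rep] by blast
    obtain x where x: "x \<in> gverts G" "card (children G r x) < (if x = r then size R else d)"
      "gdist G r x = root_void_depth R"
      using represents_root_void_depth(2)[OF rep d R(1) ne] by blast
    \<comment> \<open>The owner \<open>x\<close> of a highest void has degree below
      \<open>d + 1\<close>, so the last condition of \<open>greedy_rooted\<close> forbids vertices
      two levels below it.\<close>
    have "gdist G r x + 2 \<le> gdist G r y" using x(3) y(2) * by simp
    then have "gdegree G x = d + 1"
      using greedy x(1) y(1) unfolding greedy_rooted_def by blast
    then show False
      using represents_gdegree[OF rep x(1)] x(2) R(2) by (simp split: if_splits)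
  qed
  moreover have "size {#t \<in># R. \<not> is_perfect d t#} \<le> 1"
    using card_incomplete_children_root[OF rep d R(1)] inc represents_root_in[OF rep] by metis
  moreover have "\<forall>t\<in>#R. well_filled d t"
    using incomplete_children_iff_well_filled[OF rep d R(1)] inc by blast
  ultimately show ?thesis using reg by (simp add: root_greedy_def)
qed

lemma represents_gdegree_le:
  assumes rep: "represents G r R" and reg: "root_regular d R" and a: "a \<in> gverts G"
  shows "gdegree G a \<le> d + 1"
  using represents_gdegree[OF rep a] represents_children_le[OF rep _ a, of d] reg
  by (auto simp: root_regular_def split: if_splits)

lemma root_greedy_imp_greedy_rooted:
  assumes greedy: "root_greedy d R" and rep: "represents G r R"
    and n: "root_nodes R \<ge> d + 2" and d: "d \<ge> 1"
  shows "greedy_rooted d G r"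
proof -
  have reg: "root_regular d R" using greedy by (simp add: root_greedy_def)
  then have R: "\<forall>t\<in>#R. regular d t" "size R = Suc d" by (auto simp: root_regular_def)
  then have ne: "R \<noteq> {#}" by auto
  have r: "r \<in> gverts G" using represents_root_in[OF rep] .
  \<comment> \<open>A void at the root forces height at most 1 and hence at most
    \<open>d + 1\<close> nodes, against the bound \<open>d + 2\<close>.\<close>
  have "Void \<notin># R"
  proof
    assume "Void \<in># R"
    then obtain R' where R': "R = add_mset Void R'" by (meson mset_add)
    have "root_height R \<le> Suc 0"
      using greedy root_void_depth_le[OF \<open>Void \<in># R\<close>] by (simp add: root_greedy_def)
    then have "nodes t \<le> 1" if "t \<in># R'" for t
      using nodes_le_perfect[of d t 1] that R(1) R' by (simp add: root_height_le_iff)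
    then have "(\<Sum>t\<in>#R'. nodes t) \<le> size R' * 1" by (rule sum_mset_le_size_mult)
    then show False using n R(2) R' by (simp add: root_nodes_def)
  qed
  then have "{#t \<in># R. t \<noteq> Void#} = R" by (auto simp: filter_mset_eq_conv)
  then have degr: "gdegree G r = d + 1"
    using represents_gdegree[OF rep r] represents_root_children[OF rep] R(2) by simp
  have le: "gdegree G a \<le> d + 1" if "a \<in> gverts G" for a
    using represents_gdegree_le[OF rep reg that] .
  have fin: "finite (gverts G)" using represents_simple_graph[OF rep] by (simp add: simple_graph_def)
  have max: "max_degree G = d + 1"
    unfolding max_degree_def using fin le degr r by (intro Max_eqI) (auto intro: rev_image_eqI)
  have full: "gdegree G x = d + 1"
    if x: "x \<in> gverts G" "y \<in> gverts G" "gdist G r x + 2 \<le> gdist G r y" for x y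
  proof (rule ccontr)
    assume "gdegree G x \<noteq> d + 1"
    then have "card (children G r x) < (if x = r then size R else d)"
      using le[OF x(1)] represents_gdegree[OF rep x(1)] R(2) by (simp split: if_splits)
    then have "root_void_depth R \<le> gdist G r x"
      using represents_root_void_depth(1)[OF rep d R(1) ne x(1)] by blast
    moreover have "gdist G r y \<le> root_height R" using represents_height[OF rep] x(2) by blast
    ultimately show False using greedy x(3) by (simp add: root_greedy_def)
  qed
  \<comment> \<open>A leaf lying two or more levels above another vertex would have degree
    \<open>d + 1\<close>, which is at least 2.\<close>
  have leaves: "gdist G r x \<le> gdist G r y + 1"
    if "x \<in> gverts G" "y \<in> gverts G" "gdegree G y = 1" for x y
    using full[OF that(2,1)] that(3) d by fastforce
  have "card (incomplete_children d G r a) \<le> 1" if "a \<in> gverts G" for a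
    using that card_incomplete_children_root[OF rep d R(1)] greedy
      incomplete_children_iff_well_filled[OF rep d R(1)]
    by (cases "a = r") (auto simp: root_greedy_def)
  then have "\<forall>a\<in>gverts G.
      card {u \<in> children G r a. \<nexists>h. complete_dary_tree d h (subtree G r u) u} \<le> 1"
    unfolding incomplete_children_def by blast
  with represents_is_tree[OF rep] r max degr leaves full show ?thesis
    unfolding greedy_rooted_def by (intro conjI) blast+
qed

section \<open>Realising branches by graphs, rerooting and isomorphism\<close>

lemma represents_add_Void: "represents G v M \<Longrightarrow> represents G v (add_mset Void M)"
proof (induction rule: represents.induct)
  case (single v k)
  show ?case using represents.single[of v "Suc k"] by simp
next
  case (graft G v M H w N)
  show ?case
    using represents.graft[OF graft.IH(1) graft.hyps(2,3)] by (simp add: add_mset_commute)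
qed

text \<open>The finite set to be avoided has to be arbitrary in the induction, so that each further
  branch can be built disjoint from the graph already present.\<close>

lemma represents_exists:
  fixes X :: "nat set"
  assumes "finite X"
  shows "\<exists>G v. represents G v M \<and> gverts G \<inter> X = {}"
proof -
  define P where "P N \<longleftrightarrow> (\<forall>X :: nat set. finite X \<longrightarrow> (\<exists>G v. represents G v N \<and> gverts G \<inter> X = {}))" for N
  have multiset: "P M" if "\<And>N. Node N \<in># M \<Longrightarrow> P N" for M
    using that
  proof (induction M)
    case empty
    have "\<exists>G v. represents G v {#} \<and> gverts G \<inter> X = {}" if X: "finite X" for X :: "nat set"
    proof -
      obtain v where "v \<notin> X" using ex_new_if_finite[OF infinite_UNIV_nat X] by blast
      moreover have "represents (single_vertex v) v {#}" using represents.single[of v 0] by simp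
      ultimately show ?thesis by (intro exI[of _ "single_vertex v"] exI[of _ v]) simp
    qed
    then show ?case by (simp add: P_def)
  next
    case (add t M)
    have IH: "P M" by (rule add.IH) (use add.prems in simp)
    have "\<exists>G v. represents G v (add_mset t M) \<and> gverts G \<inter> X = {}" if X: "finite X" for X :: "nat set"
    proof -
      obtain G v where G: "represents G v M" "gverts G \<inter> X = {}" using IH X unfolding P_def by blast
      show ?thesis
      proof (cases t)
        case Void
        then show ?thesis using represents_add_Void[OF G(1)] G(2) by blast
      next
        case (Node N)
        have fin: "finite (X \<union> gverts G)"
          using X represents_simple_graph[OF G(1)] by (simp add: simple_graph_def)
        have "P N" using add.prems[of N] Node by simp
        then obtain H w where H: "represents H w N" "gverts H \<inter> (X \<union> gverts G) = {}"
          using fin unfolding P_def by blast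
        then have "gverts G \<inter> gverts H = {}" by blast
        from represents.graft[OF G(1) H(1) this] show ?thesis
          using G(2) H(2) Node by (intro exI[of _ "graft G v H w"] exI[of _ v]) auto
      qed
    qed
    then show ?case by (simp add: P_def)
  qed
  have "\<forall>N. t = Node N \<longrightarrow> P N" for t
    by (induction t) (use multiset in blast)+
  then show ?thesis using assms unfolding P_def by blast
qed

text \<open>A derivation fixes the order of grafting but the multiset does not; any branch can be
  taken as the one grafted last.\<close>

lemma represents_split:
  assumes "represents G v R" "R = add_mset (Node N) M"
  shows "\<exists>G' H w. G = graft G' v H w \<and> represents G' v M \<and> represents H w N \<and> gverts G' \<inter> gverts H = {}"
  using assms
proof (induction arbitrary: M rule: represents.induct)
  case (single v k)
  then have "Node N \<in># replicate_mset k Void" by simp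
  then show ?case by (simp split: if_splits)
next
  case (graft G v M\<^sub>1 H w N\<^sub>1)
  consider "Node N\<^sub>1 = Node N" "M\<^sub>1 = M"
    | K where "M\<^sub>1 = add_mset (Node N) K" "M = add_mset (Node N\<^sub>1) K"
    using graft.prems by (auto simp: add_eq_conv_ex)
  then show ?case
  proof cases
    case 1
    then show ?thesis using graft.hyps by blast
  next
    case 2
    obtain G' H' w' where G: "G = graft G' v H' w'" "represents G' v K" "represents H' w' N"
      "gverts G' \<inter> gverts H' = {}" using graft.IH(1)[OF 2(1)] by blast
    have disj: "gverts G' \<inter> gverts H = {}" "gverts (graft G' v H w) \<inter> gverts H' = {}"
      using graft.hyps(3) G(1,4) by auto
    have "graft G v H w = graft (graft G' v H w) v H' w'"
      unfolding G(1) by (auto simp: graft_def)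
    then show ?thesis
      using represents.graft[OF G(2) graft.hyps(2) disj(1)] 2(2) G(3) disj(2) by blast
  qed
qed

text \<open>A graft is symmetric in its two sides, so a rerooting step reads the same graph from the
  other end of one edge.\<close>

lemma represents_reroot:
  assumes "reroot\<^sup>*\<^sup>* R R'" "represents G v R"
  shows "\<exists>w. represents G w R'"
  using assms
proof (induction rule: rtranclp_induct)
  case (step R' R'')
  then obtain v' where v': "represents G v' R'" by blast
  obtain N M where NM: "R' = add_mset (Node N) M" "R'' = add_mset (Node M) N"
    using step.hyps(2) by (auto elim: reroot.cases)
  obtain G' H w where G: "G = graft G' v' H w" "represents G' v' M" "represents H w N"
    "gverts G' \<inter> gverts H = {}" using represents_split[OF v' NM(1)] by blast
  have "G = graft H w G' v'" unfolding G(1) by (auto simp: graft_def)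
  then show ?case
    using represents.graft[OF G(3,2)] G(4) NM(2) by (metis inf_commute)
qed blast

text \<open>\<open>represents_split\<close> removes the same branch on both sides and the two
  bijections are glued; tracking \<open>f v = v'\<close> makes the connecting edges
  correspond.\<close>

lemma represents_isomorphic:
  assumes "represents G v M" "represents G' v' M"
  shows "\<exists>f. bij_betw f (gverts G) (gverts G') \<and> f v = v' \<and>
    (\<forall>a\<in>gverts G. \<forall>b\<in>gverts G. adjacent G a b \<longleftrightarrow> adjacent G' (f a) (f b))"
  using assms
proof (induction arbitrary: G' v' rule: represents.induct)
  case (single v k)
  from single.prems have "G' = single_vertex v'"
  proof (cases rule: represents.cases)
    case (graft G N H w N')
    then have "Node N' \<in># replicate_mset k Void" by (metis union_single_eq_member)
    then show ?thesis by (simp split: if_splits)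
  qed simp
  then show ?case by (intro exI[of _ "\<lambda>_. v'"]) (simp add: bij_betw_def)
next
  case (graft G v M H w N)
  obtain G\<^sub>1 H\<^sub>1 w\<^sub>1 where G': "G' = graft G\<^sub>1 v' H\<^sub>1 w\<^sub>1" "represents G\<^sub>1 v' M"
    "represents H\<^sub>1 w\<^sub>1 N" "gverts G\<^sub>1 \<inter> gverts H\<^sub>1 = {}"
    using represents_split[OF graft.prems refl] by blast
  obtain f where f: "bij_betw f (gverts G) (gverts G\<^sub>1)" "f v = v'"
    "\<forall>a\<in>gverts G. \<forall>b\<in>gverts G. adjacent G a b \<longleftrightarrow> adjacent G\<^sub>1 (f a) (f b)"
    using graft.IH(1)[OF G'(2)] by blast
  obtain g where g: "bij_betw g (gverts H) (gverts H\<^sub>1)" "g w = w\<^sub>1"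
    "\<forall>a\<in>gverts H. \<forall>b\<in>gverts H. adjacent H a b \<longleftrightarrow> adjacent H\<^sub>1 (g a) (g b)"
    using graft.IH(2)[OF G'(3)] by blast
  define h where "h = (\<lambda>a. if a \<in> gverts G then f a else g a)"
  have hf: "h a = f a" "f a \<in> gverts G\<^sub>1" if "a \<in> gverts G" for a
    using that f(1) by (auto simp: h_def bij_betw_def)
  have hg: "h a = g a" "g a \<in> gverts H\<^sub>1" if "a \<in> gverts H" for a
    using that graft.hyps(3) g(1) by (auto simp: h_def bij_betw_def)
  have bij: "bij_betw h (gverts G \<union> gverts H) (gverts G\<^sub>1 \<union> gverts H\<^sub>1)"
  proof (rule bij_betw_combine[OF _ _ G'(4)])
    show "bij_betw h (gverts G) (gverts G\<^sub>1)" using f(1) hf(1) by (simp cong: bij_betw_cong)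
    show "bij_betw h (gverts H) (gverts H\<^sub>1)" using g(1) hg(1) by (simp cong: bij_betw_cong)
  qed
  have roots: "v \<in> gverts G" "w \<in> gverts H" "v' \<in> gverts G\<^sub>1" "w\<^sub>1 \<in> gverts H\<^sub>1"
    using graft.hyps G' represents_root_in by metis+
  have injf: "f a = f b \<longleftrightarrow> a = b" if "a \<in> gverts G" "b \<in> gverts G" for a b
    using f(1) that by (auto simp: bij_betw_def inj_on_def)
  have injg: "g a = g b \<longleftrightarrow> a = b" if "a \<in> gverts H" "b \<in> gverts H" for a b
    using g(1) that by (auto simp: bij_betw_def inj_on_def)
  have no: "\<not> adjacent K a b" if "simple_graph K" "a \<notin> gverts K \<or> b \<notin> gverts K" for K :: "'c ugraph" and a b
    using simple_graph_adjacent[OF that(1)] that(2) by blast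
  note noG = no[OF represents_simple_graph[OF graft.hyps(1)]]
    no[OF represents_simple_graph[OF graft.hyps(2)]]
    no[OF represents_simple_graph[OF G'(2)]] no[OF represents_simple_graph[OF G'(3)]]
  have adj: "adjacent (graft G v H w) a b \<longleftrightarrow> adjacent (graft G\<^sub>1 v' H\<^sub>1 w\<^sub>1) (h a) (h b)"
    if ab: "a \<in> gverts G \<union> gverts H" "b \<in> gverts G \<union> gverts H" for a b
  proof -
    consider "a \<in> gverts G" "b \<in> gverts G" | "a \<in> gverts G" "b \<in> gverts H"
      | "a \<in> gverts H" "b \<in> gverts G" | "a \<in> gverts H" "b \<in> gverts H"
      using ab by blast
    then show ?thesis
    proof cases
      case 1
      have "a \<noteq> w" "b \<noteq> w" "f a \<noteq> w\<^sub>1" "f b \<noteq> w\<^sub>1"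
        using 1 roots graft.hyps(3) G'(4) hf(2) by blast+
      moreover have "\<not> adjacent H a b" "\<not> adjacent H\<^sub>1 (f a) (f b)"
        using noG(2,4) 1 graft.hyps(3) G'(4) hf(2) by blast+
      ultimately show ?thesis using 1 f(3) by (simp add: adjacent_graft hf)
    next
      case 2
      have *: "a \<notin> gverts H" "b \<notin> gverts G" "f a \<notin> gverts H\<^sub>1" "g b \<notin> gverts G\<^sub>1"
        using 2 graft.hyps(3) G'(4) hf(2)[OF 2(1)] hg(2)[OF 2(2)] by blast+
      then have "a \<noteq> w" "b \<noteq> v" "f a \<noteq> w\<^sub>1" "g b \<noteq> v'" using roots by auto
      moreover have "f a = v' \<longleftrightarrow> a = v" "g b = w\<^sub>1 \<longleftrightarrow> b = w"
        using injf[OF 2(1) roots(1)] injg[OF 2(2) roots(2)] f(2) g(2) by auto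
      ultimately show ?thesis using 2 * by (simp add: adjacent_graft hf hg noG)
    next
      case 3
      have *: "b \<notin> gverts H" "a \<notin> gverts G" "f b \<notin> gverts H\<^sub>1" "g a \<notin> gverts G\<^sub>1"
        using 3 graft.hyps(3) G'(4) hf(2)[OF 3(2)] hg(2)[OF 3(1)] by blast+
      then have "b \<noteq> w" "a \<noteq> v" "f b \<noteq> w\<^sub>1" "g a \<noteq> v'" using roots by auto
      moreover have "f b = v' \<longleftrightarrow> b = v" "g a = w\<^sub>1 \<longleftrightarrow> a = w"
        using injf[OF 3(2) roots(1)] injg[OF 3(1) roots(2)] f(2) g(2) by auto
      ultimately show ?thesis using 3 * by (simp add: adjacent_graft hf hg noG)
    next
      case 4
      have "a \<noteq> v" "b \<noteq> v" "g a \<noteq> v'" "g b \<noteq> v'"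
        using 4 roots graft.hyps(3) G'(4) hg(2) by blast+
      moreover have "\<not> adjacent G a b" "\<not> adjacent G\<^sub>1 (g a) (g b)"
        using noG(1,3) 4 graft.hyps(3) G'(4) hg(2) by blast+
      ultimately show ?thesis using 4 g(3) by (simp add: adjacent_graft hg)
    qed
  qed
  show ?case
    unfolding G'(1) gverts_graft
    using bij adj hf(1)[OF roots(1)] f(2) by (intro exI[of _ h]) simp
qed

lemma represents_same_isomorphic:
  "represents G v M \<Longrightarrow> represents G' v' M \<Longrightarrow> graph_isomorphic G G'"
  using represents_isomorphic[of G v M G' v'] unfolding graph_isomorphic_def by blast

text \<open>The degree bound says that \<open>p\<close> has a free slot; the leaf fills it as a node
  with \<open>d\<close> voids.\<close>

lemma represents_add_leaf:
  "represents G v M \<Longrightarrow> \<forall>t\<in>#M. regular d t \<Longrightarrow> p \<in> gverts G \<Longrightarrow> l \<notin> gverts G \<Longrightarrow>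
    gdegree G p < (if p = v then size M else Suc d) \<Longrightarrow>
    \<exists>M'. represents (graft G p (single_vertex l) l) v M' \<and> size M' = size M \<and> (\<forall>t\<in>#M'. regular d t)"
proof (induction rule: represents.induct)
  case (single v k)
  then obtain j where k: "k = Suc j" by (cases k) auto
  have "represents (graft (single_vertex v) v (single_vertex l) l) v
      (add_mset (Node (replicate_mset d Void)) (replicate_mset j Void))"
    using single.prems by (intro represents.graft represents.single) auto
  then show ?case
    using single.prems k by (intro exI conjI) (auto split: if_splits)
next
  case (graft G v M H w N)
  note * = graft.hyps(1-3)
  have N: "size N = d" "\<forall>t\<in>#N. regular d t" and M: "\<forall>t\<in>#M. regular d t"
    using graft.prems by auto
  have v: "v \<in> gverts G" "w \<in> gverts H" "w \<notin> gverts G" "v \<notin> gverts H"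
    using represents_root_in[OF *(1)] represents_root_in[OF *(2)] *(3) by auto
  note deg = gdegree_graft[OF represents_simple_graph[OF *(1)] represents_simple_graph[OF *(2)] *(3) v(1,2)]
  show ?case
  proof (cases "p \<in> gverts G")
    case True
    then have "p \<noteq> w" using v by auto
    then have "gdegree G p < (if p = v then size M else Suc d)"
      using True graft.prems(4) by (simp add: deg split: if_splits)
    then obtain M' where M': "represents (graft G p (single_vertex l) l) v M'"
      "size M' = size M" "\<forall>t\<in>#M'. regular d t"
      using graft.IH(1)[OF M True] graft.prems(3) by auto
    have "represents (graft (graft G p (single_vertex l) l) v H w) v (add_mset (Node N) M')"
      using *(3) graft.prems(3) by (intro represents.graft[OF M'(1) *(2)]) auto
    moreover have "graft (graft G p (single_vertex l) l) v H w = graft (graft G v H w) p (single_vertex l) l"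
      by (auto simp: graft_def)
    ultimately show ?thesis using M'(2,3) N by (intro exI[of _ "add_mset (Node N) M'"]) simp
  next
    case False
    then have p: "p \<in> gverts H" "p \<noteq> v" using graft.prems(2) v by auto
    \<comment> \<open>At \<open>w\<close> one unit of degree goes to the edge towards
      \<open>v\<close>, so the bound \<open>Suc d\<close> in the grafted graph becomes
      \<open>size N = d\<close> in \<open>H\<close>.\<close>
    then have "gdegree H p < (if p = w then size N else Suc d)"
      using False graft.prems(2,4) N(1) by (simp add: deg split: if_splits)
    then obtain N' where N': "represents (graft H p (single_vertex l) l) w N'"
      "size N' = size N" "\<forall>t\<in>#N'. regular d t"
      using graft.IH(2)[OF N(2) p(1)] graft.prems(3) by auto
    have "represents (graft G v (graft H p (single_vertex l) l) w) v (add_mset (Node N') M)"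
      using *(3) graft.prems(3) by (intro represents.graft[OF *(1) N'(1)]) auto
    moreover have "graft G v (graft H p (single_vertex l) l) w = graft (graft G v H w) p (single_vertex l) l"
      by (auto simp: graft_def)
    ultimately show ?thesis using N'(2,3) N M by (intro exI[of _ "add_mset (Node N') M"]) simp
  qed
qed

section \<open>Every tree of bounded degree is represented\<close>

lemma walk_distinct:
  assumes "walk G p"
  shows "\<exists>q. walk G q \<and> distinct q \<and> hd q = hd p \<and> last q = last p"
  using assms
proof (induction "length p" arbitrary: p rule: less_induct)
  case less
  show ?case
  proof (cases "distinct p")
    case True
    then show ?thesis using less.prems by blast
  next
    case False
    then obtain xs y ys zs where p: "p = xs @ [y] @ ys @ [y] @ zs"
      using not_distinct_decomp by blast
    define q where "q = xs @ [y] @ zs"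
    have "walk G q"
      using less.prems successively_append_iff[of "adjacent G" "y # ys" "y # zs"]
      unfolding p q_def walk_def by (auto simp: successively_append_iff)
    moreover have "length q < length p" by (simp add: p q_def)
    moreover have "hd q = hd p" "last q = last p" by (auto simp: p q_def hd_append)
    ultimately show ?thesis using less.hyps[of q] by simp
  qed
qed

lemma gdist_walk:
  assumes "connected_graph G" "r \<in> gverts G" "a \<in> gverts G"
  shows "\<exists>p. walk G p \<and> hd p = r \<and> last p = a \<and> length p = Suc (gdist G r a)"
proof -
  obtain p where p: "walk G p" "hd p = r" "last p = a"
    using assms unfolding connected_graph_def by blast
  then have "length p = Suc (length p - 1)" by (cases p) (auto simp: walk_def)
  with p have "\<exists>k p. walk G p \<and> hd p = r \<and> last p = a \<and> length p = Suc k" by blast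
  then show ?thesis unfolding gdist_def by (rule LeastI_ex)
qed

lemma gdist_le_walk:
  "walk G p \<Longrightarrow> hd p = r \<Longrightarrow> last p = a \<Longrightarrow> length p = Suc k \<Longrightarrow> gdist G r a \<le> k"
  unfolding gdist_def by (rule Least_le) blast

text \<open>A vertex at maximal distance from the root lies on no shortest walk to another vertex, so
  the graph stays connected without it; two neighbours of it would then be joined by a path that
  closes to a cycle.\<close>

lemma tree_remove_leaf:
  assumes tree: "is_tree G" and r: "r \<in> gverts G" and big: "gverts G \<noteq> {r}"
  obtains G' l p where "is_tree G'" "r \<in> gverts G'" "p \<in> gverts G'" "l \<notin> gverts G'"
    "gverts G = insert l (gverts G')" "G = graft G' p (single_vertex l) l"
proof -
  have simple: "simple_graph G" and conn: "connected_graph G" and acyc: "\<And>p. \<not> is_cycle G p"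
    using tree by (auto simp: is_tree_def)
  have fin: "finite (gverts G)" using simple by (simp add: simple_graph_def)
  have "Max (gdist G r ` gverts G) \<in> gdist G r ` gverts G"
    using fin r by (intro Max_in) auto
  then obtain l where l: "l \<in> gverts G" "Max (gdist G r ` gverts G) = gdist G r l" by auto
  have max: "gdist G r a \<le> gdist G r l" if "a \<in> gverts G" for a
    using Max_ge[of "gdist G r ` gverts G" "gdist G r a"] fin l(2) that by simp
  obtain a where a: "a \<in> gverts G" "a \<noteq> r" using big r by blast
  have "gdist G r a \<noteq> 0"
  proof
    assume "gdist G r a = 0"
    then obtain p where "hd p = r" "last p = a" "length p = 1"
      using gdist_walk[OF conn r a(1)] by auto
    then show False using a(2) by (cases p) auto
  qed
  then have pos: "gdist G r l > 0" using max[OF a(1)] by simp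
  have "gdist G r r \<le> 0" by (rule gdist_le_walk[of G "[r]"]) (use r in \<open>auto simp: walk_def\<close>)
  then have lr: "l \<noteq> r" using pos by auto
  define G' where "G' = induced_subgraph G (gverts G - {l})"
  have verts: "gverts G' = gverts G - {l}" by (simp add: G'_def induced_subgraph_def)
  have adj: "adjacent G' x y \<longleftrightarrow> adjacent G x y \<and> x \<noteq> l \<and> y \<noteq> l" for x y
    using simple_graph_adjacent[OF simple, of x y]
    by (auto simp: G'_def induced_subgraph_def adjacent_def)
  have simple': "simple_graph G'"
    using simple by (auto simp: G'_def induced_subgraph_def simple_graph_def)
  have walk': "walk G' p \<longleftrightarrow> walk G p \<and> l \<notin> set p" for p
  proof -
    have "successively (adjacent G') p \<longleftrightarrow> successively (adjacent G) p" if "l \<notin> set p"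
      using that by (intro successively_cong) (auto simp: adj)
    then show ?thesis by (auto simp: walk_def verts)
  qed
  have "\<exists>p. walk G' p \<and> hd p = r \<and> last p = b" if b: "b \<in> gverts G'" for b
  proof -
    have b': "b \<in> gverts G" "b \<noteq> l" using b verts by auto
    obtain p where p: "walk G p" "hd p = r" "last p = b" "length p = Suc (gdist G r b)"
      using gdist_walk[OF conn r b'(1)] by blast
    have "l \<notin> set p"
    proof
      assume "l \<in> set p"
      then obtain xs ys where xs: "p = xs @ l # ys" by (meson split_list)
      then have "ys \<noteq> []" using p(3) b'(2) by auto
      have "walk G (xs @ [l])"
        using p(1) unfolding xs walk_def by (auto simp: successively_append_iff)
      moreover have "hd (xs @ [l]) = r" using p(2) xs by (cases xs) auto
      ultimately have "gdist G r l \<le> length xs" by (intro gdist_le_walk) auto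
      moreover have "length ys > 0" using \<open>ys \<noteq> []\<close> by simp
      moreover have "length p = length xs + Suc (length ys)" by (simp add: xs)
      ultimately show False using p(4) max[OF b'(1)] by linarith
    qed
    with p walk' show ?thesis by blast
  qed
  then have conn': "connected_graph G'"
    using r lr verts by (intro connected_graphI[of r]) auto
  have "\<not> is_cycle G' p" for p
    using acyc[of p] walk'[of p] adj by (auto simp: is_cycle_def)
  with simple' conn' have tree': "is_tree G'" by (simp add: is_tree_def)
  obtain q where q: "walk G q" "hd q = r" "last q = l" using conn r l(1) unfolding connected_graph_def by blast
  obtain q' where q': "q = q' @ [l]"
    using q by (metis append_butlast_last_id walk_def)
  then have "q' \<noteq> []" using q(2) lr by auto
  then have pl: "adjacent G (last q') l"
    using q(1) unfolding q' walk_def by (auto simp: successively_append_iff)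
  define p where "p = last q'"
  have p: "p \<in> gverts G" "p \<noteq> l" using simple_graph_adjacent[OF simple pl] by (auto simp: p_def)
  have unique: "b = p" if b: "adjacent G b l" for b
  proof (rule ccontr)
    assume bp: "b \<noteq> p"
    have bl: "b \<in> gverts G" "b \<noteq> l" using simple_graph_adjacent[OF simple b] by auto
    obtain s where "walk G' s" "hd s = p" "last s = b"
      using conn' p bl verts unfolding connected_graph_def by blast
    then obtain s where s: "walk G' s" "distinct s" "hd s = p" "last s = b"
      using walk_distinct by metis
    obtain x y zs where "s = x # y # zs"
      using s bp by (cases s; cases "tl s") (auto simp: walk_def)
    moreover have "adjacent G l p" using pl adjacent_commute[of G] by (simp add: p_def)
    ultimately have "is_cycle G (l # s)"
      using s walk'[of s] l(1) b by (auto simp: is_cycle_def walk_def)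
    then show False using acyc by blast
  qed
  have "e \<in> insert {p, l} (gedges G')" if e: "e \<in> gedges G" for e
  proof (cases "l \<in> e")
    case True
    have "card e = 2" using e simple by (simp add: simple_graph_def)
    then obtain x y where "e = {x, y}" "x \<noteq> y" by (auto simp: card_2_iff)
    then obtain b where "e = {b, l}" using True by auto
    then show ?thesis using unique[of b] e by (simp add: adjacent_def)
  next
    case False
    then show ?thesis
      using simple_graph_edge[OF simple e] e by (auto simp: G'_def induced_subgraph_def)
  qed
  moreover have "{p, l} \<in> gedges G" using pl by (simp add: p_def adjacent_def)
  ultimately have "gedges G = insert {p, l} (gedges G')"
    by (auto simp: G'_def induced_subgraph_def)
  then have G: "G = graft G' p (single_vertex l) l"
    using l(1) verts by (cases G) (auto simp: graft_def single_vertex_def)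
  show ?thesis
  proof (rule that[OF tree' _ _ _ _ G])
    show "r \<in> gverts G'" "p \<in> gverts G'" "l \<notin> gverts G'" "gverts G = insert l (gverts G')"
      unfolding verts using r lr p l(1) by auto
  qed
qed

text \<open>The tree is dismantled leaf by leaf, always keeping \<open>r\<close>; when a leaf is put
  back, the degree bound in \<open>G\<close> provides the free slot at \<open>p\<close>.\<close>

lemma tree_represents:
  assumes "is_tree G" "r \<in> gverts G" "\<And>a. a \<in> gverts G \<Longrightarrow> gdegree G a \<le> Suc d"
  shows "\<exists>R. represents G r R \<and> root_regular d R"
proof -
  have "finite (gverts G)" using assms(1) by (simp add: is_tree_def simple_graph_def)
  then show ?thesis
    using assms
  proof (induction "card (gverts G)" arbitrary: G rule: less_induct)
    case less
    show ?case
    proof (cases "gverts G = {r}")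
      case True
      have "simple_graph G" using less.prems(2) by (simp add: is_tree_def)
      have "e \<notin> gedges G" for e
      proof
        assume "e \<in> gedges G"
        then have "e \<subseteq> {r}" "card e = 2"
          using \<open>simple_graph G\<close> True by (auto simp: simple_graph_def)
        then show False using card_mono[of "{r}" e] by simp
      qed
      then have "gedges G = {}" by blast
      then have "G = single_vertex r" using True by (cases G) (simp add: single_vertex_def)
      moreover have "root_regular d (replicate_mset (Suc d) Void)"
        unfolding root_regular_def by (auto split: if_splits)
      ultimately show ?thesis using represents.single[of r "Suc d"] by blast
    next
      case False
      obtain G' l p where G': "is_tree G'" "r \<in> gverts G'" "p \<in> gverts G'" "l \<notin> gverts G'"
        "gverts G = insert l (gverts G')" "G = graft G' p (single_vertex l) l"
        using tree_remove_leaf[OF less.prems(2,3) False] .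
      have fin: "finite (gverts G')" using less.prems(1) G'(5) by simp
      have deg: "gdegree G a = gdegree G' a + (if a = p then 1 else 0)" if "a \<in> gverts G'" for a
        unfolding G'(6) using that G' gdegree_graft[of G' "single_vertex l" p l a]
        by (auto simp: is_tree_def)
      have "gdegree G' a \<le> Suc d" if "a \<in> gverts G'" for a
        using less.prems(4)[of a] deg[OF that] that G'(5) by (simp split: if_splits)
      then obtain R where R: "represents G' r R" "root_regular d R"
        using less.hyps[of G'] fin G' by auto
      have "gdegree G' p < Suc d" using less.prems(4)[of p] deg[OF G'(3)] G'(3,5) by simp
      then have "gdegree G' p < (if p = r then size R else Suc d)"
        using R(2) by (auto simp: root_regular_def)
      then obtain R' where "represents G r R'" "size R' = size R" "\<forall>t\<in>#R'. regular d t"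
        using represents_add_leaf[OF R(1) _ G'(3,4), of d] R(2) unfolding G'(6)[symmetric]
        by (auto simp: root_regular_def)
      then show ?thesis using R(2) by (auto simp: root_regular_def)
    qed
  qed
qed

section \<open>The characteristic polynomial of the signless Laplacian\<close>

definition fun_mat :: "'a list \<Rightarrow> ('a \<Rightarrow> 'a \<Rightarrow> real) \<Rightarrow> real mat" where
  "fun_mat vs A = mat (length vs) (length vs) (\<lambda>(i, j). A (vs ! i) (vs ! j))"

text \<open>Indexing by vertices instead of positions keeps elimination local; different numberings
  give similar matrices and so the same determinant.\<close>

definition vertex_det :: "'a set \<Rightarrow> ('a \<Rightarrow> 'a \<Rightarrow> real) \<Rightarrow> real" where
  "vertex_det V A = det (fun_mat (SOME vs. distinct vs \<and> set vs = V) A)"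

lemma fun_mat_carrier: "fun_mat vs A \<in> carrier_mat (length vs) (length vs)"
  by (simp add: fun_mat_def)

lemma det_fun_mat_unique:
  assumes "distinct vs" "distinct vs'" "set vs = set vs'"
  shows "det (fun_mat vs A) = det (fun_mat vs' A)"
proof -
  let ?n = "length vs"
  have len: "length vs' = ?n"
    using assms by (metis distinct_card)
  have b: "bij_betw ((!) vs) {..<?n} (set vs)" "bij_betw ((!) vs') {..<?n} (set vs)"
    using bij_betw_nth[OF assms(1) refl refl] bij_betw_nth[OF assms(2) refl refl] assms(3) len
    by auto
  define p where "p = inv_into {..<?n} ((!) vs') \<circ> (!) vs"
  have p: "bij_betw p {..<?n} {..<?n}"
    unfolding p_def using b by (blast intro: bij_betw_trans bij_betw_inv_into)
  have pn: "p i < ?n" "vs' ! p i = vs ! i" if "i < ?n" for i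
    using p b that bij_betw_inv_into_right[OF b(2), of "vs ! i"] by (auto simp: p_def bij_betw_def)
  have "similar_mat (fun_mat vs A) (fun_mat vs' A)"
    by (rule similar_mat_reindex[OF _ _ p]) (auto simp: fun_mat_def len pn)
  then show ?thesis by (rule det_similar)
qed

lemma vertex_det_eq:
  assumes "distinct vs" "set vs = V"
  shows "vertex_det V A = det (fun_mat vs A)"
proof -
  have "distinct (SOME vs. distinct vs \<and> set vs = V) \<and> set (SOME vs. distinct vs \<and> set vs = V) = V"
    by (rule someI[of _ vs]) (use assms in simp)
  then show ?thesis unfolding vertex_det_def using assms by (intro det_fun_mat_unique) auto
qed

lemma vertex_det_cong:
  assumes "finite V" "\<And>u w. u \<in> V \<Longrightarrow> w \<in> V \<Longrightarrow> A u w = B u w"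
  shows "vertex_det V A = vertex_det V B"
proof -
  obtain vs where vs: "set vs = V" "distinct vs" using finite_distinct_list[OF assms(1)] by blast
  have "fun_mat vs A = fun_mat vs B"
    unfolding fun_mat_def using vs(1) by (intro cong_mat) (auto intro!: assms(2))
  then show ?thesis using vertex_det_eq[OF vs(2,1)] by metis
qed

lemma vertex_det_singleton: "vertex_det {r} A = A r r"
proof -
  have "vertex_det {r} A = det (fun_mat [r] A)" by (rule vertex_det_eq) auto
  also have "\<dots> = A r r"
    by (subst det_single) (auto simp: fun_mat_def)
  finally show ?thesis .
qed

definition set_diag :: "('a \<Rightarrow> 'a \<Rightarrow> real) \<Rightarrow> 'a \<Rightarrow> real \<Rightarrow> 'a \<Rightarrow> 'a \<Rightarrow> real" where
  "set_diag A r y = (\<lambda>u w. if u = r \<and> w = r then y else A u w)"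

text \<open>Subtracting \<open>1 / A l l\<close> times the row of \<open>l\<close> from the row of
  \<open>p\<close> clears the only other nonzero entry in the column of \<open>l\<close> and leaves
  a block triangular matrix.\<close>

lemma vertex_det_leaf:
  assumes fin: "finite V" and l: "l \<notin> V" and p: "p \<in> V" and a: "A l l \<noteq> 0"
    and lp: "A l p = 1" "A p l = 1"
    and zero: "\<And>u. u \<in> V \<Longrightarrow> u \<noteq> p \<Longrightarrow> A u l = 0 \<and> A l u = 0"
  shows "vertex_det (insert l V) A = A l l * vertex_det V (set_diag A p (A p p - 1 / A l l))"
proof -
  obtain vs where vs: "set vs = V" "distinct vs" using finite_distinct_list[OF fin] by blast
  define n where "n = length vs"
  obtain k where k: "k < n" "vs ! k = p" using p vs(1) by (metis in_set_conv_nth n_def)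
  define B where "B = fun_mat vs (set_diag A p (A p p - 1 / A l l))"
  define C where "C = mat 1 n (\<lambda>(_, j). A l (vs ! j))"
  define D where "D = mat 1 1 (\<lambda>_. A l l)"
  have nth: "(vs @ [l]) ! i = (if i < n then vs ! i else l)" if "i < Suc n" for i
    using that by (auto simp: n_def nth_append)
  have inV: "vs ! i \<in> V" if "i < n" for i using that vs(1) by (auto simp: n_def)
  have eqp: "vs ! i = p \<longleftrightarrow> i = k" if "i < n" for i
    using that k vs(2) by (auto simp: n_def nth_eq_iff_index_eq)
  have Bc: "B \<in> carrier_mat n n" by (simp add: B_def n_def fun_mat_carrier)
  have "addrow (- 1 / A l l) k n (fun_mat (vs @ [l]) A) = four_block_mat B (0\<^sub>m n 1) C D"
  proof (rule eq_matI)
    fix i j assume "i < dim_row (four_block_mat B (0\<^sub>m n 1) C D)"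
      "j < dim_col (four_block_mat B (0\<^sub>m n 1) C D)"
    then have ij: "i < Suc n" "j < Suc n" using Bc by (auto simp: D_def)
    have "l \<noteq> p" using l p by auto
    then show "addrow (- 1 / A l l) k n (fun_mat (vs @ [l]) A) $$ (i, j) =
        four_block_mat B (0\<^sub>m n 1) C D $$ (i, j)"
      using ij k(1) Bc a lp zero[OF inV[of i]] zero[OF inV[of j]] eqp[of i] eqp[of j] nth[OF ij(1)] nth[OF ij(2)]
        nth[of n]
      by (cases "i < n"; cases "j < n")
        (auto simp: index_mat_four_block B_def C_def D_def fun_mat_def set_diag_def n_def less_Suc_eq)
  qed (use Bc in \<open>auto simp: D_def fun_mat_def n_def\<close>)
  moreover have "det (addrow (- 1 / A l l) k n (fun_mat (vs @ [l]) A)) = det (fun_mat (vs @ [l]) A)"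
    using k(1) by (intro det_addrow[of _ "Suc n"]) (auto simp: n_def fun_mat_def)
  moreover have "det (four_block_mat B (0\<^sub>m n 1) C D) = det B * A l l"
  proof -
    have "C \<in> carrier_mat 1 n" "D \<in> carrier_mat 1 1" by (auto simp: C_def D_def)
    then show ?thesis
      using det_four_block_mat_upper_right_zero_col[OF Bc refl, of C D] det_single[of D]
      by (simp add: D_def)
  qed
  moreover have "vertex_det (insert l V) A = det (fun_mat (vs @ [l]) A)"
    by (rule vertex_det_eq) (use vs l in auto)
  moreover have "vertex_det V (set_diag A p (A p p - 1 / A l l)) = det B"
    unfolding B_def by (rule vertex_det_eq) (use vs in auto)
  ultimately show ?thesis by simp
qed

text \<open>Gaussian elimination from the leaves towards the root. The pivot of a non-root vertex is
  one plus the conductance of the branch that it carries.\<close>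

lemma represents_vertex_det:
  "represents G r M \<Longrightarrow> x > 0 \<Longrightarrow> finite W \<Longrightarrow> W \<inter> gverts G = {} \<Longrightarrow>
    (\<And>u. u \<in> gverts G \<Longrightarrow> u \<noteq> r \<Longrightarrow> A u u = x + real (gdegree G u)) \<Longrightarrow>
    (\<And>u w. u \<in> gverts G \<Longrightarrow> w \<in> gverts G \<Longrightarrow> u \<noteq> w \<Longrightarrow> A u w = (if adjacent G u w then 1 else 0)) \<Longrightarrow>
    (\<And>u w. u \<in> gverts G \<Longrightarrow> u \<noteq> r \<Longrightarrow> w \<in> W \<Longrightarrow> A u w = 0 \<and> A w u = 0) \<Longrightarrow>
    vertex_det (W \<union> gverts G) A = (\<Prod>t\<in>#M. weight x t) *
      vertex_det (insert r W) (set_diag A r (A r r - real (gdegree G r) + (\<Sum>t\<in>#M. flow x t)))"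
proof (induction arbitrary: W A rule: represents.induct)
  case (single v k)
  have "set_diag A v (A v v) = A" by (auto simp: set_diag_def fun_eq_iff)
  then show ?case by simp
next
  case (graft G v M H w N)
  note * = graft.hyps(1-3) and x = graft.prems(1)
  have v: "v \<in> gverts G" "w \<in> gverts H" "w \<notin> gverts G" "v \<notin> gverts H" "v \<noteq> w"
    using represents_root_in[OF *(1)] represents_root_in[OF *(2)] *(3) by auto
  note simple = represents_simple_graph[OF *(1)] represents_simple_graph[OF *(2)]
  note deg = gdegree_graft[OF simple *(3) v(1,2)]
  note noG = simple_graph_adjacent[OF simple(1)] and noH = simple_graph_adjacent[OF simple(2)]
  note diag = graft.prems(4) and adj = graft.prems(5) and out = graft.prems(6)
  have fin: "finite (W \<union> gverts G)" using graft.prems(2) simple by (simp add: simple_graph_def)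
  have adjG: "A a b = (if adjacent G a b then 1 else 0)"
    if "a \<in> gverts G" "b \<in> gverts G" "a \<noteq> b" for a b
  proof -
    have "adjacent (graft G v H w) a b \<longleftrightarrow> adjacent G a b"
      using that v noH[of a b] *(3) by (auto simp: adjacent_graft)
    then show ?thesis using adj[of a b] that by simp
  qed
  have adjH: "A a b = (if adjacent H a b then 1 else 0)"
    if "a \<in> gverts H" "b \<in> gverts H" "a \<noteq> b" for a b
  proof -
    have "adjacent (graft G v H w) a b \<longleftrightarrow> adjacent H a b"
      using that v noG[of a b] *(3) by (auto simp: adjacent_graft)
    then show ?thesis using adj[of a b] that by simp
  qed
  have cross: "A a b = (if a = w \<and> b = v then 1 else 0)" "A b a = (if a = w \<and> b = v then 1 else 0)"
    if "a \<in> gverts H" "b \<in> gverts G" for a b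
  proof -
    have ne: "a \<noteq> b" "a \<noteq> v" "b \<noteq> w" using that *(3) v by auto
    have "adjacent (graft G v H w) a b \<longleftrightarrow> a = w \<and> b = v"
      "adjacent (graft G v H w) b a \<longleftrightarrow> a = w \<and> b = v"
      using that ne noG[of a b] noG[of b a] noH[of a b] noH[of b a] *(3) by (auto simp: adjacent_graft)
    then show "A a b = (if a = w \<and> b = v then 1 else 0)" "A b a = (if a = w \<and> b = v then 1 else 0)"
      using adj[of a b] adj[of b a] that ne by simp_all
  qed
  have wW: "w \<notin> W" "v \<notin> W" using graft.prems(3) v by auto
  \<comment> \<open>The pivot of \<open>w\<close> after the branches below it are gone; the 1 is the
    edge to \<open>v\<close>, counted by the degree in the grafted graph but not in
    \<open>H\<close>.\<close>
  define a where "a = 1 + conductance x (Node N)"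
  have apos: "a > 0" using conductance_nonneg[OF x, of "Node N"] unfolding a_def by linarith
  define A1 where "A1 = set_diag A w a"
  define A2 where "A2 = set_diag A1 v (A1 v v - 1 / A1 w w)"
  have "A w w = x + real (gdegree H w) + 1"
    using diag[of w] v deg[of w] by simp
  then have "A w w - real (gdegree H w) + (\<Sum>t\<in>#N. flow x t) = a"
    unfolding a_def by simp
  \<comment> \<open>\<open>H\<close> is eliminated with all of \<open>G\<close> as surroundings, to
    which only \<open>w\<close> is linked. This is why the claim carries a set \<open>W\<close> of
    outer vertices.\<close>
  moreover have "vertex_det ((W \<union> gverts G) \<union> gverts H) A = (\<Prod>t\<in>#N. weight x t) *
      vertex_det (insert w (W \<union> gverts G))
        (set_diag A w (A w w - real (gdegree H w) + (\<Sum>t\<in>#N. flow x t)))"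
  proof (rule graft.IH(2)[OF x fin])
    show "(W \<union> gverts G) \<inter> gverts H = {}" using graft.prems(3) *(3) by auto
    show "A u u = x + real (gdegree H u)" if "u \<in> gverts H" "u \<noteq> w" for u
    proof -
      have "u \<noteq> v" "u \<notin> gverts G" using that v *(3) by auto
      then show ?thesis using diag[of u] deg[of u] that by simp
    qed
    show "A u z = 0 \<and> A z u = 0" if "u \<in> gverts H" "u \<noteq> w" "z \<in> W \<union> gverts G" for u z
    proof (cases "z \<in> W")
      case True
      then show ?thesis using out[of u z] that v by auto
    next
      case False
      then show ?thesis using cross[of u z] that by auto
    qed
  qed (use adjH in auto)
  ultimately have 1: "vertex_det ((W \<union> gverts G) \<union> gverts H) A =
      (\<Prod>t\<in>#N. weight x t) * vertex_det (insert w (W \<union> gverts G)) A1"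
    unfolding A1_def by simp
  have A1: "A1 w w = a" "A1 u z = A u z" if "u \<noteq> w \<or> z \<noteq> w" for u z
    using that by (auto simp: A1_def set_diag_def)
  have A1ww: "A1 w w = a" by (simp add: A1_def set_diag_def)
  have 2: "vertex_det (insert w (W \<union> gverts G)) A1 = a * vertex_det (W \<union> gverts G) A2"
    unfolding A2_def A1ww[symmetric]
  proof (rule vertex_det_leaf[OF fin])
    show "w \<notin> W \<union> gverts G" "v \<in> W \<union> gverts G" using wW v by auto
    show "A1 w w \<noteq> 0" using A1ww apos by simp
    show "A1 w v = 1" "A1 v w = 1" using cross[OF v(2,1)] v(5) A1(2) by auto
    show "A1 u w = 0 \<and> A1 w u = 0" if "u \<in> W \<union> gverts G" "u \<noteq> v" for u
    proof -
      have "u \<noteq> w" using that wW v by auto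
      then show ?thesis
        using that cross[OF v(2), of u] out[of w u] v A1(2) by auto
    qed
  qed
  have A2: "A2 u z = A u z" if "u \<noteq> w" "z \<noteq> w" "\<not> (u = v \<and> z = v)" for u z
    using that by (auto simp: A2_def A1_def set_diag_def)
  have A2vv: "A2 v v = A v v - 1 / a"
    using v(5) by (simp add: A2_def A1_def set_diag_def)
  \<comment> \<open>Here the diagonal entry at \<open>v\<close> is already altered by the
    elimination of \<open>w\<close>; the induction hypothesis applies because it leaves the entry at
    the root free.\<close>
  have 3: "vertex_det (W \<union> gverts G) A2 = (\<Prod>t\<in>#M. weight x t) *
      vertex_det (insert v W) (set_diag A2 v (A2 v v - real (gdegree G v) + (\<Sum>t\<in>#M. flow x t)))"
  proof (rule graft.IH(1)[OF x graft.prems(2)])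
    show "W \<inter> gverts G = {}" using graft.prems(3) by auto
    show "A2 u u = x + real (gdegree G u)" if "u \<in> gverts G" "u \<noteq> v" for u
    proof -
      have "u \<noteq> w" using that v by auto
      then show ?thesis using diag[of u] deg[of u] that A2[of u u] by simp
    qed
    show "A2 u z = (if adjacent G u z then 1 else 0)" if "u \<in> gverts G" "z \<in> gverts G" "u \<noteq> z" for u z
    proof -
      have "u \<noteq> w" "z \<noteq> w" using that v by auto
      then have "A2 u z = A u z" using that(3) by (intro A2) auto
      then show ?thesis using adjG[OF that] by simp
    qed
    show "A2 u z = 0 \<and> A2 z u = 0" if "u \<in> gverts G" "u \<noteq> v" "z \<in> W" for u z
    proof -
      have "u \<noteq> w" "z \<noteq> w" using that v wW by auto
      then show ?thesis using out[of u z] A2[of u z] A2[of z u] that by simp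
    qed
  qed
  \<comment> \<open>Eliminating \<open>w\<close> lowers the entry of \<open>v\<close> by
    \<open>1 / a\<close>, while the degree of \<open>v\<close> counts 1 for the edge; the net
    contribution is the flow.\<close>
  have fl: "flow x (Node N) = 1 - 1 / a"
    using apos unfolding flow_def a_def by (simp add: field_simps del: conductance_Node)
  have y: "A2 v v - real (gdegree G v) + (\<Sum>t\<in>#M. flow x t) =
      A v v - real (gdegree (graft G v H w) v) + (\<Sum>t\<in>#add_mset (Node N) M. flow x t)"
    using A2vv fl deg[of v] v(1) by simp
  have 4: "vertex_det (insert v W) (set_diag A2 v (A2 v v - real (gdegree G v) + (\<Sum>t\<in>#M. flow x t))) =
      vertex_det (insert v W) (set_diag A v
        (A v v - real (gdegree (graft G v H w) v) + (\<Sum>t\<in>#add_mset (Node N) M. flow x t)))"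
    unfolding y
  proof (rule vertex_det_cong)
    show "finite (insert v W)" using graft.prems(2) by simp
    show "set_diag A2 v y' u z = set_diag A v y' u z"
      if "u \<in> insert v W" "z \<in> insert v W" for u z y'
    proof -
      have "u \<noteq> w" "z \<noteq> w" using that wW v by auto
      then show ?thesis using A2[of u z] by (auto simp: set_diag_def)
    qed
  qed
  have wN: "(\<Prod>t\<in>#add_mset (Node N) M. weight x t) =
      (\<Prod>t\<in>#N. weight x t) * (a * (\<Prod>t\<in>#M. weight x t))"
    by (simp add: a_def)
  show ?case
    unfolding gverts_graft Un_assoc[symmetric] 1 2 3 4 wN by (simp only: mult.assoc)
qed

definition signless :: "'a ugraph \<Rightarrow> real \<Rightarrow> 'a \<Rightarrow> 'a \<Rightarrow> real" where
  "signless G x u w = (if u = w then x + real (gdegree G u) else if adjacent G u w then 1 else 0)"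

lemma vertex_det_signless:
  assumes rep: "represents G r R" and x: "x > 0"
  shows "vertex_det (gverts G) (signless G x) = root_weight x R"
proof -
  have "vertex_det ({} \<union> gverts G) (signless G x) = (\<Prod>t\<in>#R. weight x t) *
      vertex_det (insert r {}) (set_diag (signless G x) r
        (signless G x r r - real (gdegree G r) + (\<Sum>t\<in>#R. flow x t)))"
    by (rule represents_vertex_det[OF rep x]) (auto simp: signless_def)
  then show ?thesis
    by (simp add: vertex_det_singleton set_diag_def signless_def root_weight_def)
qed

section \<open>Singular values and the energy\<close>

text \<open>With \<open>y\<close> the transpose of \<open>A\<close> applied to the eigenvector
  \<open>v\<close>, the eigenvalue times the squared norm of \<open>v\<close> is the squared norm of
  \<open>y\<close>. The eigenvector is complex because realness of the eigenvalue is part of the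
  claim.\<close>

lemma gram_eigenvalue_nonneg:
  fixes A :: "real mat"
  assumes A: "A \<in> carrier_mat n m"
    and ev: "eigenvalue (map_mat complex_of_real (A * transpose_mat A)) a"
  obtains r where "r \<ge> 0" "a = complex_of_real r"
proof -
  let ?Q = "map_mat complex_of_real (A * transpose_mat A)"
  obtain v where v: "v \<in> carrier_vec n" "v \<noteq> 0\<^sub>v n" "?Q *\<^sub>v v = a \<cdot>\<^sub>v v"
    using ev A by (auto simp: eigenvalue_def eigenvector_def)
  define y where "y k = (\<Sum>j<n. complex_of_real (A $$ (j, k)) * v $ j)" for k
  have row: "a * v $ i = (\<Sum>k<m. complex_of_real (A $$ (i, k)) * y k)" if i: "i < n" for i
  proof -
    have "a * v $ i = (?Q *\<^sub>v v) $ i" using v i by simp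
    also have "\<dots> = (\<Sum>j<n. complex_of_real (\<Sum>k<m. A $$ (i, k) * A $$ (j, k)) * v $ j)"
      using i A v(1) by (auto simp: scalar_prod_def lessThan_atLeast0 intro!: sum.cong)
    also have "\<dots> = (\<Sum>j<n. \<Sum>k<m. complex_of_real (A $$ (i, k)) * (complex_of_real (A $$ (j, k)) * v $ j))"
      by (simp add: sum_distrib_right mult.assoc)
    also have "\<dots> = (\<Sum>k<m. \<Sum>j<n. complex_of_real (A $$ (i, k)) * (complex_of_real (A $$ (j, k)) * v $ j))"
      by (rule sum.swap)
    also have "\<dots> = (\<Sum>k<m. complex_of_real (A $$ (i, k)) * y k)"
      by (simp add: y_def sum_distrib_left)
    finally show ?thesis .
  qed
  define p where "p = (\<Sum>i<n. (cmod (v $ i))\<^sup>2)"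
  define q where "q = (\<Sum>k<m. (cmod (y k))\<^sup>2)"
  have cmod: "complex_of_real ((cmod z)\<^sup>2) = cnj z * z" for z
    by (simp only: complex_norm_square mult.commute)
  have "a * complex_of_real p = (\<Sum>i<n. cnj (v $ i) * (a * v $ i))"
    unfolding p_def of_real_sum cmod by (simp add: sum_distrib_left mult_ac)
  also have "\<dots> = (\<Sum>i<n. \<Sum>k<m. complex_of_real (A $$ (i, k)) * cnj (v $ i) * y k)"
    by (intro sum.cong) (auto simp: row sum_distrib_left mult_ac)
  also have "\<dots> = (\<Sum>k<m. \<Sum>i<n. complex_of_real (A $$ (i, k)) * cnj (v $ i) * y k)"
    by (rule sum.swap)
  also have "\<dots> = (\<Sum>k<m. cnj (y k) * y k)"
    by (simp add: y_def sum_distrib_right)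
  also have "\<dots> = complex_of_real q"
    unfolding q_def of_real_sum cmod ..
  finally have eq: "a * complex_of_real p = complex_of_real q" .
  obtain i where i: "i < n" "v $ i \<noteq> 0"
    using v(1,2) by (metis carrier_vecD eq_vecI index_zero_vec(1) index_zero_vec(2))
  have "p > 0"
    unfolding p_def by (rule sum_pos2[of _ i]) (use i in auto)
  moreover have "q \<ge> 0" unfolding q_def by (simp add: sum_nonneg)
  moreover have "a = complex_of_real (q / p)" using eq \<open>p > 0\<close> by (simp add: field_simps)
  ultimately show ?thesis using that[of "q / p"] by simp
qed

text \<open>The factorization exists over the complex numbers; as all roots are real and
  nonnegative, it descends along the injective embedding of coefficients.\<close>

lemma gram_char_poly:
  fixes A :: "real mat"
  assumes A: "A \<in> carrier_mat n m"
  obtains rs where "length rs = n" "\<forall>r\<in>set rs. r \<ge> 0"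
    "char_poly (A * transpose_mat A) = (\<Prod>r\<leftarrow>rs. [:- r, 1:])"
proof -
  let ?Q = "A * transpose_mat A"
  let ?C = "map_mat complex_of_real ?Q"
  have Q: "?Q \<in> carrier_mat n n" using A by simp
  then have C: "?C \<in> carrier_mat n n" by simp
  obtain as where as: "char_poly ?C = (\<Prod>a\<leftarrow>as. [:- a, 1:])" "length as = n"
    using char_poly_factorized[OF C] by blast
  have "\<exists>r\<ge>0. a = complex_of_real r" if "a \<in> set as" for a
  proof -
    have "poly (char_poly ?C) a = 0"
      unfolding as(1) using that by (induction as) auto
    then have "eigenvalue ?C a" using eigenvalue_root_char_poly[OF C] by simp
    from gram_eigenvalue_nonneg[OF A this] show ?thesis by metis
  qed
  then have nonneg: "Re a \<ge> 0 \<and> complex_of_real (Re a) = a" if "a \<in> set as" for a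
    using that by fastforce
  interpret h: map_poly_inj_comm_ring_hom complex_of_real ..
  define rs where "rs = map Re as"
  have "map_poly complex_of_real (\<Prod>r\<leftarrow>map Re bs. [:- r, 1:]) = (\<Prod>a\<leftarrow>bs. [:- a, 1:])"
    if "set bs \<subseteq> set as" for bs
    using that
  proof (induction bs)
    case (Cons b bs)
    then have "complex_of_real (Re b) = b" using nonneg by simp
    then show ?case using Cons by (simp add: h.hom_mult map_poly_pCons del: mult_pCons_left mult_pCons_right)
  qed simp
  from this[of as] have "map_poly complex_of_real (\<Prod>r\<leftarrow>rs. [:- r, 1:]) = char_poly ?C"
    unfolding rs_def as(1) by simp
  also have "\<dots> = map_poly complex_of_real (char_poly ?Q)"
    by (rule of_real_hom.char_poly_hom[OF Q])
  finally have "char_poly ?Q = (\<Prod>r\<leftarrow>rs. [:- r, 1:])"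
    by (simp only: h.eq_iff)
  then show ?thesis using that[of rs] as(2) nonneg by (auto simp: rs_def)
qed

text \<open>Turns the sum over distinct eigenvalues with multiplicities, as in
  \<open>singular_value_sum\<close>, into a sum over a list with repetitions.\<close>

lemma sum_order_linear_factors:
  fixes f :: "real \<Rightarrow> real"
  assumes "finite S" "set rs \<subseteq> S"
  shows "(\<Sum>k\<in>S. real (Polynomial.order k (\<Prod>r\<leftarrow>rs. [:- r, 1:])) * f k) = (\<Sum>r\<leftarrow>rs. f r)"
  using assms(2)
proof (induction rs)
  case (Cons r rs)
  let ?p = "\<Prod>r\<leftarrow>rs. [:- r, 1:]"
  have "?p \<noteq> 0" by (auto simp: prod_list_zero_iff)
  then have "[:- r, 1:] * ?p \<noteq> 0" by (simp only: mult_eq_0_iff) simp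
  from order_mult[OF this]
  have "Polynomial.order k (\<Prod>r\<leftarrow>r # rs. [:- r, 1:]) = (if k = r then 1 else 0) + Polynomial.order k ?p" for k
    using order_power_n_n[of r 1] order_0I[of "[:- r, 1:]" k] by auto
  then have "(\<Sum>k\<in>S. real (Polynomial.order k (\<Prod>r\<leftarrow>r # rs. [:- r, 1:])) * f k) =
      (\<Sum>k\<in>S. (if k = r then f k else 0) + real (Polynomial.order k ?p) * f k)"
    by (intro sum.cong) (auto simp: algebra_simps)
  also have "\<dots> = f r + (\<Sum>r\<leftarrow>rs. f r)"
    using Cons assms(1) by (simp add: sum.distrib)
  finally show ?case by simp
qed simp

lemma singular_values:
  fixes A :: "real mat"
  assumes A: "A \<in> carrier_mat n m"
  obtains rs where "length rs = n" "\<forall>r\<in>set rs. r \<ge> 0"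
    "singular_value_sum A = (\<Sum>r\<leftarrow>rs. sqrt r)"
    "\<And>x. (\<Prod>r\<leftarrow>rs. x + r) = det (x \<cdot>\<^sub>m 1\<^sub>m n + A * transpose_mat A)"
proof -
  let ?Q = "A * transpose_mat A"
  have Q: "?Q \<in> carrier_mat n n" using A by simp
  obtain rs where rs: "length rs = n" "\<forall>r\<in>set rs. r \<ge> 0" "char_poly ?Q = (\<Prod>r\<leftarrow>rs. [:- r, 1:])"
    using gram_char_poly[OF A] .
  have roots: "poly (\<Prod>r\<leftarrow>rs. [:- r, 1:]) k = 0 \<longleftrightarrow> k \<in> set rs" for k :: real
    by (induction rs) auto
  have spec: "spectrum ?Q = set rs"
    using roots by (simp add: spectrum_root_char_poly[OF Q] rs(3))
  have "singular_value_sum A = (\<Sum>r\<leftarrow>rs. sqrt r)"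
    unfolding singular_value_sum_def rs(3) spec by (rule sum_order_linear_factors) auto
  moreover have "(\<Prod>r\<leftarrow>rs. x + r) = det (x \<cdot>\<^sub>m 1\<^sub>m n + ?Q)" for x
  proof -
    have "poly (\<Prod>r\<leftarrow>rs. [:- r, 1:]) (- x) = (- 1) ^ length rs * (\<Prod>r\<leftarrow>rs. x + r)"
      by (induction rs) (auto simp: algebra_simps)
    moreover have "poly (char_poly ?Q) (- x) = det (- char_matrix ?Q (- x))"
      by (rule char_poly_matrix[OF Q])
    moreover have "- char_matrix ?Q (- x) = (- 1) \<cdot>\<^sub>m (x \<cdot>\<^sub>m 1\<^sub>m n + ?Q)"
      using Q A by (intro eq_matI) (auto simp: char_matrix_def)
    moreover have "dim_col (x \<cdot>\<^sub>m 1\<^sub>m n + ?Q) = n" using A by simp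
    ultimately have "(- 1) ^ n * (\<Prod>r\<leftarrow>rs. x + r) = (- 1) ^ n * det (x \<cdot>\<^sub>m 1\<^sub>m n + ?Q)"
      using rs(1,3) by simp
    then show ?thesis by simp
  qed
  ultimately show ?thesis using that rs(1,2) by blast
qed

text \<open>On the positive axis this is an antiderivative of \<open>ln (1 + l / s\<^sup>2)\<close>, running from \<open>0\<close> at \<open>0\<close> to
  \<open>\<pi> * sqrt l\<close> at infinity. For \<open>l = 0\<close> it vanishes, since \<open>sqrt 0 = 0\<close>.\<close>

definition log_primitive :: "real \<Rightarrow> real \<Rightarrow> real" where
  "log_primitive l s = s * (ln (s\<^sup>2 + l) - 2 * ln s) + 2 * sqrt l * arctan (s / sqrt l)"

lemma log_primitive_deriv:
  assumes "l \<ge> 0" "s > 0"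
  shows "(log_primitive l has_real_derivative ln (s\<^sup>2 + l) - 2 * ln s) (at s)"
proof -
  have pos: "s\<^sup>2 + l > 0" using assms by (simp add: add_pos_nonneg)
  have "((\<lambda>s. s * (ln (s\<^sup>2 + l) - 2 * ln s)) has_real_derivative
      ln (s\<^sup>2 + l) - 2 * ln s - 2 * l / (s\<^sup>2 + l)) (at s)"
    using assms(2) pos
    by (auto intro!: derivative_eq_intros simp: divide_simps) (simp add: power2_eq_square algebra_simps)
  moreover have "((\<lambda>s. 2 * sqrt l * arctan (s / sqrt l)) has_real_derivative 2 * l / (s\<^sup>2 + l)) (at s)"
  proof (cases "l = 0")
    case False
    define q where "q = sqrt l"
    have q: "q > 0" "l = q\<^sup>2" using False assms(1) by (auto simp: q_def)
    have "((\<lambda>s. 2 * q * arctan (s / q)) has_real_derivative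
        2 * q * (1 / q / (1 + (s / q)\<^sup>2))) (at s)"
      using q(1) by (auto intro!: derivative_eq_intros simp: divide_simps)
    moreover have "2 * q * (1 / q / (1 + (s / q)\<^sup>2)) = 2 * q\<^sup>2 / (s\<^sup>2 + q\<^sup>2)"
      using q(1) by (simp add: power_divide add_divide_eq_iff add.commute)
    ultimately show ?thesis using q(1) by (simp add: q(2))
  qed simp
  ultimately have "((\<lambda>s. s * (ln (s\<^sup>2 + l) - 2 * ln s) + 2 * sqrt l * arctan (s / sqrt l))
      has_real_derivative ln (s\<^sup>2 + l) - 2 * ln s - 2 * l / (s\<^sup>2 + l) + 2 * l / (s\<^sup>2 + l)) (at s)"
    by (rule DERIV_add)
  then show ?thesis by (simp add: log_primitive_def[abs_def])
qed

lemma log_primitive_limits: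
  assumes "l \<ge> 0"
  shows "(log_primitive l \<longlongrightarrow> 0) (at_right 0)" "(log_primitive l \<longlongrightarrow> pi * sqrt l) at_top"
proof -
  have "(log_primitive l \<longlongrightarrow> 0) (at_right 0) \<and> (log_primitive l \<longlongrightarrow> pi * sqrt l) at_top"
  proof (cases "l = 0")
    case True
    have "log_primitive 0 s = 0" if "s > 0" for s
      using that by (simp add: log_primitive_def ln_realpow)
    then have "eventually (\<lambda>s. log_primitive 0 s = 0) (at_right 0)"
      "eventually (\<lambda>s. log_primitive 0 s = 0) at_top"
      by (auto intro: eventually_mono[OF eventually_at_right_less] eventually_mono[OF eventually_gt_at_top[of 0]])
    then show ?thesis using True by (simp add: tendsto_eventually)
  next
    case False
    define q where "q = sqrt l"
    have q: "q > 0" "l = q\<^sup>2" using False assms by (auto simp: q_def)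
    have "((\<lambda>s. s * (ln (s\<^sup>2 + q\<^sup>2) - 2 * ln s) + 2 * q * arctan (s / q)) \<longlongrightarrow> 0) (at_right 0)"
      using q(1) by real_asymp
    moreover have "((\<lambda>s. s * (ln (s\<^sup>2 + q\<^sup>2) - 2 * ln s) + 2 * q * arctan (s / q)) \<longlongrightarrow> pi * q) at_top"
      using q(1) by real_asymp
    ultimately show ?thesis using q(1) by (simp add: q(2) log_primitive_def[abs_def])
  qed
  then show "(log_primitive l \<longlongrightarrow> 0) (at_right 0)" "(log_primitive l \<longlongrightarrow> pi * sqrt l) at_top"
    by auto
qed

lemma has_real_derivative_sum_list:
  "(\<And>l. l \<in> set ls \<Longrightarrow> (f l has_real_derivative f' l) (at s)) \<Longrightarrow>
    ((\<lambda>s. \<Sum>l\<leftarrow>ls. f l s) has_real_derivative (\<Sum>l\<leftarrow>ls. f' l)) (at s)"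
  by (induction ls) (auto intro!: derivative_intros)

lemma tendsto_sum_list_real:
  fixes f :: "'a \<Rightarrow> 'b \<Rightarrow> real"
  shows "(\<And>l. l \<in> set ls \<Longrightarrow> (f l \<longlongrightarrow> g l) F) \<Longrightarrow> ((\<lambda>s. \<Sum>l\<leftarrow>ls. f l s) \<longlongrightarrow> (\<Sum>l\<leftarrow>ls. g l)) F"
  by (induction ls) (auto intro!: tendsto_intros)

lemma sum_list_ln:
  assumes "\<forall>l\<in>set ls. l \<ge> 0" "s > 0"
  shows "(\<Sum>l\<leftarrow>ls. ln (s\<^sup>2 + l) - 2 * ln s) = ln (\<Prod>l\<leftarrow>ls. s\<^sup>2 + l) - real (length ls) * (2 * ln s)
    \<and> (\<Prod>l\<leftarrow>ls. s\<^sup>2 + l) > 0"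
  using assms(1)
proof (induction ls)
  case (Cons l ls)
  have "s\<^sup>2 + l > 0" using Cons.prems assms(2) by (simp add: add_pos_nonneg)
  moreover have "(\<Prod>l\<leftarrow>ls. s\<^sup>2 + l) > 0" using Cons by simp
  ultimately have "ln (\<Prod>l\<leftarrow>l # ls. s\<^sup>2 + l) = ln (s\<^sup>2 + l) + ln (\<Prod>l\<leftarrow>ls. s\<^sup>2 + l) \<and>
      (\<Prod>l\<leftarrow>l # ls. s\<^sup>2 + l) > 0"
    unfolding list.map prod_list.Cons using ln_mult_pos mult_pos_pos by blast
  then show ?case using Cons by (simp add: algebra_simps del: prod_list.Cons)
qed simp

text \<open>The derivative of \<open>g\<close> is the logarithm of the quotient of the two products
  at \<open>x = s\<^sup>2\<close>, since the terms \<open>2 * ln s\<close> cancel for lists of equal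
  length. The limits of \<open>g\<close> at 0 and at infinity are 0 and \<open>pi\<close> times the
  difference of the two sums.\<close>

lemma sum_sqrt_less:
  fixes rs ss :: "real list"
  assumes rs: "\<forall>r\<in>set rs. r \<ge> 0" and ss: "\<forall>r\<in>set ss. r \<ge> 0" and len: "length rs = length ss"
    and less: "\<And>x. x > 0 \<Longrightarrow> (\<Prod>r\<leftarrow>rs. x + r) < (\<Prod>r\<leftarrow>ss. x + r)"
  shows "(\<Sum>r\<leftarrow>rs. sqrt r) < (\<Sum>r\<leftarrow>ss. sqrt r)"
proof -
  define g where "g s = (\<Sum>r\<leftarrow>ss. log_primitive r s) - (\<Sum>r\<leftarrow>rs. log_primitive r s)" for s
  have deriv: "\<exists>y. (g has_real_derivative y) (at s) \<and> y > 0" if s: "s > 0" for s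
  proof (intro exI conjI)
    show "(g has_real_derivative ((\<Sum>r\<leftarrow>ss. ln (s\<^sup>2 + r) - 2 * ln s) - (\<Sum>r\<leftarrow>rs. ln (s\<^sup>2 + r) - 2 * ln s))) (at s)"
      unfolding g_def[abs_def]
      by (intro derivative_intros has_real_derivative_sum_list log_primitive_deriv)
        (use rs ss s in auto)
    have "ln (\<Prod>r\<leftarrow>rs. s\<^sup>2 + r) < ln (\<Prod>r\<leftarrow>ss. s\<^sup>2 + r)"
      using less[of "s\<^sup>2"] s sum_list_ln[OF rs s] sum_list_ln[OF ss s] by simp
    then show "(\<Sum>r\<leftarrow>ss. ln (s\<^sup>2 + r) - 2 * ln s) - (\<Sum>r\<leftarrow>rs. ln (s\<^sup>2 + r) - 2 * ln s) > 0"
      using sum_list_ln[OF rs s] sum_list_ln[OF ss s] len by simp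
  qed
  have mono: "g s < g t" if "0 < s" "s < t" for s t
  proof (rule DERIV_pos_imp_increasing[OF that(2)])
    show "\<exists>y. (g has_real_derivative y) (at z) \<and> y > 0" if "s \<le> z" "z \<le> t" for z
      by (rule deriv) (use that \<open>0 < s\<close> in simp)
  qed
  have lim0: "(g \<longlongrightarrow> (\<Sum>r\<leftarrow>ss. 0) - (\<Sum>r\<leftarrow>rs. 0)) (at_right 0)"
    unfolding g_def[abs_def]
    by (rule tendsto_diff[OF tendsto_sum_list_real[where g = "\<lambda>_. 0"] tendsto_sum_list_real[where g = "\<lambda>_. 0"]])
      (use rs ss log_primitive_limits(1) in auto)
  then have lim0: "(g \<longlongrightarrow> 0) (at_right 0)" by simp
  have ev0: "eventually (\<lambda>s. g s \<le> g 1) (at_right 0)"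
    by (rule eventually_at_rightI[of 0 1]) (use mono[of _ 1] in \<open>auto intro: less_imp_le\<close>)
  \<comment> \<open>Limits give only weak inequalities; strictness comes from the two interior
    points 1 and 2.\<close>
  have "0 \<le> g 1" by (rule tendsto_upperbound[OF lim0 ev0]) simp
  have lim: "(g \<longlongrightarrow> (\<Sum>r\<leftarrow>ss. pi * sqrt r) - (\<Sum>r\<leftarrow>rs. pi * sqrt r)) at_top"
    unfolding g_def[abs_def]
    by (rule tendsto_diff[OF tendsto_sum_list_real[where g = "\<lambda>r. pi * sqrt r"]
          tendsto_sum_list_real[where g = "\<lambda>r. pi * sqrt r"]])
      (use rs ss log_primitive_limits(2) in auto)
  have ev: "eventually (\<lambda>s. g 2 \<le> g s) at_top"
    by (rule eventually_mono[OF eventually_gt_at_top[of 2]]) (use mono[of 2] in \<open>auto intro: less_imp_le\<close>)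
  have "g 2 \<le> (\<Sum>r\<leftarrow>ss. pi * sqrt r) - (\<Sum>r\<leftarrow>rs. pi * sqrt r)"
    by (rule tendsto_lowerbound[OF lim ev]) simp
  moreover have "g 1 < g 2" by (rule mono) auto
  ultimately have "pi * (\<Sum>r\<leftarrow>rs. sqrt r) < pi * (\<Sum>r\<leftarrow>ss. sqrt r)"
    using \<open>0 \<le> g 1\<close> unfolding sum_list_const_mult by linarith
  then show ?thesis by (simp add: mult_less_cancel_left_pos)
qed

section \<open>Energies of represented trees\<close>

lemma represents_energy:
  assumes rep: "represents G r R"
  obtains rs where "length rs = root_nodes R" "\<forall>r\<in>set rs. r \<ge> 0"
    "incidence_energy G = (\<Sum>r\<leftarrow>rs. sqrt r)"
    "\<And>x. x > 0 \<Longrightarrow> (\<Prod>r\<leftarrow>rs. x + r) = root_weight x R"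
proof -
  have simple: "simple_graph G" using represents_simple_graph[OF rep] .
  then have fin: "finite (gverts G)" "finite (gedges G)"
    using simple_graph_finite_edges by (auto simp: simple_graph_def)
  obtain vs where vs: "set vs = gverts G" "distinct vs" using finite_distinct_list[OF fin(1)] by blast
  obtain es where es: "set es = gedges G" "distinct es" using finite_distinct_list[OF fin(2)] by blast
  define A where "A = incidence_mat vs es"
  have A: "A \<in> carrier_mat (length vs) (length es)" by (simp add: A_def incidence_mat_def)
  obtain rs where rs: "length rs = length vs" "\<forall>r\<in>set rs. r \<ge> 0"
    "singular_value_sum A = (\<Sum>r\<leftarrow>rs. sqrt r)"
    "\<And>x. (\<Prod>r\<leftarrow>rs. x + r) = det (x \<cdot>\<^sub>m 1\<^sub>m (length vs) + A * transpose_mat A)"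
    using singular_values[OF A] by blast
  \<comment> \<open>Two distinct vertices share at most one edge, so the Gram matrix is the signless
    Laplacian.\<close>
  have card: "real (card {e \<in> gedges G. u \<in> e \<and> w \<in> e}) =
      (if u = w then real (gdegree G u) else if adjacent G u w then 1 else 0)" for u w
  proof (cases "u = w")
    case False
    have unique: "e = {u, w}" if "e \<in> gedges G" "u \<in> e" "w \<in> e" for e
    proof -
      have "card e = 2" using simple that(1) by (simp add: simple_graph_def)
      then obtain a b where "e = {a, b}" by (auto simp: card_2_iff)
      with that False show ?thesis by auto
    qed
    have "{e \<in> gedges G. u \<in> e \<and> w \<in> e} = (if {u, w} \<in> gedges G then {{u, w}} else {})"
    proof (cases "{u, w} \<in> gedges G")
      case True
      then have "{e \<in> gedges G. u \<in> e \<and> w \<in> e} = {{u, w}}" using unique by blast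
      with True show ?thesis by simp
    next
      case False
      then have "{e \<in> gedges G. u \<in> e \<and> w \<in> e} = {}" using unique by blast
      with False show ?thesis by simp
    qed
    with False show ?thesis by (simp add: adjacent_def)
  qed (simp add: gdegree_def)
  have "x \<cdot>\<^sub>m 1\<^sub>m (length vs) + A * transpose_mat A = fun_mat vs (signless G x)" for x
  proof (rule eq_matI)
    fix i j assume "i < dim_row (fun_mat vs (signless G x))" "j < dim_col (fun_mat vs (signless G x))"
    then have ij: "i < length vs" "j < length vs" by (auto simp: fun_mat_def)
    then have "(A * transpose_mat A) $$ (i, j) =
        (if i = j then real (gdegree G (vs ! i)) else if adjacent G (vs ! i) (vs ! j) then 1 else 0)"
      unfolding A_def incidence_mat_gram[OF es(2) ij] es(1) card
      using vs(2) by (simp add: nth_eq_iff_index_eq)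
    moreover have "(x \<cdot>\<^sub>m 1\<^sub>m (length vs) + A * transpose_mat A) $$ (i, j) =
        (x \<cdot>\<^sub>m 1\<^sub>m (length vs)) $$ (i, j) + (A * transpose_mat A) $$ (i, j)"
      using ij A by (intro index_add_mat(1)) auto
    ultimately show "(x \<cdot>\<^sub>m 1\<^sub>m (length vs) + A * transpose_mat A) $$ (i, j) = fun_mat vs (signless G x) $$ (i, j)"
      using ij vs(2) by (simp add: fun_mat_def signless_def nth_eq_iff_index_eq)
  qed (use A in \<open>auto simp: fun_mat_def\<close>)
  then have "(\<Prod>r\<leftarrow>rs. x + r) = root_weight x R" if "x > 0" for x
    using vertex_det_signless[OF rep that] vertex_det_eq[OF vs(2,1)] rs(4) by metis
  moreover have "length rs = root_nodes R"
    using rs(1) distinct_card[OF vs(2)] vs(1) represents_card[OF rep] by simp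
  moreover have "incidence_energy G = (\<Sum>r\<leftarrow>rs. sqrt r)"
    using incidence_energy_eq[OF vs(2,1) es(2,1)] rs(3) by (simp add: A_def)
  ultimately show ?thesis using that rs(2) by blast
qed

lemma represents_energy_less:
  assumes "represents G r R" "represents H s Q" "root_nodes R = root_nodes Q"
    and "\<And>x. x > 0 \<Longrightarrow> root_weight x R < root_weight x Q"
  shows "incidence_energy G < incidence_energy H"
proof -
  obtain rs where rs: "length rs = root_nodes R" "\<forall>r\<in>set rs. r \<ge> 0"
    "incidence_energy G = (\<Sum>r\<leftarrow>rs. sqrt r)"
    "\<And>x. x > 0 \<Longrightarrow> (\<Prod>r\<leftarrow>rs. x + r) = root_weight x R"
    using represents_energy[OF assms(1)] by blast
  obtain ss where ss: "length ss = root_nodes Q" "\<forall>r\<in>set ss. r \<ge> 0"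
    "incidence_energy H = (\<Sum>r\<leftarrow>ss. sqrt r)"
    "\<And>x. x > 0 \<Longrightarrow> (\<Prod>r\<leftarrow>ss. x + r) = root_weight x Q"
    using represents_energy[OF assms(2)] by blast
  show ?thesis
    unfolding rs(3) ss(3) by (rule sum_sqrt_less) (use rs ss assms(3,4) in auto)
qed

text \<open>When the numberings of vertices and edges are carried along the isomorphism, the
  incidence matrix stays literally the same.\<close>

lemma isomorphic_energy_eq:
  assumes G: "simple_graph G" and H: "simple_graph H" and iso: "graph_isomorphic G H"
  shows "incidence_energy G = incidence_energy H"
proof -
  obtain f where f: "bij_betw f (gverts G) (gverts H)"
    and adj: "\<And>a b. a \<in> gverts G \<Longrightarrow> b \<in> gverts G \<Longrightarrow> adjacent G a b \<longleftrightarrow> adjacent H (f a) (f b)"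
    using iso unfolding graph_isomorphic_def by blast
  have inj: "inj_on f (gverts G)" and img: "f ` gverts G = gverts H" using f by (auto simp: bij_betw_def)
  have sub: "e \<subseteq> gverts G" if "e \<in> gedges G" for e using simple_graph_edge[OF G that] by blast
  have pair: "\<exists>a b. e = {a, b} \<and> a \<in> gverts K \<and> b \<in> gverts K" if "simple_graph K" "e \<in> gedges K"
    for K :: "'c ugraph" and e
  proof -
    have "card e = 2" "e \<subseteq> gverts K" using that by (auto simp: simple_graph_def)
    then show ?thesis by (auto simp: card_2_iff)
  qed
  have edges: "(`) f ` gedges G = gedges H"
  proof
    show "(`) f ` gedges G \<subseteq> gedges H"
    proof
      fix e assume "e \<in> (`) f ` gedges G"
      then obtain e' where e': "e = f ` e'" "e' \<in> gedges G" by blast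
      then obtain a b where "e' = {a, b}" "a \<in> gverts G" "b \<in> gverts G" using pair[OF G] by blast
      then show "e \<in> gedges H" using e' adj[of a b] by (simp add: adjacent_def)
    qed
    show "gedges H \<subseteq> (`) f ` gedges G"
    proof
      fix e assume e: "e \<in> gedges H"
      then obtain a b where ab: "e = {a, b}" "a \<in> f ` gverts G" "b \<in> f ` gverts G"
        using pair[OF H e] img by auto
      then obtain a' b' where a': "a = f a'" "a' \<in> gverts G" and b': "b = f b'" "b' \<in> gverts G" by blast
      then have "{a', b'} \<in> gedges G" using adj[of a' b'] e ab(1) by (simp add: adjacent_def)
      moreover have "e = f ` {a', b'}" using ab(1) a' b' by simp
      ultimately show "e \<in> (`) f ` gedges G" by blast
    qed
  qed
  have inj': "inj_on ((`) f) (gedges G)"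
    using inj sub by (intro inj_onI) (metis inj_on_image_eq_iff)
  have "finite (gverts G)" "finite (gedges G)"
    using G simple_graph_finite_edges by (auto simp: simple_graph_def)
  then obtain vs es where vs: "set vs = gverts G" "distinct vs" and es: "set es = gedges G" "distinct es"
    using finite_distinct_list by metis
  have "f (vs ! i) \<in> f ` (es ! j) \<longleftrightarrow> vs ! i \<in> es ! j" if "i < length vs" "j < length es" for i j
    using inj_on_image_mem_iff[OF inj _ sub] vs(1) es(1) nth_mem[OF that(1)] nth_mem[OF that(2)] by simp
  then have "incidence_mat (map f vs) (map ((`) f) es) = incidence_mat vs es"
    by (auto simp: incidence_mat_def intro!: cong_mat)
  moreover have "incidence_energy H = singular_value_sum (incidence_mat (map f vs) (map ((`) f) es))"
    by (rule incidence_energy_eq) (use vs es inj inj' img edges in \<open>auto simp: distinct_map\<close>)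
  moreover have "incidence_energy G = singular_value_sum (incidence_mat vs es)"
    by (rule incidence_energy_eq) (use vs es in auto)
  ultimately show ?thesis by simp
qed

section \<open>Existence of greedy trees and the conclusion\<close>

lemma regular_exists: "d \<ge> 1 \<Longrightarrow> \<exists>t. regular d t \<and> nodes t = k"
proof (induction k)
  case 0
  show ?case by (rule exI[of _ Void]) simp
next
  case (Suc k)
  then obtain t where t: "regular d t" "nodes t = k" by blast
  \<comment> \<open>The witness is a path, with voids in all other slots.\<close>
  have "regular d (Node (add_mset t (replicate_mset (d - 1) Void)))"
    using t Suc.prems by (auto split: if_splits)
  moreover have "nodes (Node (add_mset t (replicate_mset (d - 1) Void))) = Suc k"
    using t by simp
  ultimately show ?case by blast
qed

text \<open>Instead of an explicit construction: start from any regular tree with \<open>n\<close>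
  nodes, minimise the root weight at the arbitrary value \<open>x = 1\<close>, and move the root to
  the centre.\<close>

lemma greedy_tree_exists:
  assumes d: "d \<ge> 1" and n: "n \<ge> d + 2"
  shows "\<exists>S :: nat ugraph. greedy_tree n d S"
proof -
  obtain t where t: "regular d t" "nodes t = n - 1" using regular_exists[OF d] by blast
  have "root_regular d (add_mset t (replicate_mset d Void))"
    using t by (auto simp: root_regular_def split: if_splits)
  then obtain R where R: "optimal 1 d R" "root_nodes R = root_nodes (add_mset t (replicate_mset d Void))"
    by (rule optimal_exists)
  obtain R' where R': "reroot\<^sup>*\<^sup>* R R'" "root_greedy d R'"
    by (rule optimal_imp_greedy[OF _ d R(1)]) simp_all
  have nodes: "root_nodes R' = n"
    using root_nodes_reroot[OF R'(1)] R(2) t n by (simp add: root_nodes_def)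
  obtain S :: "nat ugraph" and v where S: "represents S v R'"
    using represents_exists[of "{}"] by blast
  have "greedy_rooted d S v"
    using root_greedy_imp_greedy_rooted[OF R'(2) S _ d] nodes n by simp
  then show ?thesis
    using represents_card[OF S] nodes by (auto simp: greedy_tree_def)
qed

lemma max_degree_ge: "finite (gverts G) \<Longrightarrow> a \<in> gverts G \<Longrightarrow> gdegree G a \<le> max_degree G"
  by (simp add: max_degree_def)

text \<open>The first conjunct keeps the statement about greedy trees from being vacuous; its
  witness lives on \<open>nat\<close>, while \<open>S\<close> and \<open>T\<close> may have
  different vertex types.\<close>

theorem theorem1p4:
  fixes d n :: nat
  assumes "d \<ge> 1"
  shows "(n \<ge> d + 2 \<longrightarrow> (\<exists>S :: nat ugraph. greedy_tree n d S)) \<and>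
    (\<forall>S :: 'a ugraph. greedy_tree n d S \<longrightarrow>
       S \<in> trees_of_order_max_degree n (d + 1) \<and>
       (\<forall>T \<in> (trees_of_order_max_degree n (d + 1) :: 'b ugraph set).
          incidence_energy S \<le> incidence_energy T \<and>
          (incidence_energy S = incidence_energy T \<longleftrightarrow> graph_isomorphic S T)))"
proof (intro conjI impI allI ballI)
  show "\<exists>S :: nat ugraph. greedy_tree n d S" if "n \<ge> d + 2"
    using greedy_tree_exists[OF assms that] .
next
  fix S :: "'a ugraph" assume "greedy_tree n d S"
  then show "S \<in> trees_of_order_max_degree n (d + 1)"
    by (auto simp: greedy_tree_def greedy_rooted_def trees_of_order_max_degree_def)
next
  fix S :: "'a ugraph" and T :: "'b ugraph"
  assume S: "greedy_tree n d S" and T: "T \<in> trees_of_order_max_degree n (d + 1)"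
  obtain r where r: "greedy_rooted d S r" using S by (auto simp: greedy_tree_def)
  have treeS: "is_tree S" "r \<in> gverts S" "max_degree S = d + 1" "card (gverts S) = n"
    using r S by (auto simp: greedy_rooted_def greedy_tree_def)
  have treeT: "is_tree T" "max_degree T = d + 1" "card (gverts T) = n"
    using T by (auto simp: trees_of_order_max_degree_def)
  have simple: "simple_graph S" "simple_graph T" using treeS(1) treeT(1) by (auto simp: is_tree_def)
  then have fin: "finite (gverts S)" "finite (gverts T)" by (auto simp: simple_graph_def)
  have "gdegree S a \<le> Suc d" if "a \<in> gverts S" for a
    using max_degree_ge[OF fin(1) that] treeS(3) by simp
  then obtain R where R: "represents S r R" "root_regular d R"
    using tree_represents[OF treeS(1,2)] by blast
  have greedy: "root_greedy d R" using greedy_rooted_imp_root_greedy[OF r R assms] .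
  obtain t where t: "t \<in> gverts T"
    using treeT(1) by (auto simp: is_tree_def connected_graph_def)
  have "gdegree T a \<le> Suc d" if "a \<in> gverts T" for a
    using max_degree_ge[OF fin(2) that] treeT(2) by simp
  then obtain Q where Q: "represents T t Q" "root_regular d Q"
    using tree_represents[OF treeT(1) t] by blast
  have nodes: "root_nodes R = root_nodes Q"
    using represents_card[OF R(1)] represents_card[OF Q(1)] treeS(4) treeT(3) by simp
  have opt: "optimal x d R" if "x > 0" for x
    using greedy_optimal[OF that assms greedy] .
  \<comment> \<open>Equal root weights at a single \<open>x\<close> already make \<open>Q\<close>
    optimal, and then \<open>T\<close> is isomorphic to \<open>S\<close>. So without an isomorphism
    the inequality is strict at every \<open>x\<close>.\<close>
  have less: "incidence_energy S < incidence_energy T" if noniso: "\<not> graph_isomorphic S T"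
  proof (rule represents_energy_less[OF R(1) Q(1) nodes])
    fix x :: real assume x: "x > 0"
    have "root_weight x R \<le> root_weight x Q"
      using opt[OF x] Q(2) nodes unfolding optimal_def by metis
    moreover have "root_weight x R \<noteq> root_weight x Q"
    proof
      assume "root_weight x R = root_weight x Q"
      then have "optimal x d Q" using opt[OF x] Q(2) nodes unfolding optimal_def by metis
      then obtain Q' where Q': "reroot\<^sup>*\<^sup>* Q Q'" "root_greedy d Q'"
        by (rule optimal_imp_greedy[OF x assms])
      have "R = Q'"
        using root_greedy_unique[OF assms greedy Q'(2)] root_nodes_reroot[OF Q'(1)] nodes by metis
      then obtain t' where t': "represents T t' R"
        using represents_reroot[OF Q'(1) Q(1)] by blast
      have "graph_isomorphic S T" by (rule represents_same_isomorphic[OF R(1) t'])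
      with noniso show False by contradiction
    qed
    ultimately show "root_weight x R < root_weight x Q" by simp
  qed
  have eq: "incidence_energy S = incidence_energy T" if "graph_isomorphic S T"
    using isomorphic_energy_eq[OF simple that] .
  show "incidence_energy S \<le> incidence_energy T"
    using less eq by fastforce
  show "incidence_energy S = incidence_energy T \<longleftrightarrow> graph_isomorphic S T"
    using less eq by fastforce
qed

end
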